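(* Let $\gamma$ be a Jordan curve of $\mathbb{R}^2$ of class $\mathcal{C}_2$ enclosing a connected, compact and bounded set $\Omega$ of $\mathbb{R}^2$ (so that $\gamma=\partial\Omega$). Let $s$ be a point of $\gamma$. For each $N\ge 1$ let $\sigma$ be the spin configuration associated to $\gamma$ at step $N$, i.e. $\sigma(x)=+1$ if $\Lambda_{x/N}\cap\Omega\neq\emptyset$ and $\sigma(x)=-1$ otherwise ($x\in\mathbb{Z}^2$). Then $$\lim_{r\to 0}\,\lim_{\delta\to 0}\,\liminf_{N\to+\infty}\frac{1}{2r}\mathbf{A}^{\sigma,\gamma}_N(s,r,\delta)=\lim_{r\to 0}\,\lim_{\delta\to 0}\,\limsup_{N\to+\infty}\frac{1}{2r}\mathbf{A}^{\sigma,\gamma}_N(s,r,\delta)=-\frac12\,|\cos 2\theta|\,\xi_\gamma(s),$$ where $\xi_\gamma(s)$ is the curvature of $\gamma$ at $s$ and $\theta$ is the angle between the horizontal axis and the tangent to $\gamma$ at $s$.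
   Context: Boxes. For $N\ge1$ and $x=(x_1,x_2)\in\mathbb{Z}^2$, $\Lambda_{x/N}=\{(u_1,u_2)\in\mathbb{R}^2: -\frac1{2N}\le u_i-\frac{x_i}{N}<\frac1{2N},\ i=1,2\}$. For a bounded set $S\subset\mathbb{R}^2$, $S_N$ is the union of all boxes $\Lambda_{x/N}$, $x\in\mathbb{Z}^2$, with $\Lambda_{x/N}\cap S\ne\emptyset$. Dynamics. $(\sigma_t)_{t\ge0}$ is the zero-temperature 2D stochastic Ising model: the continuous-time Markov process on $\{-1,+1\}^{\mathbb{Z}^2}$ with generator $(Lf)(\sigma)=\sum_{x\in\mathbb{Z}^2}c(x,\sigma)(f(\sigma^x)-f(\sigma))$ on local functions, where $\sigma^x$ is $\sigma$ with the spin at $x$ flipped, and $c(x,\sigma)$ equals $1$ if more than 2 of the 4 nearest neighbours of $x$ have spin opposite to $\sigma(x)$, $\frac12$ if exactly 2 do, and $0$ otherwise. $\mathbb{E}_\sigma$ is the expectation for the process started from $\sigma$. Droplet. $\mathcal{A}^{\sigma}_N=\bigcup_{x\in\mathbb{Z}^2,\ \sigma(x)=+1}\Lambda_{x/N}$; $\mathrm{vol}$ is planar Lebesgue measure. Averaged drift. $B(p,\rho)$ is the closed Euclidean ball. For $s\in\gamma$ and $r>0$ so small that $\partial B(s,r)\cap\gamma$ consists of exactly two points $x_0,x_1$ (named so that $x_0,s,x_1$ are arranged counterclockwise along $\gamma$), put $\mathcal{S}(s,r,\alpha_1,\alpha_2)=B(s,r)\cup B(x_0,\alpha_1)\cup B(x_1,\alpha_2)$,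 $\mathcal{S}_N=(\mathcal{S}(s,r,\alpha_1,\alpha_2))_N$, $$L_N^{\sigma,\gamma}(s,r,\alpha_1,\alpha_2)=\lim_{t\to0}\frac1t\Big(\mathbb{E}_\sigma\big(\mathrm{vol}(\mathcal{A}_N^{\sigma_{tN^2}}\cap\mathcal{S}_N)\big)-\mathrm{vol}(\mathcal{A}_N^\sigma\cap\mathcal{S}_N)\Big),$$ $$\mathbf{A}_N^{\sigma,\gamma}(s,r,\delta)=\frac1{\delta^2}\int_0^\delta\int_0^\delta L_N^{\sigma,\gamma}(s,r,\alpha_1,\alpha_2)\,d\alpha_1\,d\alpha_2.$$ Curvature. For a counterclockwise regular parametrization $t\mapsto(x(t),y(t))$ of $\gamma$, the curvature at the point of parameter $t$ is $\xi_\gamma=\frac{x'(t)y''(t)-x''(t)y'(t)}{(x'(t)^2+y'(t)^2)^{3/2}}$. *)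

theory Defs
  imports "HOL-Probability.Probability" "HOL-Complex_Analysis.Complex_Analysis"
begin

text \<open>The Euclidean plane is represented by \<^typ>\<open>complex\<close>, for which the library has the
  Jordan curve theorem and winding numbers; planar Lebesgue measure is \<^term>\<open>lborel :: complex measure\<close>.\<close>

section \<open>Zero-temperature stochastic Ising model\<close>

datatype spin = Plus | Minus

type_synonym site = "int \<times> int"
type_synonym config = "site \<Rightarrow> spin"

definition neighbours :: "site \<Rightarrow> site set" where
  "neighbours x = {(fst x + 1, snd x), (fst x - 1, snd x), (fst x, snd x + 1), (fst x, snd x - 1)}"

definition flip_at :: "site \<Rightarrow> config \<Rightarrow> config" where
  "flip_at x \<sigma> = \<sigma>(x := (if \<sigma> x = Plus then Minus else Plus))"

definition flip_rate :: "site \<Rightarrow> config \<Rightarrow> real" where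
  "flip_rate x \<sigma> =
     (let k = card {y \<in> neighbours x. \<sigma> y \<noteq> \<sigma> x}
      in if k > 2 then 1 else if k = 2 then 1 / 2 else 0)"

definition local_function :: "(config \<Rightarrow> real) \<Rightarrow> bool" where
  "local_function f \<longleftrightarrow>
     (\<exists>F. finite F \<and> (\<forall>\<sigma> \<tau>. (\<forall>x\<in>F. \<sigma> x = \<tau> x) \<longrightarrow> f \<sigma> = f \<tau>))"

text \<open>For a local function only finitely many terms of the sum are nonzero.\<close>

definition ising_generator :: "(config \<Rightarrow> real) \<Rightarrow> config \<Rightarrow> real" where
  "ising_generator f \<sigma> = (\<Sum>\<^sub>\<infinity>x. flip_rate x \<sigma> * (f (flip_at x \<sigma>) - f \<sigma>))"

definition config_space :: "config measure" where
  "config_space = PiM UNIV (\<lambda>_. count_space UNIV)"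

definition natural_filtration ::
    "'w measure \<Rightarrow> 's measure \<Rightarrow> (real \<Rightarrow> 'w \<Rightarrow> 's) \<Rightarrow> real \<Rightarrow> 'w measure" where
  "natural_filtration W S X s =
     sigma (space W) {X u -` B \<inter> space W | u B. 0 \<le> u \<and> u \<le> s \<and> B \<in> sets S}"

text \<open>A time-homogeneous Markov process on the state space \<open>S\<close>: the coordinates \<open>X t\<close> live on
  one measurable space \<open>W\<close>, and \<open>P \<sigma>\<close> is the law on \<open>W\<close> of the process started from \<open>\<sigma>\<close>.
  The expectation \<open>E\<^sub>\<sigma>\<close> is integration against \<open>P \<sigma>\<close>.\<close>

definition markov_process ::
    "'s measure \<Rightarrow> 'w measure \<Rightarrow> ('s \<Rightarrow> 'w measure) \<Rightarrow> (real \<Rightarrow> 'w \<Rightarrow> 's) \<Rightarrow> bool" where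
  "markov_process S W P X \<longleftrightarrow>
     P \<in> S \<rightarrow>\<^sub>M prob_algebra W \<and>
     (\<forall>t\<ge>0. X t \<in> W \<rightarrow>\<^sub>M S) \<and>
     (\<forall>\<sigma>\<in>space S. AE \<omega> in P \<sigma>. X 0 \<omega> = \<sigma>) \<and>
     (\<forall>\<sigma>\<in>space S. \<forall>s\<ge>0. \<forall>t\<ge>0. \<forall>B\<in>sets S.
        AE \<omega> in P \<sigma>.
          real_cond_exp (P \<sigma>) (natural_filtration W S X s)
            (\<lambda>\<omega>. indicator B (X (s + t) \<omega>)) \<omega>
          = measure (P (X s \<omega>)) {\<omega>' \<in> space W. X t \<omega>' \<in> B})"

text \<open>The generator is the derivative at time zero, in supremum norm, of the transition semigroup.
  Since the rates are bounded and of finite range, its values on local functions determine the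
  transition semigroup.\<close>

definition stochastic_ising ::
    "'w measure \<Rightarrow> (config \<Rightarrow> 'w measure) \<Rightarrow> (real \<Rightarrow> 'w \<Rightarrow> config) \<Rightarrow> bool" where
  "stochastic_ising W P X \<longleftrightarrow>
     markov_process config_space W P X \<and>
     (\<forall>f. local_function f \<longrightarrow>
        uniform_limit UNIV (\<lambda>t \<sigma>. ((\<integral>\<omega>. f (X t \<omega>) \<partial>P \<sigma>) - f \<sigma>) / t)
          (ising_generator f) (at_right 0))"

section \<open>Boxes and droplets\<close>

definition cell :: "nat \<Rightarrow> site \<Rightarrow> complex set" where
  "cell N x = {u. - 1 / (2 * real N) \<le> Re u - of_int (fst x) / real N \<and>
                  Re u - of_int (fst x) / real N < 1 / (2 * real N) \<and>
                  - 1 / (2 * real N) \<le> Im u - of_int (snd x) / real N \<and>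
                  Im u - of_int (snd x) / real N < 1 / (2 * real N)}"

definition discretize :: "nat \<Rightarrow> complex set \<Rightarrow> complex set" where
  "discretize N S = \<Union>{cell N x | x. cell N x \<inter> S \<noteq> {}}"

definition droplet :: "nat \<Rightarrow> config \<Rightarrow> complex set" where
  "droplet N \<sigma> = (\<Union>x\<in>{x. \<sigma> x = Plus}. cell N x)"

definition initial_config :: "nat \<Rightarrow> complex set \<Rightarrow> config" where
  "initial_config N \<Omega> x = (if cell N x \<inter> \<Omega> \<noteq> {} then Plus else Minus)"

section \<open>Curves\<close>

text \<open>A Jordan curve of class \<open>C\<^sub>2\<close>, given by a counterclockwise regular parametrization. It is
  defined on the whole line with period 1, so that smoothness includes the closing point; as a path,
  it is considered on the unit interval.\<close>

definition C2_jordan_curve :: "(real \<Rightarrow> complex) \<Rightarrow> bool" where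
  "C2_jordan_curve \<gamma> \<longleftrightarrow>
     (\<forall>t. \<gamma> (t + 1) = \<gamma> t) \<and>
     simple_path \<gamma> \<and>
     \<gamma> C1_differentiable_on UNIV \<and>
     (\<lambda>t. vector_derivative \<gamma> (at t)) C1_differentiable_on UNIV \<and>
     (\<forall>t. vector_derivative \<gamma> (at t) \<noteq> 0) \<and>
     (\<forall>z \<in> inside (path_image \<gamma>). winding_number \<gamma> z = 1)"

text \<open>The last condition is needed because the curve itself is a compact connected set whose frontier
  is the curve.\<close>

definition encloses :: "(real \<Rightarrow> complex) \<Rightarrow> complex set \<Rightarrow> bool" where
  "encloses \<gamma> \<Omega> \<longleftrightarrow>
     connected \<Omega> \<and> compact \<Omega> \<and> frontier \<Omega> = path_image \<gamma> \<and> inside (path_image \<gamma>) \<subseteq> \<Omega>"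

definition curvature :: "(real \<Rightarrow> complex) \<Rightarrow> real \<Rightarrow> real" where
  "curvature \<gamma> t =
     (let d1 = vector_derivative \<gamma> (at t);
          d2 = vector_derivative (\<lambda>u. vector_derivative \<gamma> (at u)) (at t)
      in (Re d1 * Im d2 - Re d2 * Im d1) / ((Re d1)\<^sup>2 + (Im d1)\<^sup>2) powr (3 / 2))"

definition ordered_along :: "(real \<Rightarrow> complex) \<Rightarrow> complex \<Rightarrow> complex \<Rightarrow> complex \<Rightarrow> bool" where
  "ordered_along \<gamma> p q w \<longleftrightarrow>
     (\<exists>a b c. a < b \<and> b < c \<and> c < a + 1 \<and> \<gamma> a = p \<and> \<gamma> b = q \<and> \<gamma> c = w)"

text \<open>The pair \<open>(x\<^sub>0, x\<^sub>1)\<close>; only meaningful for \<open>r\<close> so small that the circle meets the curve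
  in exactly two points.\<close>

definition crossings :: "(real \<Rightarrow> complex) \<Rightarrow> complex \<Rightarrow> real \<Rightarrow> complex \<times> complex" where
  "crossings \<gamma> s r =
     (THE p. fst p \<noteq> snd p \<and> sphere s r \<inter> path_image \<gamma> = {fst p, snd p} \<and>
             ordered_along \<gamma> (fst p) s (snd p))"

section \<open>Averaged drift\<close>

definition window :: "(real \<Rightarrow> complex) \<Rightarrow> complex \<Rightarrow> real \<Rightarrow> real \<Rightarrow> real \<Rightarrow> complex set" where
  "window \<gamma> s r \<alpha>1 \<alpha>2 =
     cball s r \<union> cball (fst (crossings \<gamma> s r)) \<alpha>1 \<union> cball (snd (crossings \<gamma> s r)) \<alpha>2"

definition drift ::
    "(config \<Rightarrow> 'w measure) \<Rightarrow> (real \<Rightarrow> 'w \<Rightarrow> config) \<Rightarrow> nat \<Rightarrow> config \<Rightarrow> (real \<Rightarrow> complex) \<Rightarrow>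
     complex \<Rightarrow> real \<Rightarrow> real \<Rightarrow> real \<Rightarrow> real" where
  "drift P X N \<sigma> \<gamma> s r \<alpha>1 \<alpha>2 =
     (let S\<^sub>N = discretize N (window \<gamma> s r \<alpha>1 \<alpha>2)
      in Lim (at_right 0) (\<lambda>t.
           1 / t * ((\<integral>\<omega>. measure lborel (droplet N (X (t * (real N)\<^sup>2) \<omega>) \<inter> S\<^sub>N) \<partial>P \<sigma>)
                    - measure lborel (droplet N \<sigma> \<inter> S\<^sub>N))))"

definition averaged_drift ::
    "(config \<Rightarrow> 'w measure) \<Rightarrow> (real \<Rightarrow> 'w \<Rightarrow> config) \<Rightarrow> nat \<Rightarrow> config \<Rightarrow> (real \<Rightarrow> complex) \<Rightarrow>
     complex \<Rightarrow> real \<Rightarrow> real \<Rightarrow> real" where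
  "averaged_drift P X N \<sigma> \<gamma> s r \<delta> =
     1 / \<delta>\<^sup>2 * (LINT \<alpha>1:{0..\<delta>}|lborel. (LINT \<alpha>2:{0..\<delta>}|lborel. drift P X N \<sigma> \<gamma> s r \<alpha>1 \<alpha>2))"

text \<open>\<open>lim\<^bsub>r\<rightarrow>0\<^esub> lim\<^bsub>\<delta>\<rightarrow>0\<^esub> f r \<delta> = l\<close>, including the existence of the inner limit for all
  sufficiently small \<open>r > 0\<close>.\<close>

definition has_iterated_limit :: "(real \<Rightarrow> real \<Rightarrow> ereal) \<Rightarrow> ereal \<Rightarrow> bool" where
  "has_iterated_limit f l \<longleftrightarrow>
     (\<exists>g. (\<forall>\<^sub>F r in at_right 0. (f r \<longlongrightarrow> g r) (at_right 0)) \<and> (g \<longlongrightarrow> l) (at_right 0))"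

end

theory Submission
  imports Defs
begin

text \<open>A flip changes the volume of the droplet by the area of one cell, so the generator, evaluated at
  time zero and rescaled by \<open>N\<^sup>2\<close>, gives the drift as a finite sum of signed flip rates over the
  cells of the window. Averaging over the two outer radii only replaces the indicator of the window by
  a weight: it is one on the cells that meet the disc, and near an end point it decreases linearly
  with the distance from that point (\<open>averaged_drift_eq\<close>).

  Suppose that near \<open>s\<close> the curve is a graph over the horizontal axis, with slopes at most one in
  absolute value or, if the tangent is diagonal, monotone. The configuration is then described by
  column heights. A site with \<open>k\<close> disagreeing neighbours, \<open>1 \<le> k \<le> 3\<close>, flips at rate
  \<open>(k - 1) / 2\<close>, one half for each horizontal neighbour across the interface. The signed
  sum over a column is therefore one half of the sum of the signs of the height differences to the two
  adjacent columns, a kind of discrete Laplacian, and summation by parts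
  (\<open>sum_signed_rate_heap\<close>) turns it into one half of the sum, over the steps of the interface,
  of the sign of the step times the difference of the weights of the two sites that face each other
  at the step. The weight is constant except near the two ends of the arc, and only the ends remain.

  At an end where the tangent makes the angle \<open>\<phi>\<close> with the axis, a step of height \<open>D\<close>
  moves the corner by \<open>(1, D - sgn D)\<close>, which changes the weight by its projection on the tangent
  direction. The heights telescope, whatever the arithmetic of the slope may be, and the end
  contributes one half of \<open>sin \<phi> * cos \<phi>\<close> if the slope is at most one in absolute value; beyond
  that the contribution is one half of the complementary fraction, up to sign (\<open>tilt\<close>, \<open>end_sum\<close>). For the
  slopes one and minus one several step sizes occur together, but then the two coordinates of a
  displacement have projections of the same length and the pattern of steps does not matter
  (\<open>step_pattern\<close>). So for fixed \<open>r\<close> the inner limits give one half of the difference of the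
  tilts at the two end points, up to the sign that tells on which side the region lies
  (\<open>local_drift\<close>). Dividing by \<open>2 * r\<close> and letting \<open>r\<close> tend to zero differentiates the tilt
  along the curve: the derivative of \<open>sin \<phi> * cos \<phi>\<close> with respect to the angle is
  \<open>cos (2 * \<phi>)\<close>, and that of the angle with respect to arc length is the curvature. For a diagonal
  tangent the derivatives of both branches vanish, in agreement with \<open>cos (2 * \<phi>) = 0\<close>.

  For a Jordan curve one takes the axis that is closer to the tangent, which amounts to a reflection
  in the diagonal, a symmetry of the dynamics. That the region lies on the left of a curve of winding
  number one is read off from the jump of the winding number across the curve
  (\<open>left_side_inside\<close>).\<close>

section \<open>The drift as a weighted sum of flip rates\<close>

text \<open>The expected rate of change of the number of plus spins at one site.\<close>

definition signed_rate :: "config \<Rightarrow> site \<Rightarrow> real" where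
  "signed_rate \<sigma> x = (if \<sigma> x = Plus then - flip_rate x \<sigma> else flip_rate x \<sigma>)"

lemma mem_cell_iff:
  assumes "N > 0"
  shows "u \<in> cell N x \<longleftrightarrow> fst x = \<lfloor>real N * Re u + 1/2\<rfloor> \<and> snd x = \<lfloor>real N * Im u + 1/2\<rfloor>"
proof -
  have *: "(- 1 / (2 * real N) \<le> v - of_int j / real N \<and> v - of_int j / real N < 1 / (2 * real N))
      \<longleftrightarrow> j = \<lfloor>real N * v + 1/2\<rfloor>" for v :: real and j :: int
  proof -
    have "(- 1 / (2 * real N) \<le> v - of_int j / real N) \<longleftrightarrow> of_int j \<le> real N * v + 1/2"
      using assms by (simp add: field_simps)
    moreover have "(v - of_int j / real N < 1 / (2 * real N)) \<longleftrightarrow> real N * v + 1/2 < of_int j + 1"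
      using assms mult_less_cancel_left_pos[of "real N" "v - of_int j / real N" "1 / (2 * real N)"]
      by (simp add: right_diff_distrib) linarith
    ultimately show ?thesis by (metis floor_eq_iff)
  qed
  show ?thesis
    unfolding cell_def mem_Collect_eq using *[of "Re u" "fst x"] *[of "Im u" "snd x"] by blast
qed

definition centre :: "nat \<Rightarrow> site \<Rightarrow> complex" where
  "centre N x = Complex (of_int (fst x) / real N) (of_int (snd x) / real N)"

lemma centre_in_cell: "N > 0 \<Longrightarrow> centre N x \<in> cell N x"
  by (auto simp: mem_cell_iff centre_def)

lemma dist_centre_cell:
  assumes "N > 0" "u \<in> cell N x"
  shows "dist u (centre N x) \<le> 1 / N"
proof -
  have "\<bar>Re (u - centre N x)\<bar> \<le> 1 / (2 * real N)" "\<bar>Im (u - centre N x)\<bar> \<le> 1 / (2 * real N)"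
    using assms(2) by (auto simp: cell_def centre_def)
  moreover have "cmod (u - centre N x) \<le> \<bar>Re (u - centre N x)\<bar> + \<bar>Im (u - centre N x)\<bar>"
    by (rule cmod_le)
  ultimately show ?thesis by (simp add: dist_norm)
qed

lemma cell_disjoint: "N > 0 \<Longrightarrow> x \<noteq> y \<Longrightarrow> cell N x \<inter> cell N y = {}"
  by (auto simp: mem_cell_iff prod_eq_iff)

lemma cell_borel [measurable]: "cell N x \<in> sets borel"
proof -
  have "cell N x = {u \<in> space borel. - 1 / (2 * real N) \<le> Re u - of_int (fst x) / real N \<and>
                  Re u - of_int (fst x) / real N < 1 / (2 * real N) \<and>
                  - 1 / (2 * real N) \<le> Im u - of_int (snd x) / real N \<and>
                  Im u - of_int (snd x) / real N < 1 / (2 * real N)}"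
    by (simp add: cell_def)
  also have "\<dots> \<in> sets borel" by measurable
  finally show ?thesis .
qed

text \<open>A half-open cell lies between an open and a closed box with the same sides.\<close>

lemma emeasure_cell:
  assumes "N > 0"
  shows "emeasure lborel (cell N x) = ennreal (1 / (real N)\<^sup>2)"
proof -
  define a where "a = centre N x - Complex (1/(2*real N)) (1/(2*real N))"
  define b where "b = centre N x + Complex (1/(2*real N)) (1/(2*real N))"
  have le: "\<And>i. i \<in> Basis \<Longrightarrow> a \<bullet> i \<le> b \<bullet> i"
    using assms by (auto simp: a_def b_def Basis_complex_def inner_complex_def)
  have p: "(\<Prod>i\<in>Basis. (b - a) \<bullet> i) = 1 / (real N)\<^sup>2"
    using assms by (simp add: a_def b_def Basis_complex_def inner_complex_def power2_eq_square field_simps)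
  have "box a b \<subseteq> cell N x" "cell N x \<subseteq> cbox a b"
    by (auto simp: in_box_complex_iff in_cbox_complex_iff cell_def a_def b_def centre_def)
  then have "emeasure lborel (box a b) \<le> emeasure lborel (cell N x)"
     "emeasure lborel (cell N x) \<le> emeasure lborel (cbox a b)"
    by (auto intro!: emeasure_mono)
  then show ?thesis using p le by (simp add: emeasure_lborel_box emeasure_lborel_cbox)
qed

lemma finite_cells_meeting_bounded:
  assumes "N > 0" "bounded S"
  shows "finite {x. cell N x \<inter> S \<noteq> {}}"
proof -
  obtain B where B: "\<And>z. z \<in> S \<Longrightarrow> cmod z \<le> B" using assms(2) by (auto simp: bounded_iff)
  have "{x. cell N x \<inter> S \<noteq> {}} \<subseteq> {\<lfloor>- (real N * B)\<rfloor>..\<lceil>real N * B + 1\<rceil>} \<times> {\<lfloor>- (real N * B)\<rfloor>..\<lceil>real N * B + 1\<rceil>}"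
  proof
    fix x assume "x \<in> {x. cell N x \<inter> S \<noteq> {}}"
    then obtain u where u: "u \<in> cell N x" "u \<in> S" by auto
    have *: "\<lfloor>real N * v + 1/2\<rfloor> \<in> {\<lfloor>- (real N * B)\<rfloor>..\<lceil>real N * B + 1\<rceil>}" if "\<bar>v\<bar> \<le> B" for v
    proof -
      have "\<bar>real N * v\<bar> \<le> real N * B" using that by (simp add: abs_mult mult_left_mono)
      then have "- (real N * B) \<le> real N * v + 1/2" "real N * v + 1/2 \<le> real N * B + 1" by linarith+
      then show ?thesis by (auto intro: floor_mono) linarith
    qed
    have "\<bar>Re u\<bar> \<le> B" "\<bar>Im u\<bar> \<le> B" using B[OF u(2)] abs_Re_le_cmod[of u] abs_Im_le_cmod[of u] by linarith+
    then show "x \<in> {\<lfloor>- (real N * B)\<rfloor>..\<lceil>real N * B + 1\<rceil>} \<times> {\<lfloor>- (real N * B)\<rfloor>..\<lceil>real N * B + 1\<rceil>}"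
      using u(1) * by (auto simp: mem_cell_iff[OF assms(1)] mem_Times_iff)
  qed
  then show ?thesis using finite_subset by blast
qed

lemma droplet_volume:
  assumes "N > 0" "bounded S"
  shows "measure lborel (droplet N \<sigma> \<inter> discretize N S)
    = (\<Sum>x\<in>{x. cell N x \<inter> S \<noteq> {}}. (if \<sigma> x = Plus then 1 else 0)) / (real N)\<^sup>2"
proof -
  define F where "F = {x. cell N x \<inter> S \<noteq> {}}"
  have F: "finite F" unfolding F_def by (rule finite_cells_meeting_bounded[OF assms])
  have "droplet N \<sigma> \<inter> discretize N S = (\<Union>x\<in>F \<inter> {x. \<sigma> x = Plus}. cell N x)"
  proof -
    have "x = y" if "u \<in> cell N x" "u \<in> cell N y" for u x y
      using cell_disjoint[OF assms(1), of x y] that by auto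
    then show ?thesis
      unfolding droplet_def discretize_def F_def by blast
  qed
  moreover have "measure lborel (\<Union>x\<in>F \<inter> {x. \<sigma> x = Plus}. cell N x) 
     = (\<Sum>x\<in>F \<inter> {x. \<sigma> x = Plus}. measure lborel (cell N x))"
    using F assms(1) by (intro measure_finite_Union)
      (auto simp: disjoint_family_on_def cell_disjoint emeasure_cell)
  moreover have "measure lborel (cell N x) = 1 / (real N)\<^sup>2" for x
    using emeasure_cell[OF assms(1), of x] by (simp add: measure_def)
  ultimately show ?thesis unfolding F_def[symmetric]
    using F by (simp add: sum.If_cases sum_divide_distrib)
qed

text \<open>The volume of the droplet in a bounded window has this form, with \<open>c = N\<^sup>2\<close>.\<close>

lemma ising_generator_occupation:
  assumes "finite F"
  shows "ising_generator (\<lambda>\<sigma>. (\<Sum>x\<in>F. (if \<sigma> x = Plus then 1 else 0)) / c) \<sigma> = (\<Sum>x\<in>F. signed_rate \<sigma> x) / c"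
proof -
  define f where "f \<sigma> = (\<Sum>x\<in>F. (if \<sigma> x = Plus then 1 else 0)) / c" for \<sigma> :: config
  have diff: "f (flip_at x \<sigma>) - f \<sigma> = (if x \<in> F then (if \<sigma> x = Plus then - 1 else 1) / c else 0)" for x
  proof -
    have "f (flip_at x \<sigma>) - f \<sigma> = (\<Sum>y\<in>F. (if flip_at x \<sigma> y = Plus then 1 else 0) - (if \<sigma> y = Plus then 1 else 0)) / c"
      by (simp add: f_def sum_subtractf diff_divide_distrib)
    also have "(\<Sum>y\<in>F. (if flip_at x \<sigma> y = Plus then 1 else 0) - (if \<sigma> y = Plus then 1 else 0))
      = (\<Sum>y\<in>F. if y = x then (if \<sigma> x = Plus then - 1 else 1 :: real) else 0)"
      by (intro sum.cong) (auto simp: flip_at_def)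
    also have "\<dots> = (if x \<in> F then (if \<sigma> x = Plus then - 1 else 1) else 0)"
      using assms by simp
    finally show ?thesis by simp
  qed
  have "ising_generator f \<sigma> = (\<Sum>\<^sub>\<infinity>x\<in>F. flip_rate x \<sigma> * (f (flip_at x \<sigma>) - f \<sigma>))"
    unfolding ising_generator_def by (rule infsum_cong_neutral) (auto simp: diff)
  also have "\<dots> = (\<Sum>x\<in>F. signed_rate \<sigma> x / c)"
    using assms by (auto simp: infsum_finite diff signed_rate_def intro!: sum.cong)
  finally show ?thesis by (simp add: f_def[abs_def] sum_divide_distrib)
qed

text \<open>The factor \<open>N\<^sup>2\<close> in the time scale cancels the area of a cell.\<close>

lemma drift_eq:
  assumes "N > 0" "stochastic_ising W P X"
  shows "drift P X N \<sigma> \<gamma> s r \<alpha>1 \<alpha>2 = (\<Sum>x\<in>{x. cell N x \<inter> window \<gamma> s r \<alpha>1 \<alpha>2 \<noteq> {}}. signed_rate \<sigma> x)"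
proof -
  define S where "S = window \<gamma> s r \<alpha>1 \<alpha>2"
  define F where "F = {x. cell N x \<inter> S \<noteq> {}}"
  define f where "f \<sigma> = (\<Sum>x\<in>F. (if \<sigma> x = Plus then 1 else 0)) / (real N)\<^sup>2" for \<sigma> :: config
  have bS: "bounded S" by (auto simp: S_def window_def)
  have F: "finite F" unfolding F_def by (rule finite_cells_meeting_bounded[OF assms(1) bS])
  have vol: "measure lborel (droplet N \<tau> \<inter> discretize N S) = f \<tau>" for \<tau>
    unfolding f_def F_def by (rule droplet_volume[OF assms(1) bS])
  have "local_function f" unfolding local_function_def
    by (rule exI[of _ F]) (auto simp: F f_def intro!: arg_cong[where f = "\<lambda>x. x / _"] sum.cong)
  then have "uniform_limit UNIV (\<lambda>t \<sigma>. ((\<integral>\<omega>. f (X t \<omega>) \<partial>P \<sigma>) - f \<sigma>) / t) (ising_generator f) (at_right 0)"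
    using assms(2) by (auto simp: stochastic_ising_def)
  then have lim: "((\<lambda>t. ((\<integral>\<omega>. f (X t \<omega>) \<partial>P \<sigma>) - f \<sigma>) / t) \<longlongrightarrow> ising_generator f \<sigma>) (at_right 0)"
    by (rule tendsto_uniform_limitI) simp
  have "filterlim (\<lambda>t. t * (real N)\<^sup>2) (at_right 0) (at_right 0)"
    unfolding filterlim_at
  proof (intro conjI)
    show "((\<lambda>t. t * (real N)\<^sup>2) \<longlongrightarrow> 0) (at_right 0)"
      by (rule tendsto_eq_intros | simp)+
    show "\<forall>\<^sub>F x in at_right 0. x * (real N)\<^sup>2 \<in> {0<..} \<and> x * (real N)\<^sup>2 \<noteq> 0"
      using assms(1) by (auto simp: eventually_at_right_field intro!: exI[of _ 1])
  qed
  from filterlim_compose[OF lim this]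
  have "((\<lambda>t. (real N)\<^sup>2 * (((\<integral>\<omega>. f (X (t * (real N)\<^sup>2) \<omega>) \<partial>P \<sigma>) - f \<sigma>) / (t * (real N)\<^sup>2)))
      \<longlongrightarrow> (real N)\<^sup>2 * ising_generator f \<sigma>) (at_right 0)"
    by (rule tendsto_mult_left)
  also have "(\<lambda>t. (real N)\<^sup>2 * (((\<integral>\<omega>. f (X (t * (real N)\<^sup>2) \<omega>) \<partial>P \<sigma>) - f \<sigma>) / (t * (real N)\<^sup>2)))
     = (\<lambda>t. 1 / t * ((\<integral>\<omega>. f (X (t * (real N)\<^sup>2) \<omega>) \<partial>P \<sigma>) - f \<sigma>))"
    using assms(1) by (auto simp: fun_eq_iff)
  finally have "((\<lambda>t. 1 / t * ((\<integral>\<omega>. f (X (t * (real N)\<^sup>2) \<omega>) \<partial>P \<sigma>) - f \<sigma>))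
      \<longlongrightarrow> (real N)\<^sup>2 * ising_generator f \<sigma>) (at_right 0)" .
  moreover have "(real N)\<^sup>2 * ising_generator f \<sigma> = (\<Sum>x\<in>F. signed_rate \<sigma> x)"
    unfolding f_def[abs_def] ising_generator_occupation[OF F] using assms(1) by simp
  ultimately show ?thesis
    unfolding drift_def Let_def vol S_def[symmetric] F_def[symmetric]
    by (auto intro: tendsto_Lim)
qed

text \<open>The probability that a cell meets the window if the two outer radii are drawn independently and
  uniformly from \<open>{0..\<delta>}\<close>.\<close>

definition window_weight :: "nat \<Rightarrow> complex \<Rightarrow> real \<Rightarrow> complex \<Rightarrow> complex \<Rightarrow> real \<Rightarrow> site \<Rightarrow> real" where
  "window_weight N s r x0 x1 \<delta> x =
     1 - (if cell N x \<inter> cball s r \<noteq> {} then 0 else 1)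
         * (min \<delta> (infdist x0 (cell N x)) / \<delta>) * (min \<delta> (infdist x1 (cell N x)) / \<delta>)"

text \<open>The cell misses the ball up to the radius \<open>infdist p (cell N x)\<close>. Since the cell is half open,
  it may or may not meet the ball of exactly this radius, which does not affect the integral.\<close>

lemma cell_miss_cball_integral:
  assumes "N > 0" "\<delta> > 0"
  shows "set_integrable lborel {0..\<delta>} (\<lambda>\<alpha>. if cell N x \<inter> cball p \<alpha> = {} then 1 else 0 :: real)"
    and "(LINT \<alpha>:{0..\<delta>}|lborel. (if cell N x \<inter> cball p \<alpha> = {} then 1 else 0)) = min \<delta> (infdist p (cell N x))"
proof -
  define d where "d = infdist p (cell N x)"
  have ne: "cell N x \<noteq> {}" using centre_in_cell[OF assms(1)] by blast
  have d0: "d \<ge> 0" by (simp add: d_def infdist_nonneg)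
  have miss: "cell N x \<inter> cball p \<alpha> = {}" if "\<alpha> < d" for \<alpha>
    using that infdist_le[of _ "cell N x" p] by (force simp: d_def)
  have hit: "cell N x \<inter> cball p \<alpha> \<noteq> {}" if "d < \<alpha>" for \<alpha>
  proof -
    have "(INF a\<in>cell N x. dist p a) < \<alpha>" using that ne by (simp add: d_def infdist_notempty)
    then obtain a where "a \<in> cell N x" "dist p a < \<alpha>"
      using ne by (subst (asm) cINF_less_iff) auto
    then show ?thesis by force
  qed
  have le: "\<alpha> \<le> d" if "cell N x \<inter> cball p \<alpha> = {}" for \<alpha>
    using hit[of \<alpha>] that by linarith
  have mono: "{\<alpha>. cell N x \<inter> cball p \<alpha> = {}} = {..<d} \<or> {\<alpha>. cell N x \<inter> cball p \<alpha> = {}} = {..d}"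
  proof (cases "cell N x \<inter> cball p d = {}")
    case True
    have "cell N x \<inter> cball p \<alpha> = {} \<longleftrightarrow> \<alpha> \<le> d" for \<alpha>
      using le[of \<alpha>] miss[of \<alpha>] True by (cases "\<alpha> = d") (blast, linarith)
    then show ?thesis by auto
  next
    case False
    have "cell N x \<inter> cball p \<alpha> = {} \<longleftrightarrow> \<alpha> < d" for \<alpha>
      using le[of \<alpha>] miss[of \<alpha>] False by (cases "\<alpha> = d") (blast, linarith)
    then show ?thesis by auto
  qed
  let ?A = "{0..\<delta>} \<inter> {\<alpha>. cell N x \<inter> cball p \<alpha> = {}}"
  have ind: "(\<lambda>\<alpha>. indicator {0..\<delta>} \<alpha> *\<^sub>R (if cell N x \<inter> cball p \<alpha> = {} then 1 else 0 :: real)) = indicat_real ?A"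
    by (auto simp: fun_eq_iff indicator_def)
  have A: "?A = {0..\<delta>} \<inter> {..<d} \<or> ?A = {0..\<delta>} \<inter> {..d}" using mono by auto
  have em: "?A \<in> sets lborel \<and> emeasure lborel ?A = ennreal (min \<delta> d)"
  proof -
    have sub: "{0<..<min \<delta> d} \<subseteq> ?A" "?A \<subseteq> {0..min \<delta> d}"
      using A by (elim disjE; simp add: subset_iff)+
    have m: "?A \<in> sets lborel" using A by auto
    have "emeasure lborel {0<..<min \<delta> d} \<le> emeasure lborel ?A" "emeasure lborel ?A \<le> emeasure lborel {0..min \<delta> d}"
      using sub m by (auto intro!: emeasure_mono)
    then show ?thesis using m d0 assms by simp
  qed
  show "set_integrable lborel {0..\<delta>} (\<lambda>\<alpha>. if cell N x \<inter> cball p \<alpha> = {} then 1 else 0 :: real)"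
    unfolding set_integrable_def ind using em by (intro integrable_real_indicator) auto
  show "(LINT \<alpha>:{0..\<delta>}|lborel. (if cell N x \<inter> cball p \<alpha> = {} then 1 else 0)) = min \<delta> (infdist p (cell N x))"
    unfolding set_lebesgue_integral_def ind using em d0 assms by (simp add: measure_def d_def)
qed

text \<open>The cell misses the window if and only if it misses the disc and both outer balls, so the
  double integral factorizes. The set \<open>F\<close> may be enlarged at will because the weight vanishes outside.\<close>

lemma averaged_drift_eq:
  assumes N: "N > 0" and \<delta>: "\<delta> > 0" and ising: "stochastic_ising W P X"
    and cr: "crossings \<gamma> s r = (x0, x1)"
    and F: "finite F" "{x. cell N x \<inter> (cball s r \<union> cball x0 \<delta> \<union> cball x1 \<delta>) \<noteq> {}} \<subseteq> F"
  shows "averaged_drift P X N \<sigma> \<gamma> s r \<delta> = (\<Sum>x\<in>F. signed_rate \<sigma> x * window_weight N s r x0 x1 \<delta> x)"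
proof -
  define a :: "site \<Rightarrow> real" where "a x = (if cell N x \<inter> cball s r \<noteq> {} then 0 else 1)" for x
  define b :: "complex \<Rightarrow> real \<Rightarrow> site \<Rightarrow> real" where "b p \<alpha> x = (if cell N x \<inter> cball p \<alpha> = {} then 1 else 0)" for p \<alpha> x
  define m where "m p x = min \<delta> (infdist p (cell N x))" for p x
  have drift: "drift P X N \<sigma> \<gamma> s r \<alpha>1 \<alpha>2 = (\<Sum>x\<in>F. signed_rate \<sigma> x * (1 - a x * b x0 \<alpha>1 x * b x1 \<alpha>2 x))"
    if "\<alpha>1 \<in> {0..\<delta>}" "\<alpha>2 \<in> {0..\<delta>}" for \<alpha>1 \<alpha>2
  proof -
    let ?G = "{x. cell N x \<inter> window \<gamma> s r \<alpha>1 \<alpha>2 \<noteq> {}}"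
    have w: "window \<gamma> s r \<alpha>1 \<alpha>2 = cball s r \<union> cball x0 \<alpha>1 \<union> cball x1 \<alpha>2"
      by (simp add: window_def cr)
    have "?G \<subseteq> F"
    proof -
      have "window \<gamma> s r \<alpha>1 \<alpha>2 \<subseteq> cball s r \<union> cball x0 \<delta> \<union> cball x1 \<delta>"
        using that unfolding w by auto
      then show ?thesis using F(2) by blast
    qed
    then have "(\<Sum>x\<in>?G. signed_rate \<sigma> x) = (\<Sum>x\<in>F. if x \<in> ?G then signed_rate \<sigma> x else 0)"
      using sum.inter_restrict[OF F(1), of "signed_rate \<sigma>" ?G] by (simp add: Int_absorb1)
    also have "\<dots> = (\<Sum>x\<in>F. signed_rate \<sigma> x * (1 - a x * b x0 \<alpha>1 x * b x1 \<alpha>2 x))"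
      by (intro sum.cong refl) (auto simp: w a_def b_def Int_Un_distrib)
    finally show ?thesis unfolding drift_eq[OF N ising] .
  qed
  have si: "set_integrable lborel {0..\<delta>} (\<lambda>\<alpha>. b p \<alpha> x)" for p x
    unfolding b_def by (rule cell_miss_cball_integral(1)[OF N \<delta>])
  have I: "(LINT \<alpha>:{0..\<delta>}|lborel. b p \<alpha> x) = m p x" for p x
    unfolding b_def m_def by (rule cell_miss_cball_integral(2)[OF N \<delta>])
  have c: "set_integrable lborel {0..\<delta>} (\<lambda>\<alpha>. k)" "(LINT \<alpha>:{0..\<delta>}|lborel. k) = \<delta> * k" for k :: real
    using \<delta> by (simp_all add: set_integrable_def set_lebesgue_integral_def)
  have affine: "(LINT \<alpha>:{0..\<delta>}|lborel. (\<Sum>x\<in>F. A x - B x * b p \<alpha> x)) = (\<Sum>x\<in>F. \<delta> * A x - B x * m p x)"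
    for A B :: "site \<Rightarrow> real" and p
  proof -
    have ii: "set_integrable lborel {0..\<delta>} (\<lambda>\<alpha>. A x - B x * b p \<alpha> x)" for x
      by (intro set_integral_diff set_integrable_mult_right c si)
    have "(LINT \<alpha>:{0..\<delta>}|lborel. (\<Sum>x\<in>F. A x - B x * b p \<alpha> x)) = (\<Sum>x\<in>F. LINT \<alpha>:{0..\<delta>}|lborel. A x - B x * b p \<alpha> x)"
      using ii F(1) unfolding set_lebesgue_integral_def set_integrable_def scaleR_sum_right
      by (intro Bochner_Integration.integral_sum) auto
    also have "\<dots> = (\<Sum>x\<in>F. \<delta> * A x - B x * m p x)"
    proof (rule sum.cong[OF refl])
      fix x
      have "(LINT \<alpha>:{0..\<delta>}|lborel. A x - B x * b p \<alpha> x) = (LINT \<alpha>:{0..\<delta>}|lborel. A x) - (LINT \<alpha>:{0..\<delta>}|lborel. B x * b p \<alpha> x)"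
        by (intro set_integral_diff set_integrable_mult_right c si)
      then show "(LINT \<alpha>:{0..\<delta>}|lborel. A x - B x * b p \<alpha> x) = \<delta> * A x - B x * m p x"
        by (simp add: c I)
    qed
    finally show ?thesis .
  qed
  have inner: "(LINT \<alpha>2:{0..\<delta>}|lborel. drift P X N \<sigma> \<gamma> s r \<alpha>1 \<alpha>2)
      = (\<Sum>x\<in>F. \<delta> * signed_rate \<sigma> x - (signed_rate \<sigma> x * a x * m x1 x) * b x0 \<alpha>1 x)"
    if "\<alpha>1 \<in> {0..\<delta>}" for \<alpha>1
  proof -
    have "(LINT \<alpha>2:{0..\<delta>}|lborel. drift P X N \<sigma> \<gamma> s r \<alpha>1 \<alpha>2)
       = (LINT \<alpha>2:{0..\<delta>}|lborel. (\<Sum>x\<in>F. signed_rate \<sigma> x - (signed_rate \<sigma> x * a x * b x0 \<alpha>1 x) * b x1 \<alpha>2 x))"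
      using that by (intro set_lebesgue_integral_cong) (auto simp: drift algebra_simps)
    then show ?thesis unfolding affine by (simp add: algebra_simps)
  qed
  have "(LINT \<alpha>1:{0..\<delta>}|lborel. (LINT \<alpha>2:{0..\<delta>}|lborel. drift P X N \<sigma> \<gamma> s r \<alpha>1 \<alpha>2))
     = (\<Sum>x\<in>F. \<delta> * (\<delta> * signed_rate \<sigma> x) - (signed_rate \<sigma> x * a x * m x1 x) * m x0 x)"
    unfolding affine[symmetric] by (intro set_lebesgue_integral_cong) (auto simp: inner)
  then have "averaged_drift P X N \<sigma> \<gamma> s r \<delta>
      = (\<Sum>x\<in>F. 1 / \<delta>\<^sup>2 * (\<delta> * (\<delta> * signed_rate \<sigma> x) - (signed_rate \<sigma> x * a x * m x1 x) * m x0 x))"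
    unfolding averaged_drift_def sum_distrib_left[symmetric] by simp
  also have "\<dots> = (\<Sum>x\<in>F. signed_rate \<sigma> x * window_weight N s r x0 x1 \<delta> x)"
    unfolding window_weight_def a_def[symmetric] m_def[symmetric]
    by (intro sum.cong refl) (use \<delta> in \<open>simp add: field_simps power2_eq_square\<close>)
  finally show ?thesis .
qed

section \<open>Summation by parts along a lattice interface\<close>

text \<open>The plus phase fills everything above the heights \<open>h\<close>: the height of a column is the top
  minus site.\<close>

definition heap_config :: "(int \<Rightarrow> int) \<Rightarrow> config" where
  "heap_config h x = (if h (fst x) < snd x then Plus else Minus)"

definition step :: "(int \<Rightarrow> int) \<Rightarrow> int \<Rightarrow> int" where
  "step h i = h (i + 1) - h i"

text \<open>At a step between the columns \<open>i\<close> and \<open>i + 1\<close> the interface has one horizontal and, if the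
  step is not zero, a stretch of vertical edges. The left and the right site are the corner sites at the two
  ends of the vertical stretch. For a step \<open>D\<close> different from zero they differ by \<open>(1, D - sgn D)\<close>.\<close>

definition left_site :: "(int \<Rightarrow> int) \<Rightarrow> int \<Rightarrow> site" where
  "left_site h i = (i, if step h i > 0 then h i + 1 else h i)"

definition right_site :: "(int \<Rightarrow> int) \<Rightarrow> int \<Rightarrow> site" where
  "right_site h i = (i + 1, if step h i > 0 then h (i + 1) else h (i + 1) + 1)"

definition step_sum :: "(int \<Rightarrow> int) \<Rightarrow> (site \<Rightarrow> real) \<Rightarrow> int set \<Rightarrow> real" where
  "step_sum h M J = (\<Sum>i\<in>J. of_int (sgn (step h i)) * (M (right_site h i) - M (left_site h i)))"

lemma card_opposite_neighbours:
  "card {y \<in> neighbours (i, j). \<sigma> y \<noteq> c} =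
     of_bool (\<sigma> (i + 1, j) \<noteq> c) + of_bool (\<sigma> (i - 1, j) \<noteq> c) +
     of_bool (\<sigma> (i, j + 1) \<noteq> c) + of_bool (\<sigma> (i, j - 1) \<noteq> c)"
proof -
  have "{y \<in> neighbours (i, j). \<sigma> y \<noteq> c} =
     (if \<sigma> (i + 1, j) \<noteq> c then {(i + 1, j)} else {}) \<union> (if \<sigma> (i - 1, j) \<noteq> c then {(i - 1, j)} else {})
     \<union> (if \<sigma> (i, j + 1) \<noteq> c then {(i, j + 1)} else {}) \<union> (if \<sigma> (i, j - 1) \<noteq> c then {(i, j - 1)} else {})"
    by (auto simp: neighbours_def)
  then show ?thesis by simp
qed

text \<open>A violation would give a site with both horizontal neighbours, but no vertical one, in the other
  phase, which flips at a positive rate as well. There is none if all steps are at most one in absolute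
  value, and none if the heights are monotone.\<close>

definition no_deep_notch :: "(int \<Rightarrow> int) \<Rightarrow> bool" where
  "no_deep_notch h \<longleftrightarrow>
     (\<forall>i. \<not> (h (i + 1) \<ge> h i + 2 \<and> h (i - 1) \<ge> h i + 2) \<and> \<not> (h (i + 1) \<le> h i - 2 \<and> h (i - 1) \<le> h i - 2))"

text \<open>The sites next to the interface have one vertical neighbour in the other phase, so their rate
  is one half of the number of horizontal neighbours in the other phase.\<close>

lemma signed_rate_heap:
  assumes "no_deep_notch h"
  shows "signed_rate (heap_config h) (i, j) =
    1/2 * (of_bool (j = h i) * (of_bool (step h i < 0) + of_bool (step h (i - 1) > 0))
         - of_bool (j = h i + 1) * (of_bool (step h i > 0) + of_bool (step h (i - 1) < 0)))"
proof -
  have nn: "\<not> (h (i + 1) \<ge> h i + 2 \<and> h (i - 1) \<ge> h i + 2)" "\<not> (h (i + 1) \<le> h i - 2 \<and> h (i - 1) \<le> h i - 2)"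
    using assms by (auto simp: no_deep_notch_def)
  consider "j < h i" | "j = h i" | "j = h i + 1" | "j > h i + 1" by linarith
  then show ?thesis
  proof cases
    case 1
    then show ?thesis using nn
      by (auto simp: signed_rate_def flip_rate_def Let_def card_opposite_neighbours heap_config_def)
  next
    case 2
    then show ?thesis
      by (auto simp: signed_rate_def flip_rate_def Let_def card_opposite_neighbours heap_config_def step_def)
  next
    case 3
    then show ?thesis
      by (auto simp: signed_rate_def flip_rate_def Let_def card_opposite_neighbours heap_config_def step_def)
  next
    case 4
    then show ?thesis using nn
      by (auto simp: signed_rate_def flip_rate_def Let_def card_opposite_neighbours heap_config_def)
  qed
qed

text \<open>Each nonzero step \<open>D\<close> contributes \<open>sgn D / 2\<close> at its right site and the opposite at its left
  site. Collecting the terms by steps instead of sites leaves differences of \<open>M\<close>, so that only the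
  regions where \<open>M\<close> varies contribute.\<close>

lemma sum_signed_rate_heap:
  fixes M :: "site \<Rightarrow> real"
  assumes h: "no_deep_notch h" and F: "finite F" and supp: "\<And>x. M x \<noteq> 0 \<Longrightarrow> x \<in> F \<and> \<bar>fst x\<bar> < B"
  shows "(\<Sum>x\<in>F. signed_rate (heap_config h) x * M x)
    = 1/2 * step_sum h M {-B..B}"
proof -
  define u where "u i = of_bool (step h i < 0) * M (i, h i) - of_bool (step h i > 0) * M (i, h i + 1)" for i
  define v where "v i = of_bool (step h i > 0) * M (i + 1, h (i + 1)) - of_bool (step h i < 0) * M (i + 1, h (i + 1) + 1)" for i
  define Y where "Y = h ` {-B..B} \<union> (\<lambda>i. h i + 1) ` {-B..B} \<union> snd ` F"
  have Y: "finite Y" using F by (simp add: Y_def)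
  have M0: "M (i, j) = 0" if "\<bar>i\<bar> \<ge> B" for i j using supp[of "(i, j)"] that by force
  have "(\<Sum>x\<in>F. signed_rate (heap_config h) x * M x) = (\<Sum>x\<in>{-B..B} \<times> Y. signed_rate (heap_config h) x * M x)"
  proof (rule sum.mono_neutral_cong)
    show "finite ({-B..B} \<times> Y)" "finite F" using Y F by simp_all
  next
    fix x assume x: "x \<in> F - {-B..B} \<times> Y"
    show "signed_rate (heap_config h) x * M x = 0"
    proof (rule ccontr)
      assume "signed_rate (heap_config h) x * M x \<noteq> 0"
      then have "M x \<noteq> 0" by auto
      then have "\<bar>fst x\<bar> < B" using supp by blast
      then show False using x by (auto simp: Y_def mem_Times_iff)
    qed
  qed (use supp in force)+
  also have "\<dots> = (\<Sum>i\<in>{-B..B}. \<Sum>j\<in>Y. signed_rate (heap_config h) (i, j) * M (i, j))"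
    by (simp add: sum.cartesian_product)
  also have "\<dots> = (\<Sum>i\<in>{-B..B}. 1/2 * (u i + v (i - 1)))"
  proof (rule sum.cong[OF refl])
    fix i assume i: "i \<in> {-B..B}"
    have inY: "h i \<in> Y" "h i + 1 \<in> Y" using i by (auto simp: Y_def)
    have "(\<Sum>j\<in>Y. signed_rate (heap_config h) (i, j) * M (i, j)) =
      (\<Sum>j\<in>Y. (if j = h i then 1/2 * (of_bool (step h i < 0) + of_bool (step h (i - 1) > 0)) * M (i, h i) else 0)
           - (if j = h i + 1 then 1/2 * (of_bool (step h i > 0) + of_bool (step h (i - 1) < 0)) * M (i, h i + 1) else 0))"
      unfolding signed_rate_heap[OF h] by (intro sum.cong refl) auto
    also have "\<dots> = 1/2 * (of_bool (step h i < 0) + of_bool (step h (i - 1) > 0)) * M (i, h i)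
           - 1/2 * (of_bool (step h i > 0) + of_bool (step h (i - 1) < 0)) * M (i, h i + 1)"
      using Y inY by (simp add: sum_subtractf)
    also have "\<dots> = 1/2 * (u i + v (i - 1))" by (simp add: u_def v_def algebra_simps add_divide_distrib)
    finally show "(\<Sum>j\<in>Y. signed_rate (heap_config h) (i, j) * M (i, j)) = 1/2 * (u i + v (i - 1))" .
  qed
  also have "\<dots> = 1/2 * ((\<Sum>i\<in>{-B..B}. u i) + (\<Sum>i\<in>{-B..B}. v (i - 1)))"
    by (simp only: sum_distrib_left[symmetric] sum.distrib)
  also have "(\<Sum>i\<in>{-B..B}. v (i - 1)) = (\<Sum>i\<in>{-B-1..B-1}. v i)"
    by (rule sum.reindex_bij_witness[of _ "\<lambda>i. i + 1" "\<lambda>i. i - 1"]) auto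
  also have "\<dots> = (\<Sum>i\<in>{-B..B}. v i)"
    by (rule sum.mono_neutral_cong) (auto simp: v_def M0)
  also have "1/2 * ((\<Sum>i\<in>{-B..B}. u i) + (\<Sum>i\<in>{-B..B}. v i)) = 1/2 * (\<Sum>i\<in>{-B..B}. u i + v i)"
    by (simp add: sum.distrib)
  also have "(\<Sum>i\<in>{-B..B}. u i + v i) = step_sum h M {-B..B}"
    unfolding step_sum_def by (intro sum.cong refl) (auto simp: u_def v_def left_site_def right_site_def sgn_if)
  finally show ?thesis .
qed

lemma signed_rate_flip_all:
  "signed_rate (\<lambda>x. if \<sigma> x = Plus then Minus else Plus) x = - signed_rate \<sigma> x"
proof -
  have "{y \<in> neighbours x. (if \<sigma> y = Plus then Minus else Plus) \<noteq> (if \<sigma> x = Plus then Minus else Plus)}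
     = {y \<in> neighbours x. \<sigma> y \<noteq> \<sigma> x}"
  proof -
    have "(if a = Plus then Minus else Plus) \<noteq> (if b = Plus then Minus else Plus) \<longleftrightarrow> a \<noteq> b" for a b
      by (cases a; cases b) auto
    then show ?thesis by simp
  qed
  then show ?thesis by (cases "\<sigma> x") (auto simp: signed_rate_def flip_rate_def)
qed

lemma signed_rate_swap: "signed_rate (\<sigma> \<circ> prod.swap) (prod.swap x) = signed_rate \<sigma> x"
proof -
  obtain i j where x: "x = (i, j)" by force
  have "card {y \<in> neighbours (j, i). (\<sigma> \<circ> prod.swap) y \<noteq> c} = card {y \<in> neighbours (i, j). \<sigma> y \<noteq> c}" for c
    unfolding card_opposite_neighbours by simp
  then have "flip_rate (j, i) (\<sigma> \<circ> prod.swap) = flip_rate (i, j) \<sigma>"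
    unfolding flip_rate_def by (simp only: o_apply prod.swap_def fst_conv snd_conv)
  then show ?thesis by (simp add: x signed_rate_def)
qed

lemma signed_rate_cong:
  assumes "\<sigma> x = \<tau> x" "\<And>y. y \<in> neighbours x \<Longrightarrow> \<sigma> y = \<tau> y"
  shows "signed_rate \<sigma> x = signed_rate \<tau> x"
proof -
  have "{y \<in> neighbours x. \<sigma> y \<noteq> \<sigma> x} = {y \<in> neighbours x. \<tau> y \<noteq> \<tau> x}" using assms by auto
  then have "flip_rate x \<sigma> = flip_rate x \<tau>" by (simp only: flip_rate_def)
  then show ?thesis using assms(1) by (simp add: signed_rate_def)
qed

section \<open>Distances from a point to translated cells\<close>

text \<open>The norm is convex, so its increment lies between the directional derivatives at the two end
  points; both directions are close to \<open>b\<close>.\<close>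

lemma norm_add_near_ray:
  fixes v w b :: "'a::real_inner"
  assumes b: "norm b = 1" and t: "t > 0" and \<eta>: "\<eta> < 1"
    and v: "norm (v - t *\<^sub>R b) \<le> \<eta> * t" and vw: "norm (v + w - t *\<^sub>R b) \<le> \<eta> * t"
  shows "\<bar>norm (v + w) - norm v - b \<bullet> w\<bar> \<le> 2 * \<eta> * norm w"
proof -
  have dir: "z \<noteq> 0 \<and> \<bar>(z \<bullet> w) / norm z - b \<bullet> w\<bar> \<le> 2 * \<eta> * norm w"
    if z: "norm (z - t *\<^sub>R b) \<le> \<eta> * t" for z
  proof -
    have "norm (t *\<^sub>R b) = t" using b t by simp
    then have n: "\<bar>norm z - t\<bar> \<le> \<eta> * t" using norm_triangle_ineq3[of z "t *\<^sub>R b"] z by simp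
    have z0: "z \<noteq> 0" using n t \<eta> by auto
    have "t * norm (inverse (norm z) *\<^sub>R z - b) = norm ((t * inverse (norm z)) *\<^sub>R z - t *\<^sub>R b)"
      using t by (simp add: scaleR_diff_right[symmetric] flip: scaleR_scaleR)
    also have "\<dots> \<le> norm ((t * inverse (norm z)) *\<^sub>R z - z) + norm (z - t *\<^sub>R b)"
      by (metis norm_triangle_ineq diff_add_cancel add_diff_eq)
    also have "norm ((t * inverse (norm z)) *\<^sub>R z - z) = \<bar>t - norm z\<bar>"
    proof -
      have "(t * inverse (norm z)) *\<^sub>R z - z = (t * inverse (norm z) - 1) *\<^sub>R z"
        by (simp add: scaleR_diff_left)
      then have "norm ((t * inverse (norm z)) *\<^sub>R z - z) = \<bar>(t * inverse (norm z) - 1) * norm z\<bar>"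
        by (simp add: abs_mult)
      also have "(t * inverse (norm z) - 1) * norm z = t - norm z" using z0 by (simp add: field_simps)
      finally show ?thesis .
    qed
    finally have "t * norm (inverse (norm z) *\<^sub>R z - b) \<le> 2 * (\<eta> * t)" using n z by linarith
    then have "t * norm (inverse (norm z) *\<^sub>R z - b) \<le> t * (2 * \<eta>)" by (simp only: ac_simps)
    then have *: "norm (inverse (norm z) *\<^sub>R z - b) \<le> 2 * \<eta>" using t by simp
    have "(z \<bullet> w) / norm z - b \<bullet> w = (inverse (norm z) *\<^sub>R z - b) \<bullet> w"
      by (simp add: inner_diff_left divide_inverse)
    also have "\<bar>\<dots>\<bar> \<le> norm (inverse (norm z) *\<^sub>R z - b) * norm w" by (rule Cauchy_Schwarz_ineq2)
    also have "\<dots> \<le> 2 * \<eta> * norm w" using * by (rule mult_right_mono) simp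
    finally show ?thesis using z0 by blast
  qed
  note v' = dir[OF v] and vw' = dir[OF vw]
  have "v \<bullet> w / norm v \<le> norm (v + w) - norm v"
  proof -
    have "v \<bullet> (v + w) \<le> norm v * norm (v + w)" by (rule norm_cauchy_schwarz)
    then have "v \<bullet> w \<le> norm v * (norm (v + w) - norm v)"
      by (simp add: inner_add_right right_diff_distrib power2_eq_square[symmetric] power2_norm_eq_inner)
    then show ?thesis using v' by (simp add: field_simps)
  qed
  moreover have "norm (v + w) - norm v \<le> (v + w) \<bullet> w / norm (v + w)"
  proof -
    have "(v + w) \<bullet> v \<le> norm (v + w) * norm v" by (rule norm_cauchy_schwarz)
    moreover have "(v + w) \<bullet> v = (norm (v + w))\<^sup>2 - (v + w) \<bullet> w"
      by (simp add: power2_norm_eq_inner inner_add_left inner_add_right)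
    ultimately have "norm (v + w) * (norm (v + w) - norm v) \<le> (v + w) \<bullet> w"
      by (simp add: right_diff_distrib power2_eq_square)
    then show ?thesis using vw' by (simp add: field_simps)
  qed
  ultimately show ?thesis using v' vw' by linarith
qed

lemma infdist_le_infdist_add:
  assumes "A \<noteq> {}" "\<And>a. a \<in> A \<Longrightarrow> \<exists>b\<in>B. dist x b \<le> dist x a + c"
  shows "infdist x B \<le> infdist x A + c"
proof -
  have "infdist x B - c \<le> (INF a\<in>A. dist x a)"
  proof (rule cINF_greatest[OF assms(1)])
    fix a assume "a \<in> A"
    then obtain b where "b \<in> B" "dist x b \<le> dist x a + c" using assms(2) by blast
    then show "infdist x B - c \<le> dist x a" using infdist_le[of b B x] by linarith
  qed
  then show ?thesis using assms(1) by (simp add: infdist_notempty)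
qed

lemma cell_translate:
  assumes "N > 0"
  shows "u \<in> cell N x \<longleftrightarrow> u + (centre N y - centre N x) \<in> cell N y"
proof -
  have "real N * (Re u + (of_int (fst y) / real N - of_int (fst x) / real N)) + 1/2
     = real N * Re u + 1/2 + of_int (fst y - fst x)"
    using assms by (simp add: field_simps)
  moreover have "real N * (Im u + (of_int (snd y) / real N - of_int (snd x) / real N)) + 1/2
     = real N * Im u + 1/2 + of_int (snd y - snd x)"
    using assms by (simp add: field_simps)
  ultimately show ?thesis
    unfolding mem_cell_iff[OF assms] centre_def by (auto simp: algebra_simps)
qed

text \<open>Two cells are translates of each other; an estimate for the distances of corresponding points
  passes to the infima. This avoids a discussion of which point of a cell is closest.\<close>

lemma infdist_cell_translate:
  assumes N: "N > 0"
    and *: "\<And>a. a \<in> cell N x \<Longrightarrow> \<bar>dist p (a + (centre N y - centre N x)) - dist p a - c\<bar> \<le> \<eta>"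
  shows "\<bar>infdist p (cell N y) - infdist p (cell N x) - c\<bar> \<le> \<eta>"
proof -
  define w where "w = centre N y - centre N x"
  have ne: "cell N x \<noteq> {}" "cell N y \<noteq> {}" using centre_in_cell[OF N] by blast+
  have "infdist p (cell N y) \<le> infdist p (cell N x) + (c + \<eta>)"
  proof (rule infdist_le_infdist_add[OF ne(1)])
    fix a assume "a \<in> cell N x"
    then show "\<exists>b\<in>cell N y. dist p b \<le> dist p a + (c + \<eta>)"
      using cell_translate[OF N, of a x y] *[of a] by (intro bexI[of _ "a + w"]) (auto simp: w_def)
  qed
  moreover have "infdist p (cell N x) \<le> infdist p (cell N y) + (\<eta> - c)"
  proof (rule infdist_le_infdist_add[OF ne(2)])
    fix b assume b: "b \<in> cell N y"
    then have "b - w \<in> cell N x" using cell_translate[OF N, of "b - w" x y] by (simp add: w_def)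
    then show "\<exists>a\<in>cell N x. dist p a \<le> dist p b + (\<eta> - c)"
      using *[of "b - w"] by (intro bexI[of _ "b - w"]) (auto simp: w_def)
  qed
  ultimately show ?thesis by linarith
qed

lemma infdist_cell_diff:
  assumes "N > 0"
  shows "\<bar>infdist p (cell N y) - infdist p (cell N x)\<bar> \<le> norm (centre N y - centre N x)"
proof -
  have "\<bar>dist p (a + w) - dist p a - 0\<bar> \<le> norm w" for a w :: complex
    using dist_triangle[of p "a + w" a] dist_triangle[of p a "a + w"] by (auto simp: dist_norm)
  from infdist_cell_translate[OF assms this] show ?thesis by simp
qed

lemma sum_int_telescope:
  fixes g :: "int \<Rightarrow> 'a::ab_group_add"
  assumes "a \<le> b"
  shows "(\<Sum>i\<in>{a..<b}. g (i + 1) - g i) = g b - g a"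
  using assms
proof (induction b rule: int_ge_induct)
  case (step i)
  have "{a..<i + 1} = insert i {a..<i}" using step.hyps by auto
  then show ?case using step by simp
qed simp

lemma real_card_multiples_closed:
  assumes "N > 0"
  shows "finite {i::int. A \<le> of_int i / real N \<and> of_int i / real N \<le> B}"
    and "A \<le> B \<Longrightarrow> real (card {i::int. A \<le> of_int i / real N \<and> of_int i / real N \<le> B}) \<le> real N * (B - A) + 1"
proof -
  have eq: "{i::int. A \<le> of_int i / real N \<and> of_int i / real N \<le> B} = {\<lceil>real N * A\<rceil>..\<lfloor>real N * B\<rfloor>}"
    using assms by (auto simp: field_simps ceiling_le_iff le_floor_iff)
  show "finite {i::int. A \<le> of_int i / real N \<and> of_int i / real N \<le> B}" unfolding eq by simp
  assume "A \<le> B"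
  then have "real N * A \<le> real N * B" using assms by simp
  then have "\<lceil>real N * A\<rceil> \<le> \<lfloor>real N * B\<rfloor> + 1" by linarith
  then have "real (card {\<lceil>real N * A\<rceil>..\<lfloor>real N * B\<rfloor>}) = of_int (\<lfloor>real N * B\<rfloor> + 1 - \<lceil>real N * A\<rceil>)"
    by simp
  also have "\<dots> \<le> real N * B + 1 - real N * A" 
    by simp (smt (verit) le_of_int_ceiling of_int_floor_le)
  finally show "real (card {i::int. A \<le> of_int i / real N \<and> of_int i / real N \<le> B}) \<le> real N * (B - A) + 1"
    unfolding eq by (simp add: algebra_simps)
qed

lemma multiples_open_interval:
  assumes "N > 0"
  shows "{i::int. A < of_int i / real N \<and> of_int i / real N < B} = {\<lfloor>real N * A\<rfloor> + 1..<\<lceil>real N * B\<rceil>}"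
proof -
  have "A < of_int i / real N \<longleftrightarrow> \<lfloor>real N * A\<rfloor> + 1 \<le> i" for i
    using assms floor_less_iff[of "real N * A" i] by (auto simp: field_simps)
  moreover have "of_int i / real N < B \<longleftrightarrow> i < \<lceil>real N * B\<rceil>" for i
    using assms less_ceiling_iff[of i "real N * B"] by (auto simp: field_simps)
  ultimately show ?thesis by auto
qed

section \<open>The contribution of one end of an arc\<close>

definition graph :: "(real \<Rightarrow> real) \<Rightarrow> real \<Rightarrow> complex" where
  "graph f u = Complex u (f u)"

text \<open>The value 3 leaves room for the rounding and for the variation of a function with slopes at most 2
  over a column.\<close>

definition tracks :: "(real \<Rightarrow> real) \<Rightarrow> nat \<Rightarrow> (int \<Rightarrow> int) \<Rightarrow> bool" where
  "tracks f N h \<longleftrightarrow> (\<forall>i. \<bar>of_int (h i) - real N * f (of_int i / real N)\<bar> \<le> 3)"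

text \<open>Away from the other end point, \<open>1 - half_weight N s r p \<delta> x / \<delta>\<close> is the window weight.\<close>

definition half_weight :: "nat \<Rightarrow> complex \<Rightarrow> real \<Rightarrow> complex \<Rightarrow> real \<Rightarrow> site \<Rightarrow> real" where
  "half_weight N s r p \<delta> x = (if cell N x \<inter> cball s r \<noteq> {} then 0 else min \<delta> (infdist p (cell N x)))"

lemma dist_graph_le:
  assumes "\<And>x y. \<bar>f x - f y\<bar> \<le> 2 * \<bar>x - y\<bar>"
  shows "dist (graph f u) (graph f v) \<le> 3 * \<bar>u - v\<bar>"
proof -
  have "dist (graph f u) (graph f v) \<le> \<bar>u - v\<bar> + \<bar>f u - f v\<bar>"
    using cmod_le[of "graph f u - graph f v"] by (simp add: dist_norm graph_def)
  also have "\<dots> \<le> \<bar>u - v\<bar> + 2 * \<bar>u - v\<bar>" by (intro add_left_mono assms)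
  finally show ?thesis by simp
qed

lemma abs_le_dist_graph: "\<bar>u - v\<bar> \<le> dist (graph f u) (graph f v)"
  using abs_Re_le_cmod[of "graph f u - graph f v"] by (simp add: dist_norm graph_def)

text \<open>Everything relevant to a step happens within a few lattice spacings of the graph.\<close>

lemma step_geometry:
  assumes N: "N > 0" and f: "\<And>x y. \<bar>f x - f y\<bar> \<le> 2 * \<bar>x - y\<bar>" and h: "tracks f N h"
    and nz: "step h i \<noteq> 0"
  defines "w \<equiv> centre N (right_site h i) - centre N (left_site h i)"
  shows "w = Complex (1 / N) (of_int (step h i - sgn (step h i)) / N)"
    and "norm w \<le> 9 / N"
    and "a \<in> cell N (left_site h i) \<Longrightarrow> dist a (graph f (of_int i / N)) \<le> 8 / N"
    and "a \<in> cell N (right_site h i) \<Longrightarrow> dist a (graph f (of_int i / N)) \<le> 8 / N"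
proof -
  let ?u = "of_int i / real N"
  have hi: "\<bar>of_int (h i) - real N * f ?u\<bar> \<le> 3" "\<bar>of_int (h (i + 1)) - real N * f (of_int (i + 1) / real N)\<bar> \<le> 3"
    using h unfolding tracks_def by blast+
  have "\<bar>f (of_int (i + 1) / real N) - f ?u\<bar> \<le> 2 * \<bar>of_int (i + 1) / real N - ?u\<bar>" by (rule f)
  also have "\<dots> = 2 / N" using N by (simp add: field_simps)
  finally have "real N * \<bar>f (of_int (i + 1) / real N) - f ?u\<bar> \<le> 2" using N by (simp add: field_simps)
  then have fi: "\<bar>real N * f (of_int (i + 1) / real N) - real N * f ?u\<bar> \<le> 2"
    using N by (simp add: abs_mult flip: right_diff_distrib)
  have "real_of_int \<bar>step h i\<bar> \<le> 8" using hi fi by (simp add: step_def)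
  then have s8: "\<bar>step h i\<bar> \<le> 8" by linarith
  have "right_site h i = (fst (left_site h i) + 1, snd (left_site h i) + (step h i - sgn (step h i)))"
    using nz by (auto simp: left_site_def right_site_def step_def sgn_if)
  then show w: "w = Complex (1 / N) (of_int (step h i - sgn (step h i)) / N)"
    by (simp add: w_def centre_def complex_eq_iff add_divide_distrib diff_divide_distrib)
  have "norm w \<le> \<bar>1 / N\<bar> + \<bar>of_int (step h i - sgn (step h i)) / real N\<bar>"
    using cmod_le[of w] by (simp add: w)
  also have "\<bar>of_int (step h i - sgn (step h i)) / real N\<bar> = \<bar>of_int (step h i - sgn (step h i))\<bar> / real N"
    by simp
  also have "\<dots> \<le> 8 / N"
  proof (rule divide_right_mono)
    have "\<bar>step h i - sgn (step h i)\<bar> \<le> 8" using s8 by (auto simp: sgn_if)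
    then show "\<bar>of_int (step h i - sgn (step h i))\<bar> \<le> (8::real)" by linarith
  qed simp
  finally show "norm w \<le> 9 / N" by (simp add: add_divide_distrib[symmetric])
  have near: "dist (centre N x) (graph f ?u) \<le> 7 / N"
    if "\<bar>real_of_int (fst x) - of_int i\<bar> \<le> 1" "\<bar>of_int (snd x) - real N * f ?u\<bar> \<le> 6" for x
  proof -
    have "of_int (fst x) / real N - ?u = (of_int (fst x) - of_int i) / N" by (simp add: diff_divide_distrib)
    then have 1: "\<bar>of_int (fst x) / real N - ?u\<bar> \<le> 1 / N" using that(1) by (simp add: divide_right_mono)
    have "of_int (snd x) / real N - f ?u = (of_int (snd x) - real N * f ?u) / N" using N by (simp add: field_simps)
    then have 2: "\<bar>of_int (snd x) / real N - f ?u\<bar> \<le> 6 / N" using that(2) by (simp add: divide_right_mono)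
    have "dist (centre N x) (graph f ?u) \<le> \<bar>of_int (fst x) / real N - ?u\<bar> + \<bar>of_int (snd x) / real N - f ?u\<bar>"
      using cmod_le[of "centre N x - graph f ?u"] by (simp add: dist_norm centre_def graph_def)
    also have "\<dots> \<le> 1 / N + 6 / N" using 1 2 by (rule add_mono)
    finally show ?thesis by (simp add: add_divide_distrib[symmetric])
  qed
  have c: "dist (centre N (left_site h i)) (graph f ?u) \<le> 7 / N" "dist (centre N (right_site h i)) (graph f ?u) \<le> 7 / N"
    by (rule near; use hi fi in \<open>auto simp: left_site_def right_site_def\<close>)+
  have "dist a (graph f ?u) \<le> 8 / N" if "a \<in> cell N x" "dist (centre N x) (graph f ?u) \<le> 7 / N" for x
    using dist_centre_cell[OF N that(1)] that(2) dist_triangle[of a "graph f ?u" "centre N x"]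
    by (simp add: add_divide_distrib[symmetric] field_simps)
  then show "a \<in> cell N (left_site h i) \<Longrightarrow> dist a (graph f ?u) \<le> 8 / N"
     "a \<in> cell N (right_site h i) \<Longrightarrow> dist a (graph f ?u) \<le> 8 / N" using c by blast+
qed

text \<open>One end \<open>u1\<close> of an arc in a disc of radius \<open>r\<close> around the point over \<open>us\<close>. The sign \<open>e\<close> is
  1 at the right end and -1 at the left end. Transversality says that on this side of \<open>us\<close> the arc
  crosses the circle only at \<open>u1\<close>, and not too slowly.\<close>

locale arc_end =
  fixes f :: "real \<Rightarrow> real" and us r u1 k e c0 :: real
  assumes e: "e = 1 \<or> e = -1"
    and lip: "\<And>x y. \<bar>f x - f y\<bar> \<le> 2 * \<bar>x - y\<bar>"
    and r: "r > 0" and c0: "c0 > 0"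
    and outward: "e * (u1 - us) > 0"
    and transversal: "\<And>u. e * (u - us) \<ge> 0 \<Longrightarrow>
        ((dist (graph f u) (graph f us))\<^sup>2 - r\<^sup>2) * (e * (u - u1)) \<ge> c0 * (u - u1)\<^sup>2"
    and deriv: "(f has_real_derivative k) (at u1)"
begin

definition "c = 1 / sqrt (1 + k\<^sup>2)"

abbreviation "wt N \<delta> x \<equiv> half_weight N (graph f us) r (graph f u1) \<delta> x"

abbreviation "jump N h \<delta> i \<equiv> of_int (sgn (step h i)) * (wt N \<delta> (right_site h i) - wt N \<delta> (left_site h i))"

lemma c_bounds: "0 < c" "c \<le> 1" "c\<^sup>2 * (1 + k\<^sup>2) = 1"
proof -
  have p: "1 + k\<^sup>2 > 0" by (simp add: add_pos_nonneg)
  show "0 < c" using p by (simp add: c_def)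
  show "c \<le> 1" using p by (simp add: c_def)
  show "c\<^sup>2 * (1 + k\<^sup>2) = 1" using p by (simp add: c_def power_divide)
qed

lemma e_cases: "e * e = 1" "\<bar>e\<bar> = 1" "e \<noteq> 0" using e by auto

lemma jump_le_of_weights:
  "\<bar>jump N h \<delta> i\<bar> \<le> \<bar>wt N \<delta> (right_site h i) - wt N \<delta> (left_site h i)\<bar>"
  by (cases "step h i = 0") (auto simp: abs_mult sgn_if)

lemma dist_sq_far_inside:
  assumes "e * (u - us) \<ge> 0" "e * (u - u1) \<le> - y" "y > 0"
  shows "(dist (graph f u) (graph f us))\<^sup>2 \<le> r\<^sup>2 - c0 * y"
proof -
  define D where "D = (dist (graph f u) (graph f us))\<^sup>2 - r\<^sup>2"
  define z where "z = - (e * (u - u1))"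
  have z: "z \<ge> y" using assms by (simp add: z_def)
  have "(u - u1)\<^sup>2 = z * z" using e by (auto simp: z_def power2_eq_square algebra_simps)
  then have "D * (- z) \<ge> c0 * (z * z)" using transversal[OF assms(1)] by (simp add: D_def z_def)
  then have "z * (- D) \<ge> z * (c0 * z)" by (simp only: ac_simps mult_minus_left mult_minus_right)
  then have "- D \<ge> c0 * z" using z assms(3) by (simp only: mult_le_cancel_left_pos)
  moreover have "c0 * z \<ge> c0 * y" using z c0 by simp
  ultimately show ?thesis unfolding D_def by linarith
qed

lemma dist_sq_far_outside:
  assumes "e * (u - us) \<ge> 0" "e * (u - u1) \<ge> y" "y > 0"
  shows "(dist (graph f u) (graph f us))\<^sup>2 \<ge> r\<^sup>2 + c0 * y"
proof -
  define D where "D = (dist (graph f u) (graph f us))\<^sup>2 - r\<^sup>2"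
  define z where "z = e * (u - u1)"
  have z: "z \<ge> y" using assms by (simp add: z_def)
  have "(u - u1)\<^sup>2 = z * z" using e by (auto simp: z_def power2_eq_square algebra_simps)
  then have "D * z \<ge> c0 * (z * z)" using transversal[OF assms(1)] by (simp add: D_def z_def)
  then have "z * D \<ge> z * (c0 * z)" by (simp only: ac_simps)
  then have "D \<ge> c0 * z" using z assms(3) by (simp only: mult_le_cancel_left_pos)
  moreover have "c0 * z \<ge> c0 * y" using z c0 by simp
  ultimately show ?thesis unfolding D_def by linarith
qed

text \<open>All points of the two cells are within \<open>8 / N\<close> of the graph, and the squares of \<open>r\<close> and of
  \<open>r - 8 / N\<close> or \<open>r + 8 / N\<close> differ by less than \<open>80 * (r + 1) / N\<close>.\<close>

lemma hits_inside:
  assumes N: "N > 0" and h: "tracks f N h" and nz: "step h i \<noteq> 0"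
    and i: "e * (of_int i / N - us) \<ge> 0" "e * (of_int i / N - u1) \<le> - y"
    and y: "y > 0" "80 * (r + 1) / N < c0 * y"
  shows "cell N (left_site h i) \<inter> cball (graph f us) r \<noteq> {}"
    and "cell N (right_site h i) \<inter> cball (graph f us) r \<noteq> {}"
proof -
  let ?u = "of_int i / real N"
  have D: "(dist (graph f ?u) (graph f us))\<^sup>2 \<le> r\<^sup>2 - c0 * y" by (rule dist_sq_far_inside[OF i y(1)])
  have "16 * r / N \<le> 80 * (r + 1) / N" using r by (intro divide_right_mono) auto
  then have b: "16 * r / N \<le> c0 * y" using y by linarith
  have "c0 * y \<le> r\<^sup>2" using D zero_le_power2[of "dist (graph f ?u) (graph f us)"] by linarith
  then have "16 * r / N \<le> r * r" using b by (simp add: power2_eq_square)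
  then have "r * (16 / N) \<le> r * r" by (simp add: mult.commute)
  then have r16: "16 / N \<le> r" using r by (simp only: mult_le_cancel_left_pos)
  have "(r - 8 / N)\<^sup>2 = r\<^sup>2 + (8 / N)\<^sup>2 - 16 * r / N" by (simp add: power2_diff)
  then have "(r - 8 / N)\<^sup>2 \<ge> r\<^sup>2 - 16 * r / N" by simp
  then have "(dist (graph f ?u) (graph f us))\<^sup>2 \<le> (r - 8 / N)\<^sup>2" using D b by linarith
  moreover have "r - 8 / N \<ge> 0"
  proof -
    have "8 / real N \<le> 16 / N" by (rule divide_right_mono) auto
    then show ?thesis using r16 by linarith
  qed
  ultimately have Du: "dist (graph f ?u) (graph f us) \<le> r - 8 / N" by (rule power2_le_imp_le)
  have "centre N x \<in> cball (graph f us) r" if "dist (centre N x) (graph f ?u) \<le> 8 / N" for x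
    using Du that dist_triangle[of "graph f us" "centre N x" "graph f ?u"] by (simp add: dist_commute)
  then show "cell N (left_site h i) \<inter> cball (graph f us) r \<noteq> {}" "cell N (right_site h i) \<inter> cball (graph f us) r \<noteq> {}"
    using step_geometry(3,4)[OF N lip h nz] centre_in_cell[OF N] by blast+
qed

lemma misses_outside:
  assumes N: "N > 0" and h: "tracks f N h" and nz: "step h i \<noteq> 0"
    and i: "e * (of_int i / N - us) \<ge> 0" "e * (of_int i / N - u1) \<ge> y"
    and y: "y > 0" "80 * (r + 1) / N < c0 * y"
  shows "cell N (left_site h i) \<inter> cball (graph f us) r = {}"
    and "cell N (right_site h i) \<inter> cball (graph f us) r = {}"
proof -
  let ?u = "of_int i / real N"
  have D: "(dist (graph f ?u) (graph f us))\<^sup>2 \<ge> r\<^sup>2 + c0 * y" by (rule dist_sq_far_outside[OF i y(1)])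
  have "real N * 1 \<le> real N * real N" using N by (intro mult_left_mono) auto
  then have "64 / (real N)\<^sup>2 \<le> 64 / N" using N by (intro divide_left_mono) (auto simp: power2_eq_square)
  then have "(r + 8 / N)\<^sup>2 \<le> r\<^sup>2 + 16 * r / N + 64 / N" by (simp add: power2_sum power_divide)
  also have "\<dots> = r\<^sup>2 + (16 * r + 64) / N" by (simp add: add_divide_distrib)
  also have "\<dots> \<le> r\<^sup>2 + 80 * (r + 1) / N" using r by (intro add_left_mono divide_right_mono) auto
  finally have "(r + 8 / N)\<^sup>2 < (dist (graph f ?u) (graph f us))\<^sup>2" using D y by linarith
  then have Du: "r + 8 / N < dist (graph f ?u) (graph f us)" by (rule power2_less_imp_less) simp
  have "a \<notin> cball (graph f us) r" if "dist a (graph f ?u) \<le> 8 / N" for a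
    using Du that dist_triangle[of "graph f ?u" "graph f us" a] by (simp add: dist_commute)
  then show "cell N (left_site h i) \<inter> cball (graph f us) r = {}" "cell N (right_site h i) \<inter> cball (graph f us) r = {}"
    using step_geometry(3,4)[OF N lip h nz] by blast+
qed

text \<open>The weight jumps to zero where a cell meets the disc. By transversality this happens within
  \<open>O(1 / N)\<close> of the end point, where the weight is of this order anyway. Hence exceptional steps
  are harmless one by one.\<close>

lemma jump_bound:
  assumes N: "N > 0" and h: "tracks f N h" and \<delta>: "\<delta> > 0"
    and i: "e * (of_int i / N - us) \<ge> 0"
  shows "\<bar>jump N h \<delta> i\<bar> \<le> (9 + 250 * (r + 1) / c0) / N"
proof (cases "step h i = 0")
  case True
  then show ?thesis using r c0 by simp
next
  case nz: False
  let ?u = "of_int i / real N"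
  let ?L = "left_site h i" and ?R = "right_site h i" and ?s = "graph f us" and ?p = "graph f u1"
  note geo = step_geometry[OF N lip h nz]
  have pos: "0 \<le> 250 * (r + 1) / c0" using r c0 by simp
  have lipd: "\<bar>min \<delta> (infdist ?p (cell N ?R)) - min \<delta> (infdist ?p (cell N ?L))\<bar> \<le> 9 / N"
    using infdist_cell_diff[OF N, of ?p ?R ?L] geo(2) by linarith
  have "\<bar>wt N \<delta> ?R - wt N \<delta> ?L\<bar> \<le> (9 + 250 * (r + 1) / c0) / N"
  proof (cases "(cell N ?L \<inter> cball ?s r \<noteq> {}) = (cell N ?R \<inter> cball ?s r \<noteq> {})")
    case True
    then have "\<bar>wt N \<delta> ?R - wt N \<delta> ?L\<bar> \<le> 9 / N" using lipd by (auto simp: half_weight_def)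
    also have "\<dots> \<le> (9 + 250 * (r + 1) / c0) / N" using pos by (intro divide_right_mono) auto
    finally show ?thesis .
  next
    case False
    \<comment> \<open>Only one of the two cells meets the disc, so the step is within the distance \<open>y\<close> of the end
      in the horizontal direction, and both weights are small because they start from zero there.\<close>
    define y where "y = 81 * (r + 1) / (c0 * N)"
    have y: "y > 0" "80 * (r + 1) / N < c0 * y"
    proof -
      show "y > 0" using r c0 N by (simp add: y_def)
      have "80 * (r + 1) / N < 81 * (r + 1) / N" using r N by (intro divide_strict_right_mono) auto
      then show "80 * (r + 1) / N < c0 * y" using c0 by (simp add: y_def)
    qed
    have "\<not> e * (?u - u1) \<le> - y" "\<not> e * (?u - u1) \<ge> y"
      using hits_inside[OF N h nz i _ y] misses_outside[OF N h nz i _ y] False by auto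
    then have "\<bar>e * (?u - u1)\<bar> \<le> y" by linarith
    then have uy: "\<bar>?u - u1\<bar> \<le> y" using e_cases by (simp add: abs_mult)
    have d: "infdist ?p (cell N x) \<le> 8 / N + 3 * y" if "dist (centre N x) (graph f ?u) \<le> 8 / N" for x
    proof -
      have "infdist ?p (cell N x) \<le> dist ?p (centre N x)" by (rule infdist_le[OF centre_in_cell[OF N]])
      also have "\<dots> \<le> dist ?p (graph f ?u) + dist (graph f ?u) (centre N x)" by (rule dist_triangle)
      also have "dist ?p (graph f ?u) \<le> 3 * \<bar>u1 - ?u\<bar>" by (rule dist_graph_le[OF lip])
      also have "\<dots> \<le> 3 * y" using uy by (simp add: abs_minus_commute)
      finally show ?thesis using that by (simp add: dist_commute)
    qed
    have "wt N \<delta> x \<in> {0..8 / N + 3 * y}" if "dist (centre N x) (graph f ?u) \<le> 8 / N" for x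
      using d[OF that] \<delta> y by (auto simp: half_weight_def infdist_nonneg)
    then have "wt N \<delta> ?L \<in> {0..8 / N + 3 * y}" "wt N \<delta> ?R \<in> {0..8 / N + 3 * y}"
      using geo(3,4) centre_in_cell[OF N] by blast+
    then have "\<bar>wt N \<delta> ?R - wt N \<delta> ?L\<bar> \<le> 8 / N + 3 * y" unfolding atLeastAtMost_iff by linarith
    also have "3 * y = (243 * (r + 1) / c0) / N" by (simp add: y_def)
    also have "8 / N + (243 * (r + 1) / c0) / N = (8 + 243 * (r + 1) / c0) / N" by (simp add: add_divide_distrib)
    also have "\<dots> \<le> (9 + 250 * (r + 1) / c0) / N"
      using r c0 by (intro divide_right_mono add_mono) auto
    finally show ?thesis .
  qed
  then show ?thesis using jump_le_of_weights[of h i N \<delta>] by linarith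
qed

text \<open>Near the end point the graph is close to its tangent, and at a distance much larger than
  the lattice spacing so are the cells along it.\<close>

lemma near_ray:
  assumes near: "\<bar>f u - f u1 - k * (u - u1)\<bar> \<le> \<kappa> * \<bar>u - u1\<bar>" and y: "e * (u - u1) > 0" and \<kappa>: "\<kappa> > 0"
    and a: "dist a (graph f u) \<le> \<kappa> * (e * (u - u1))"
  shows "norm (a - graph f u1 - (e * (u - u1) / c) *\<^sub>R (e *\<^sub>R Complex c (k * c))) \<le> 2 * \<kappa> * (e * (u - u1) / c)"
proof -
  define t where "t = e * (u - u1) / c"
  have t: "t > 0" using y c_bounds(1) unfolding t_def by (intro divide_pos_pos)
  have tc: "e * (u - u1) = c * t" using c_bounds(1) unfolding t_def by simp
  have uu: "u - u1 = e * (c * t)" using e_cases(1) by (simp only: tc[symmetric] mult.assoc[symmetric]) simp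
  have "graph f u - graph f u1 - t *\<^sub>R (e *\<^sub>R Complex c (k * c)) = Complex 0 (f u - f u1 - k * (u - u1))"
  proof -
    have "u - u1 - t * (e * c) = 0" using uu by simp
    moreover have "t * (e * (k * c)) = k * (u - u1)" unfolding uu by simp
    ultimately show ?thesis by (simp add: graph_def complex_eq_iff)
  qed
  then have "norm (graph f u - graph f u1 - t *\<^sub>R (e *\<^sub>R Complex c (k * c))) \<le> \<kappa> * \<bar>u - u1\<bar>"
    using near by (simp add: cmod_def)
  moreover have "\<bar>u - u1\<bar> = c * t" using tc y e_cases(2) by (metis abs_mult abs_of_pos mult_1)
  moreover have "norm (a - graph f u1 - t *\<^sub>R (e *\<^sub>R Complex c (k * c))) \<le>
     norm (a - graph f u) + norm (graph f u - graph f u1 - t *\<^sub>R (e *\<^sub>R Complex c (k * c)))"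
    using norm_triangle_ineq[of "a - graph f u" "graph f u - graph f u1 - t *\<^sub>R (e *\<^sub>R Complex c (k * c))"]
    by (simp only: add_diff_eq diff_add_cancel)
  ultimately have "norm (a - graph f u1 - t *\<^sub>R (e *\<^sub>R Complex c (k * c))) \<le> 2 * \<kappa> * (c * t)"
    using a unfolding tc by (simp add: dist_norm)
  also have "\<dots> \<le> 2 * \<kappa> * (1 * t)"
    using c_bounds(2) t \<kappa> by (intro mult_left_mono mult_right_mono) auto
  finally show ?thesis by (simp add: t_def)
qed

text \<open>Well inside the disc both cells meet it, and both weights are zero.\<close>

lemma jump_inner:
  assumes "N > 0" "tracks f N h" "e * (of_int i / N - us) \<ge> 0" "e * (of_int i / N - u1) \<le> - y"
    "y > 0" "80 * (r + 1) / N < c0 * y"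
  shows "jump N h \<delta> i = 0"
  using hits_inside[OF assms(1,2) _ assms(3-6)] by (cases "step h i = 0") (auto simp: half_weight_def)

lemma norm_tangent: "norm (e *\<^sub>R Complex c (k * c)) = 1"
proof -
  have "(norm (Complex c (k * c)))\<^sup>2 = c\<^sup>2 * (1 + k\<^sup>2)" by (simp add: cmod_power2 algebra_simps power_mult_distrib)
  then have "(norm (Complex c (k * c)))\<^sup>2 = 1\<^sup>2" using c_bounds(3) by (simp only: one_power2)
  then have "norm (Complex c (k * c)) = 1" by (rule power2_eq_imp_eq) auto
  then show ?thesis using e_cases(2) by simp
qed

text \<open>Beyond the distance \<open>\<delta>\<close> from the end point both weights have reached the value \<open>\<delta>\<close>.\<close>

lemma jump_outer:
  assumes N: "N > 0" and h: "tracks f N h"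
    and y: "y > 0" "80 * (r + 1) / N < c0 * y" and i: "e * (of_int i / N - us) \<ge> 0" "e * (of_int i / N - u1) \<ge> y"
    and \<kappa>: "0 < \<kappa>" "\<kappa> \<le> 1/4" and \<delta>: "\<delta> > 0" "4 * \<delta> \<le> \<rho>"
    and near: "\<And>u. \<bar>u - u1\<bar> < \<rho> \<Longrightarrow> \<bar>f u - f u1 - k * (u - u1)\<bar> \<le> \<kappa> * \<bar>u - u1\<bar>"
    and far: "e * (of_int i / N - u1) > (1 + 4 * \<kappa>) * (c * \<delta>)"
    and big: "8 / N \<le> \<kappa> * y" "8 / N \<le> \<delta>"
  shows "jump N h \<delta> i = 0"
proof (cases "step h i = 0")
  case nz: False
  let ?u = "of_int i / real N"
  have pos: "e * (?u - u1) > 0" using i(2) y(1) by linarith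
  have far': "infdist (graph f u1) (cell N x) \<ge> \<delta>"
    if x: "\<And>a. a \<in> cell N x \<Longrightarrow> dist a (graph f ?u) \<le> 8 / N" for x
  proof -
    have "\<delta> \<le> dist (graph f u1) a" if a: "a \<in> cell N x" for a
    proof (cases "\<bar>?u - u1\<bar> < \<rho>")
      case True
      define t where "t = e * (?u - u1) / c"
      have "\<kappa> * y \<le> \<kappa> * (e * (?u - u1))" using i(2) \<kappa>(1) by simp
      then have "dist a (graph f ?u) \<le> \<kappa> * (e * (?u - u1))" using x[OF a] big(1) by linarith
      then have nr: "norm (a - graph f u1 - t *\<^sub>R (e *\<^sub>R Complex c (k * c))) \<le> 2 * \<kappa> * t"
        unfolding t_def by (rule near_ray[OF near[OF True] pos \<kappa>(1)])
      have "t > (1 + 4 * \<kappa>) * \<delta>" using far c_bounds(1) unfolding t_def by (simp add: field_simps)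
      moreover have "(1 + 4 * \<kappa>) * \<delta> > 0" using \<kappa> \<delta> by simp
      ultimately have t: "t \<ge> (1 + 4 * \<kappa>) * \<delta>" "t > 0" by linarith+
      have "t = norm (t *\<^sub>R (e *\<^sub>R Complex c (k * c)))"
        by (metis norm_scaleR norm_tangent abs_of_pos mult.right_neutral t(2))
      then have "t - 2 * \<kappa> * t \<le> norm (a - graph f u1)"
        using nr norm_triangle_ineq2[of "t *\<^sub>R (e *\<^sub>R Complex c (k * c))" "a - graph f u1"]
        by (simp only: norm_minus_commute)
      moreover have "\<delta> \<le> t - 2 * \<kappa> * t"
      proof -
        have "(1 + 4 * \<kappa>) * \<delta> * (1 - 2 * \<kappa>) \<le> t * (1 - 2 * \<kappa>)" using t \<kappa> by (intro mult_right_mono) auto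
        moreover have "(1 + 4 * \<kappa>) * \<delta> * (1 - 2 * \<kappa>) = \<delta> + 2 * \<kappa> * \<delta> * (1 - 4 * \<kappa>)" by (simp add: algebra_simps)
        moreover have "2 * \<kappa> * \<delta> * (1 - 4 * \<kappa>) \<ge> 0" using \<kappa> \<delta> by simp
        ultimately show ?thesis by (simp add: algebra_simps)
      qed
      ultimately show ?thesis by (simp add: dist_norm norm_minus_commute)
    next
      case False
      then have "4 * \<delta> \<le> dist (graph f ?u) (graph f u1)" using \<delta>(2) abs_le_dist_graph[of ?u u1 f] by linarith
      then show ?thesis using x[OF a] big(2) \<delta>(1) dist_triangle[of "graph f ?u" "graph f u1" a]
        by (simp add: dist_commute)
    qed
    moreover have "cell N x \<noteq> {}" using centre_in_cell[OF N, of x] by blast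
    ultimately show ?thesis by (simp add: infdist_notempty cINF_greatest)
  qed
  have "infdist (graph f u1) (cell N (left_site h i)) \<ge> \<delta>" "infdist (graph f u1) (cell N (right_site h i)) \<ge> \<delta>"
    by (rule far', erule step_geometry(3)[OF N lip h nz], rule far', erule step_geometry(4)[OF N lip h nz])
  then show ?thesis using misses_outside[OF N h nz i y] by (simp add: half_weight_def)
qed simp

text \<open>Between the end point and the distance \<open>\<delta>\<close> the weight is the distance from the end point,
  which changes by the projection of the displacement \<open>(1, D - sgn D)\<close> on the tangent.\<close>

lemma jump_middle:
  assumes N: "N > 0" and h: "tracks f N h"
    and y: "y > 0" "80 * (r + 1) / N < c0 * y" and i: "e * (of_int i / N - us) \<ge> 0" "e * (of_int i / N - u1) \<ge> y"
    and \<kappa>: "0 < \<kappa>" "\<kappa> \<le> 1/4" and \<delta>: "\<delta> > 0"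
    and near: "\<bar>f (of_int i / N) - f u1 - k * (of_int i / N - u1)\<bar> \<le> \<kappa> * \<bar>of_int i / N - u1\<bar>"
    and close: "e * (of_int i / N - u1) < (1 - 2 * \<kappa>) * (c * \<delta>)"
    and big: "8 / N \<le> \<kappa> * y"
  shows "\<bar>jump N h \<delta> i - e / N * (c * of_int (sgn (step h i)) + k * c * (of_int \<bar>step h i\<bar> - of_int \<bar>sgn (step h i)\<bar>))\<bar>
     \<le> 36 * \<kappa> / N"
proof (cases "step h i = 0")
  case True
  then show ?thesis using \<kappa> by simp
next
  case nz: False
  let ?u = "of_int i / real N" and ?L = "left_site h i" and ?R = "right_site h i" and ?p = "graph f u1"
  let ?b = "e *\<^sub>R Complex c (k * c)"
  define w where "w = centre N ?R - centre N ?L"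
  define t where "t = e * (?u - u1) / c"
  note geo = step_geometry[OF N lip h nz]
  have pos: "e * (?u - u1) > 0" using i(2) y(1) by linarith
  then have t: "t > 0" unfolding t_def using c_bounds(1) by (intro divide_pos_pos)
  have "\<kappa> * y \<le> \<kappa> * (e * (?u - u1))" using i(2) \<kappa>(1) by simp
  then have nr: "norm (a - ?p - t *\<^sub>R ?b) \<le> 2 * \<kappa> * t" if "dist a (graph f ?u) \<le> 8 / N" for a
    unfolding t_def using that big by (intro near_ray[OF near pos \<kappa>(1)]) linarith
  have le\<delta>: "dist ?p a \<le> \<delta>" if a: "dist a (graph f ?u) \<le> 8 / N" for a
  proof -
    have "t < (1 - 2 * \<kappa>) * \<delta>" using close c_bounds(1) unfolding t_def by (simp add: field_simps)
    have "norm (a - ?p) \<le> norm (a - ?p - t *\<^sub>R ?b) + norm (t *\<^sub>R ?b)"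
      using norm_triangle_ineq[of "a - ?p - t *\<^sub>R ?b" "t *\<^sub>R ?b"] by simp
    also have "norm (t *\<^sub>R ?b) = t"
      by (metis norm_scaleR norm_tangent abs_of_pos mult.right_neutral t)
    finally have "norm (a - ?p) \<le> (1 + 2 * \<kappa>) * t" using nr[OF a] by (simp add: algebra_simps)
    also have "\<dots> \<le> (1 + 2 * \<kappa>) * ((1 - 2 * \<kappa>) * \<delta>)"
      using \<open>t < _\<close> \<kappa> by (intro mult_left_mono) auto
    also have "\<dots> = \<delta> - 4 * \<kappa>\<^sup>2 * \<delta>" by (simp add: algebra_simps power2_eq_square)
    also have "\<dots> \<le> \<delta>" using \<delta> by simp
    finally show ?thesis by (simp add: dist_norm norm_minus_commute)
  qed
  have "\<bar>infdist ?p (cell N ?R) - infdist ?p (cell N ?L) - ?b \<bullet> w\<bar> \<le> 2 * (2 * \<kappa>) * norm w"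
  proof (rule infdist_cell_translate[OF N])
    fix a assume a: "a \<in> cell N ?L"
    then have a': "a + w \<in> cell N ?R" using cell_translate[OF N, of a ?L ?R] by (simp add: w_def)
    have "\<bar>norm ((a - ?p) + w) - norm (a - ?p) - ?b \<bullet> w\<bar> \<le> 2 * (2 * \<kappa>) * norm w"
    proof (rule norm_add_near_ray[OF norm_tangent t])
      show "2 * \<kappa> < 1" using \<kappa> by simp
      show "norm (a - ?p - t *\<^sub>R ?b) \<le> 2 * \<kappa> * t" by (rule nr[OF geo(3)[OF a]])
      have "a - ?p + w - t *\<^sub>R ?b = (a + w) - ?p - t *\<^sub>R ?b" by simp
      then show "norm (a - ?p + w - t *\<^sub>R ?b) \<le> 2 * \<kappa> * t" using nr[OF geo(4)[OF a']] by (simp only:)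
    qed
    then show "\<bar>dist ?p (a + (centre N ?R - centre N ?L)) - dist ?p a - ?b \<bullet> w\<bar> \<le> 2 * (2 * \<kappa>) * norm w"
      unfolding w_def[symmetric] by (simp add: dist_norm norm_minus_commute algebra_simps)
  qed
  also have "\<dots> \<le> 2 * (2 * \<kappa>) * (9 / N)" using geo(2) \<kappa>(1) unfolding w_def by (intro mult_left_mono) auto
  finally have *: "\<bar>infdist ?p (cell N ?R) - infdist ?p (cell N ?L) - ?b \<bullet> w\<bar> \<le> 36 * \<kappa> / N" by simp
  have "infdist ?p (cell N ?L) \<le> \<delta>" "infdist ?p (cell N ?R) \<le> \<delta>"
    using le\<delta>[OF geo(3)[OF centre_in_cell[OF N]]] le\<delta>[OF geo(4)[OF centre_in_cell[OF N]]]
      infdist_le[OF centre_in_cell[OF N]] order_trans by blast+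
  then have j: "jump N h \<delta> i = of_int (sgn (step h i)) * (infdist ?p (cell N ?R) - infdist ?p (cell N ?L))"
    using misses_outside[OF N h nz i y] by (simp add: half_weight_def)
  have "of_int (sgn (step h i)) * (?b \<bullet> w)
     = e / N * (c * of_int (sgn (step h i)) + k * c * (of_int \<bar>step h i\<bar> - of_int \<bar>sgn (step h i)\<bar>))"
    unfolding w_def geo(1) using nz by (cases "step h i > 0") (auto simp: inner_complex_def algebra_simps add_divide_distrib diff_divide_distrib)
  then have "jump N h \<delta> i - e / N * (c * of_int (sgn (step h i)) + k * c * (of_int \<bar>step h i\<bar> - of_int \<bar>sgn (step h i)\<bar>))
    = of_int (sgn (step h i)) * (infdist ?p (cell N ?R) - infdist ?p (cell N ?L) - ?b \<bullet> w)"
    unfolding j by (simp add: right_diff_distrib)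
  then show ?thesis using * nz by (simp add: abs_mult sgn_if)
qed

text \<open>The hypothesis \<open>steps\<close> says that the projections of the steps are an affine function of the heights of the
  steps. Their sum over the middle region then telescopes, and only the number of columns and the
  total height difference enter, whatever the order of the steps is.\<close>

lemma end_sum_explicit:
  fixes J :: "int set"
  assumes \<kappa>: "0 < \<kappa>" "\<kappa> \<le> 1/4" "\<kappa> \<le> c / 4" and \<delta>: "\<delta> > 0" "4 * \<delta> \<le> \<rho>" "4 * \<delta> \<le> e * (u1 - us)"
    and near: "\<And>u. \<bar>u - u1\<bar> < \<rho> \<Longrightarrow> \<bar>f u - f u1 - k * (u - u1)\<bar> \<le> \<kappa> * \<bar>u - u1\<bar>"
    and N: "N > 0" and h: "tracks f N h"
    and steps: "\<And>i. \<bar>of_int i / N - u1\<bar> < \<rho> \<Longrightarrow>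
        c * of_int (sgn (step h i)) + k * c * (of_int \<bar>step h i\<bar> - of_int \<bar>sgn (step h i)\<bar>)
        = \<alpha> + \<beta> * of_int (step h i)"
    and big: "80 * (r + 1) / N < c0 * (\<kappa> * \<delta>)" "10 / N \<le> \<kappa> * (\<kappa> * \<delta>)"
    and J: "finite J" "\<And>i. i \<in> J \<Longrightarrow> e * (of_int i / N - us) \<ge> 0"
      "\<And>i. e * (of_int i / N - us) > 0 \<Longrightarrow> \<bar>of_int i / N - u1\<bar> \<le> 2 * \<delta> \<Longrightarrow> i \<in> J"
  shows "\<bar>(\<Sum>i\<in>J. jump N h \<delta> i) - e * \<delta> * (c * (\<alpha> + \<beta> * k))\<bar>
     \<le> \<kappa> * \<delta> * (9 * (9 + 250 * (r + 1) / c0) + 72 + 4 * \<bar>\<alpha>\<bar> + \<bar>\<beta>\<bar> * (3 + 3 * \<bar>k\<bar>))"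
proof -
  define K where "K = 9 + 250 * (r + 1) / c0"
  have K: "K > 0" using r c0 by (simp add: K_def add_pos_pos)
  define a where "a = \<kappa> * \<delta>"
  define b where "b = (1 - 2 * \<kappa>) * (c * \<delta>)"
  define b' where "b' = (1 + 4 * \<kappa>) * (c * \<delta>)"
  have c\<delta>: "0 < c * \<delta>" "c * \<delta> \<le> \<delta>" using c_bounds \<delta> by auto
  have \<kappa>c\<delta>: "\<kappa> * (c * \<delta>) \<le> \<kappa> * \<delta>" using c\<delta> \<kappa> by (intro mult_left_mono) auto
  have a: "a > 0" using \<kappa> \<delta> by (simp add: a_def)
  have a\<delta>: "a \<le> \<delta> / 4" using \<kappa> \<delta> by (simp add: a_def)
  have ab: "a < b"
  proof -
    have "\<kappa> * \<delta> \<le> c / 4 * \<delta>" using \<kappa> \<delta> by (intro mult_right_mono) auto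
    moreover have "1/2 * (c * \<delta>) \<le> b" unfolding b_def using \<kappa> c\<delta> by (intro mult_right_mono) auto
    moreover have "c / 4 * \<delta> = c * \<delta> / 4" by simp
    ultimately show ?thesis using c\<delta> unfolding a_def by linarith
  qed
  have bb: "b \<le> b'" "b' - b \<le> 6 * a" "b' \<le> 2 * \<delta>" "b \<le> \<delta>" "\<bar>b - a - c * \<delta>\<bar> \<le> 3 * a"
  proof -
    have "b' - b = 6 * (\<kappa> * (c * \<delta>))" by (simp add: b_def b'_def algebra_simps)
    moreover have "\<kappa> * (c * \<delta>) > 0" using \<kappa> c\<delta> by simp
    ultimately show "b \<le> b'" "b' - b \<le> 6 * a" using \<kappa>c\<delta> unfolding a_def by linarith+
    have "b' \<le> 2 * (c * \<delta>)" unfolding b'_def using \<kappa> c\<delta> by (intro mult_right_mono) auto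
    then show "b' \<le> 2 * \<delta>" using c\<delta> by linarith
    have b: "b = c * \<delta> - 2 * (\<kappa> * (c * \<delta>))" by (simp add: b_def algebra_simps)
    moreover have "\<kappa> * (c * \<delta>) > 0" using \<kappa> c\<delta> by simp
    ultimately show "b \<le> \<delta>" "\<bar>b - a - c * \<delta>\<bar> \<le> 3 * a" using c\<delta> \<kappa>c\<delta> a unfolding a_def by linarith+
  qed
  have NN: "10 / N \<le> a" "8 / N \<le> \<kappa> * a" "8 / N \<le> \<delta>" "2 / N \<le> a" "1 / N \<le> a" "1 / N \<le> \<delta>"
  proof -
    have 1: "8 / real N \<le> 10 / N" "2 / real N \<le> 10 / N" "1 / real N \<le> 10 / N" by (auto intro: divide_right_mono)
    have "\<kappa> * (\<kappa> * \<delta>) \<le> 1 * (\<kappa> * \<delta>)" using \<kappa> a by (intro mult_right_mono) (auto simp: a_def)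
    then show 2: "10 / N \<le> a" using big(2) by (simp add: a_def)
    show "8 / N \<le> \<kappa> * a" using 1 big(2) by (simp add: a_def)
    show "8 / N \<le> \<delta>" "2 / N \<le> a" "1 / N \<le> a" "1 / N \<le> \<delta>" using 1 2 a\<delta> \<delta>(1) a by linarith+
  qed
  have big': "80 * (r + 1) / N < c0 * a" using big(1) by (simp add: a_def)
  define A where "A = (if e = 1 then u1 + a else u1 - b)"
  define B where "B = (if e = 1 then u1 + b else u1 - a)"
  define A' where "A' = (if e = 1 then u1 + b else u1 - b')"
  define B' where "B' = (if e = 1 then u1 + b' else u1 - b)"
  have AB: "A < B" "B - A = b - a" "\<bar>A - u1\<bar> \<le> \<delta>" "\<bar>B - u1\<bar> \<le> \<delta>" "\<bar>A - u1\<bar> + \<bar>B - u1\<bar> \<le> 2 * \<delta>" 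
    "A' \<le> B'" "B' - A' = b' - b"
    using ab bb a a\<delta> \<delta> by (auto simp: A_def B_def A'_def B'_def)
  \<comment> \<open>Steps outside these three sets have equal weights on both sides. The two bad sets, at the end point
    and at the distance \<open>\<delta>\<close> from it, contain few steps; all other steps see the tangent direction.\<close>
  define mid where "mid = {i::int. A < of_int i / N \<and> of_int i / N < B}"
  define bad1 where "bad1 = {i::int. u1 - a \<le> of_int i / N \<and> of_int i / N \<le> u1 + a}"
  define bad2 where "bad2 = {i::int. A' \<le> of_int i / N \<and> of_int i / N \<le> B'}"
  have mid_iff: "i \<in> mid \<longleftrightarrow> a < e * (of_int i / N - u1) \<and> e * (of_int i / N - u1) < b" for i
    using e by (auto simp: mid_def A_def B_def)
  have bad_iff: "i \<in> bad1 \<union> bad2 \<longleftrightarrow> \<bar>of_int i / N - u1\<bar> \<le> a \<or> (b \<le> e * (of_int i / N - u1) \<and> e * (of_int i / N - u1) \<le> b')" for i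
    using e by (auto simp: bad1_def bad2_def A'_def B'_def)
  have mid_side: "e * (of_int i / N - us) > 0" "\<bar>of_int i / N - u1\<bar> < \<rho>" "\<bar>of_int i / N - u1\<bar> \<le> 2 * \<delta>" if "i \<in> mid" for i
  proof -
    have "\<bar>e * (of_int i / N - u1)\<bar> < b" using that a unfolding mid_iff by auto
    then have *: "\<bar>of_int i / N - u1\<bar> < b" by (simp only: abs_mult e_cases(2) mult_1)
    then show "\<bar>of_int i / N - u1\<bar> < \<rho>" "\<bar>of_int i / N - u1\<bar> \<le> 2 * \<delta>" using bb \<delta> by linarith+
    show "e * (of_int i / N - us) > 0" using e * bb \<delta> outward by auto
  qed
  have midJ: "mid \<subseteq> J" using mid_side J(3) by blast
  have finmid: "finite mid" using J(1) midJ finite_subset by blast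
  have fins: "finite bad1" "finite bad2" unfolding bad1_def bad2_def
    by (rule real_card_multiples_closed(1)[OF N])+
  have zero: "jump N h \<delta> i = 0" if i: "i \<in> J" "i \<notin> mid" "i \<notin> bad1 \<union> bad2" for i
  proof -
    let ?y = "e * (of_int i / N - u1)"
    have abs: "\<bar>of_int i / N - u1\<bar> = \<bar>?y\<bar>" by (simp only: abs_mult e_cases(2) mult_1)
    consider "?y \<le> - a" | "?y > b'"
      using i(2,3) ab bb(1) unfolding mid_iff bad_iff abs by linarith
    then show ?thesis
    proof cases
      case 1
      then show ?thesis by (rule jump_inner[OF N h J(2)[OF i(1)] _ a big'])
    next
      case 2
      show ?thesis
        by (rule jump_outer[OF N h a big' J(2)[OF i(1)] _ \<kappa>(1,2) \<delta>(1,2) near]) (use 2 ab bb(1) NN in \<open>auto simp: b'_def\<close>)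
    qed
  qed
  have "\<bar>(\<Sum>i\<in>J - mid. jump N h \<delta> i)\<bar> \<le> 9 * K * a"
  proof -
    have "\<bar>\<Sum>i\<in>J - mid. jump N h \<delta> i\<bar> = \<bar>\<Sum>i\<in>(J - mid) \<inter> (bad1 \<union> bad2). jump N h \<delta> i\<bar>"
      using J(1) zero by (intro arg_cong[where f = abs] sum.mono_neutral_right) auto
    also have "\<dots> \<le> (\<Sum>i\<in>(J - mid) \<inter> (bad1 \<union> bad2). \<bar>jump N h \<delta> i\<bar>)" by (rule sum_abs)
    also have "\<dots> \<le> (\<Sum>i\<in>(J - mid) \<inter> (bad1 \<union> bad2). K / N)"
      unfolding K_def by (intro sum_mono jump_bound[OF N h \<delta>(1)] J(2)) auto
    also have "\<dots> \<le> (\<Sum>i\<in>bad1 \<union> bad2. K / N)"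
      using fins K by (intro sum_mono2) auto
    also have "\<dots> = real (card (bad1 \<union> bad2)) * (K / N)" by simp
    also have "\<dots> \<le> (real N * (8 * a) + 2) * (K / N)"
    proof (rule mult_right_mono)
      have "real (card (bad1 \<union> bad2)) \<le> real (card bad1) + real (card bad2)"
        by (simp flip: of_nat_add add: card_Un_le)
      also have "\<dots> \<le> (real N * (u1 + a - (u1 - a)) + 1) + (real N * (B' - A') + 1)"
        unfolding bad1_def bad2_def using a AB(6) by (intro add_mono real_card_multiples_closed(2)[OF N]) auto
      also have "\<dots> \<le> real N * (2 * a) + 1 + (real N * (6 * a) + 1)"
        using bb(2) N by (simp add: AB(7))
      finally show "real (card (bad1 \<union> bad2)) \<le> real N * (8 * a) + 2" by (simp add: algebra_simps)
    qed (use K in simp)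
    also have "\<dots> = K * (8 * a + 2 / N)" using N by (simp add: field_simps)
    also have "\<dots> \<le> K * (9 * a)" using NN K by (intro mult_left_mono) auto
    finally show ?thesis by simp
  qed
  moreover have "\<bar>(\<Sum>i\<in>mid. jump N h \<delta> i) - e / N * (\<Sum>i\<in>mid. \<alpha> + \<beta> * of_int (step h i))\<bar> \<le> 72 * a"
  proof -
    have "\<bar>(\<Sum>i\<in>mid. jump N h \<delta> i) - e / N * (\<Sum>i\<in>mid. \<alpha> + \<beta> * of_int (step h i))\<bar>
      = \<bar>\<Sum>i\<in>mid. jump N h \<delta> i - e / N * (\<alpha> + \<beta> * of_int (step h i))\<bar>"
      by (simp only: sum_subtractf sum_distrib_left)
    also have "\<dots> \<le> (\<Sum>i\<in>mid. \<bar>jump N h \<delta> i - e / N * (\<alpha> + \<beta> * of_int (step h i))\<bar>)" by (rule sum_abs)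
    also have "\<dots> \<le> (\<Sum>i\<in>mid. 36 * \<kappa> / N)"
    proof (rule sum_mono)
      fix i assume i: "i \<in> mid"
      note m = mid_side[OF i]
      show "\<bar>jump N h \<delta> i - e / N * (\<alpha> + \<beta> * of_int (step h i))\<bar> \<le> 36 * \<kappa> / N"
        unfolding steps[OF m(2), symmetric]
        by (rule jump_middle[OF N h a big' _ _ \<kappa>(1,2) \<delta>(1) near[OF m(2)]])
          (use m i NN in \<open>auto simp: mid_iff b_def\<close>)
    qed
    also have "\<dots> = real (card mid) * (36 * \<kappa> / N)" by simp
    also have "\<dots> \<le> (real N * (2 * \<delta>)) * (36 * \<kappa> / N)"
    proof (rule mult_right_mono)
      have "mid \<subseteq> {i::int. A \<le> of_int i / N \<and> of_int i / N \<le> B}" by (auto simp: mid_def)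
      then have "real (card mid) \<le> real (card {i::int. A \<le> of_int i / N \<and> of_int i / N \<le> B})"
        using real_card_multiples_closed(1)[OF N] by (simp add: card_mono)
      also have "\<dots> \<le> real N * (B - A) + 1" using AB(1) by (intro real_card_multiples_closed(2)[OF N]) simp
      also have "\<dots> \<le> real N * \<delta> + real N * \<delta>"
      proof (rule add_mono)
        show "real N * (B - A) \<le> real N * \<delta>" unfolding AB(2) using bb(4) a by (intro mult_left_mono) auto
        show "1 \<le> real N * \<delta>" using NN(6) N by (simp add: field_simps)
      qed
      finally show "real (card mid) \<le> real N * (2 * \<delta>)" by (simp add: mult_ac)
    qed (use \<kappa> in simp)
    also have "\<dots> = 72 * a" using N by (simp add: a_def)
    finally show ?thesis .
  qed
  moreover have "\<bar>e / N * (\<Sum>i\<in>mid. \<alpha> + \<beta> * of_int (step h i)) - e * \<delta> * (c * (\<alpha> + \<beta> * k))\<bar>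
     \<le> \<bar>\<alpha>\<bar> * (4 * a) + \<bar>\<beta>\<bar> * ((3 + 3 * \<bar>k\<bar>) * a)"
  proof -
    let ?l = "\<lfloor>real N * A\<rfloor> + 1" and ?h = "\<lceil>real N * B\<rceil>"
    have mid: "mid = {?l..<?h}" unfolding mid_def by (rule multiples_open_interval[OF N])
    have "real N * A < real N * B" using AB N by simp
    then have lh: "?l \<le> ?h" by linarith
    have l: "\<bar>of_int ?l / N - A\<bar> \<le> 1 / N"
    proof -
      have "\<bar>of_int ?l - real N * A\<bar> \<le> 1" by linarith
      then have "\<bar>of_int ?l - real N * A\<bar> / N \<le> 1 / N" by (simp add: divide_right_mono)
      moreover have "of_int ?l / N - A = (of_int ?l - real N * A) / N" using N by (simp add: field_simps)
      ultimately show ?thesis by simp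
    qed
    have hh: "\<bar>of_int ?h / N - B\<bar> \<le> 1 / N"
    proof -
      have "\<bar>of_int ?h - real N * B\<bar> \<le> 1" by linarith
      then have "\<bar>of_int ?h - real N * B\<bar> / N \<le> 1 / N" by (simp add: divide_right_mono)
      moreover have "of_int ?h / N - B = (of_int ?h - real N * B) / N" using N by (simp add: field_simps)
      ultimately show ?thesis by simp
    qed
    have height: "\<bar>of_int (h i) / N - f v\<bar> \<le> 5 / N" if "\<bar>of_int i / N - v\<bar> \<le> 1 / N" for i v
    proof -
      have "\<bar>of_int (h i) - real N * f (of_int i / real N)\<bar> / N \<le> 3 / N"
        using h by (intro divide_right_mono) (auto simp: tracks_def)
      moreover have "(of_int (h i) - real N * f (of_int i / real N)) / N = of_int (h i) / N - f (of_int i / N)"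
        using N by (simp add: field_simps)
      ultimately have "\<bar>of_int (h i) / N - f (of_int i / N)\<bar> \<le> 3 / N" by (metis abs_divide abs_of_nat)
      moreover have "\<bar>f (of_int i / N) - f v\<bar> \<le> 2 * (1 / N)" 
        using order_trans[OF lip mult_left_mono[OF that]] by simp
      moreover have "5 / real N = 3 / N + 2 * (1 / N)" by simp
      ultimately show ?thesis by linarith
    qed
    have S1: "\<bar>real (card mid) / N - c * \<delta>\<bar> \<le> 4 * a"
    proof -
      have "real (card mid) = of_int (?h - ?l)" unfolding mid using lh by simp
      then have "real (card mid) / N = of_int ?h / N - of_int ?l / N" by (simp add: diff_divide_distrib)
      then have "\<bar>real (card mid) / N - (B - A)\<bar> \<le> 2 * (1 / N)" using l hh by linarith
      moreover have "2 * (1 / real N) \<le> a" using NN(4) by simp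
      ultimately show ?thesis using bb(5) AB(2) by linarith
    qed
    have S2: "\<bar>(\<Sum>i\<in>mid. of_int (step h i)) / N - k * (c * \<delta>)\<bar> \<le> (3 + 3 * \<bar>k\<bar>) * a"
    proof -
      have "(\<Sum>i\<in>mid. of_int (step h i)) = (of_int (h ?h - h ?l) :: real)"
        unfolding mid step_def of_int_sum[symmetric] sum_int_telescope[OF lh] ..
      then have "(\<Sum>i\<in>mid. of_int (step h i)) / N = of_int (h ?h) / N - of_int (h ?l) / N" by (simp add: diff_divide_distrib)
      then have "\<bar>(\<Sum>i\<in>mid. of_int (step h i)) / N - (f B - f A)\<bar> \<le> 2 * (5 / N)"
        using height[OF hh] height[OF l] by linarith
      moreover have "2 * (5 / real N) = 10 / N" by simp
      ultimately have 1: "\<bar>(\<Sum>i\<in>mid. of_int (step h i)) / N - (f B - f A)\<bar> \<le> a" using NN(1) by linarith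
      have "\<bar>A - u1\<bar> < \<rho>" "\<bar>B - u1\<bar> < \<rho>" using AB(3,4) \<delta> by linarith+
      then have "\<bar>f A - f u1 - k * (A - u1)\<bar> \<le> \<kappa> * \<bar>A - u1\<bar>" "\<bar>f B - f u1 - k * (B - u1)\<bar> \<le> \<kappa> * \<bar>B - u1\<bar>"
        by (auto intro: near)
      moreover have "\<kappa> * \<bar>A - u1\<bar> \<le> a" "\<kappa> * \<bar>B - u1\<bar> \<le> a"
        unfolding a_def using AB(3,4) \<kappa> by (auto intro: mult_left_mono)
      moreover have "(f B - f A) - k * (B - A) = (f B - f u1 - k * (B - u1)) - (f A - f u1 - k * (A - u1))"
        by (simp add: algebra_simps)
      ultimately have 2: "\<bar>(f B - f A) - k * (B - A)\<bar> \<le> 2 * a" by linarith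
      have "k * (B - A) - k * (c * \<delta>) = k * (b - a - c * \<delta>)" by (simp add: AB(2) algebra_simps)
      then have "\<bar>k * (B - A) - k * (c * \<delta>)\<bar> \<le> \<bar>k\<bar> * (3 * a)" using bb(5) by (simp add: abs_mult mult_left_mono)
      moreover have "(3 + 3 * \<bar>k\<bar>) * a = a + 2 * a + \<bar>k\<bar> * (3 * a)" by (simp add: algebra_simps)
      ultimately show ?thesis using 1 2 by linarith
    qed
    have "e / N * (\<Sum>i\<in>mid. \<alpha> + \<beta> * of_int (step h i)) - e * \<delta> * (c * (\<alpha> + \<beta> * k))
      = e * (\<alpha> * (real (card mid) / N - c * \<delta>) + \<beta> * ((\<Sum>i\<in>mid. of_int (step h i)) / N - k * (c * \<delta>)))"
      by (simp add: sum.distrib sum_distrib_left[symmetric] add_divide_distrib algebra_simps)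
    then have "\<bar>e / N * (\<Sum>i\<in>mid. \<alpha> + \<beta> * of_int (step h i)) - e * \<delta> * (c * (\<alpha> + \<beta> * k))\<bar>
      = \<bar>\<alpha> * (real (card mid) / N - c * \<delta>) + \<beta> * ((\<Sum>i\<in>mid. of_int (step h i)) / N - k * (c * \<delta>))\<bar>"
      by (simp only: abs_mult[of e] e_cases(2) mult_1)
    also have "\<dots> \<le> \<bar>\<alpha>\<bar> * \<bar>real (card mid) / N - c * \<delta>\<bar> + \<bar>\<beta>\<bar> * \<bar>(\<Sum>i\<in>mid. of_int (step h i)) / N - k * (c * \<delta>)\<bar>"
      unfolding abs_mult[symmetric] by (rule abs_triangle_ineq)
    also have "\<dots> \<le> \<bar>\<alpha>\<bar> * (4 * a) + \<bar>\<beta>\<bar> * ((3 + 3 * \<bar>k\<bar>) * a)"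
      using S1 S2 by (intro add_mono mult_left_mono) auto
    finally show ?thesis .
  qed
  moreover have "(\<Sum>i\<in>J. jump N h \<delta> i) = (\<Sum>i\<in>J - mid. jump N h \<delta> i) + (\<Sum>i\<in>mid. jump N h \<delta> i)"
    using sum.subset_diff[OF midJ J(1)] .
  moreover have "\<bar>S - v\<bar> \<le> p + q + w"
    if "\<bar>x\<bar> \<le> p" "\<bar>y - z\<bar> \<le> q" "\<bar>z - v\<bar> \<le> w" "S = x + y" for S v x y z p q w :: real
    using that by linarith
  ultimately have "\<bar>(\<Sum>i\<in>J. jump N h \<delta> i) - e * \<delta> * (c * (\<alpha> + \<beta> * k))\<bar>
    \<le> 9 * K * a + 72 * a + (\<bar>\<alpha>\<bar> * (4 * a) + \<bar>\<beta>\<bar> * ((3 + 3 * \<bar>k\<bar>) * a))" by blast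
  also have "\<dots> = a * (9 * K + 72 + 4 * \<bar>\<alpha>\<bar> + \<bar>\<beta>\<bar> * (3 + 3 * \<bar>k\<bar>))" by (simp add: algebra_simps)
  finally show ?thesis by (simp only: a_def K_def)
qed

lemma end_sum:
  assumes "\<epsilon> > 0" "\<rho> > 0"
  obtains \<delta>0 where "\<delta>0 > 0" and "\<And>\<delta>. 0 < \<delta> \<Longrightarrow> \<delta> < \<delta>0 \<Longrightarrow> \<forall>\<^sub>F N in sequentially. \<forall>h J.
      tracks f N h \<longrightarrow>
      (\<forall>i. \<bar>of_int i / N - u1\<bar> < \<rho> \<longrightarrow>
        c * of_int (sgn (step h i)) + k * c * (of_int \<bar>step h i\<bar> - of_int \<bar>sgn (step h i)\<bar>)
        = \<alpha> + \<beta> * of_int (step h i)) \<longrightarrow>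
      finite J \<longrightarrow> (\<forall>i\<in>J. e * (of_int i / N - us) \<ge> 0) \<longrightarrow>
      (\<forall>i. e * (of_int i / N - us) > 0 \<longrightarrow> \<bar>of_int i / N - u1\<bar> \<le> 2 * \<delta> \<longrightarrow> i \<in> J) \<longrightarrow>
      \<bar>(\<Sum>i\<in>J. jump N h \<delta> i) - e * \<delta> * (c * (\<alpha> + \<beta> * k))\<bar> \<le> \<epsilon> * \<delta>"
proof -
  define K where "K = 9 * (9 + 250 * (r + 1) / c0) + 72 + 4 * \<bar>\<alpha>\<bar> + \<bar>\<beta>\<bar> * (3 + 3 * \<bar>k\<bar>)"
  have K: "K > 0"
  proof -
    have pos: "0 < 9 * (9 + x) + 72 + 4 * z + y" if "0 \<le> x" "0 \<le> y" "0 \<le> z" for x y z :: real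
      unfolding distrib_left using that by linarith
    show ?thesis unfolding K_def using r c0 by (intro pos) auto
  qed
  define \<kappa> where "\<kappa> = min (1/4) (min (c / 4) (\<epsilon> / K))"
  have \<kappa>: "0 < \<kappa>" "\<kappa> \<le> 1/4" "\<kappa> \<le> c / 4" "\<kappa> * K \<le> \<epsilon>"
  proof -
    show "0 < \<kappa>" using c_bounds(1) assms(1) K by (auto simp: \<kappa>_def)
    show "\<kappa> \<le> 1/4" "\<kappa> \<le> c / 4" unfolding \<kappa>_def by linarith+
    have "\<kappa> \<le> \<epsilon> / K" by (simp add: \<kappa>_def)
    then show "\<kappa> * K \<le> \<epsilon>" using K by (simp add: field_simps)
  qed
  have "(f has_derivative (\<lambda>h. k * h)) (at u1)" using deriv by (simp add: has_field_derivative_def)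
  then obtain d where d: "d > 0" "\<And>y. \<bar>y - u1\<bar> < d \<Longrightarrow> \<bar>f y - f u1 - k * (y - u1)\<bar> \<le> \<kappa> * \<bar>y - u1\<bar>"
    unfolding has_derivative_at_alt using \<kappa>(1) by auto
  define \<delta>0 where "\<delta>0 = min (min d \<rho>) (e * (u1 - us)) / 4"
  show thesis
  proof (rule that[of \<delta>0])
    show "\<delta>0 > 0" using d assms(2) outward by (simp add: \<delta>0_def)
  next
    fix \<delta> assume \<delta>: "0 < \<delta>" "\<delta> < \<delta>0"
    then have \<delta>': "4 * \<delta> \<le> min d \<rho>" "4 * \<delta> \<le> e * (u1 - us)" by (auto simp: \<delta>0_def)
    have *: "\<forall>\<^sub>F N in sequentially. x / real N < y" if "y > 0" for x y
    proof -
      have "(\<lambda>N. x / real N) \<longlonglongrightarrow> 0" by (rule lim_const_over_n)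
      then show ?thesis using that by (rule order_tendstoD(2))
    qed
    have 1: "\<forall>\<^sub>F N in sequentially. 80 * (r + 1) / real N < c0 * (\<kappa> * \<delta>)" using c0 \<kappa> \<delta> by (intro *) simp
    have 2: "\<forall>\<^sub>F N in sequentially. 10 / real N < \<kappa> * (\<kappa> * \<delta>)" using \<kappa> \<delta> by (intro *) simp
    show "\<forall>\<^sub>F N in sequentially. \<forall>h J.
      tracks f N h \<longrightarrow>
      (\<forall>i. \<bar>of_int i / N - u1\<bar> < \<rho> \<longrightarrow>
        c * of_int (sgn (step h i)) + k * c * (of_int \<bar>step h i\<bar> - of_int \<bar>sgn (step h i)\<bar>)
        = \<alpha> + \<beta> * of_int (step h i)) \<longrightarrow>
      finite J \<longrightarrow> (\<forall>i\<in>J. e * (of_int i / N - us) \<ge> 0) \<longrightarrow>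
      (\<forall>i. e * (of_int i / N - us) > 0 \<longrightarrow> \<bar>of_int i / N - u1\<bar> \<le> 2 * \<delta> \<longrightarrow> i \<in> J) \<longrightarrow>
      \<bar>(\<Sum>i\<in>J. jump N h \<delta> i) - e * \<delta> * (c * (\<alpha> + \<beta> * k))\<bar> \<le> \<epsilon> * \<delta>"
      using 1 2 eventually_gt_at_top[of 0]
    proof eventually_elim
      case (elim N)
      show ?case
      proof (intro allI impI)
        fix h J
        assume h: "tracks f N h"
          and steps: "\<forall>i. \<bar>of_int i / N - u1\<bar> < \<rho> \<longrightarrow>
        c * of_int (sgn (step h i)) + k * c * (of_int \<bar>step h i\<bar> - of_int \<bar>sgn (step h i)\<bar>)
        = \<alpha> + \<beta> * of_int (step h i)"
          and J: "finite J" "\<forall>i\<in>J. e * (of_int i / N - us) \<ge> 0"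
           "\<forall>i. e * (of_int i / N - us) > 0 \<longrightarrow> \<bar>of_int i / N - u1\<bar> \<le> 2 * \<delta> \<longrightarrow> i \<in> J"
        have "\<bar>(\<Sum>i\<in>J. jump N h \<delta> i) - e * \<delta> * (c * (\<alpha> + \<beta> * k))\<bar> \<le> \<kappa> * \<delta> * K"
          unfolding K_def
          by (rule end_sum_explicit[OF \<kappa>(1-3) \<delta>(1) \<delta>' _ elim(3) h _ elim(1) less_imp_le[OF elim(2)] J(1)])
            (use d(2) steps J in auto)
        also have "\<dots> = \<kappa> * K * \<delta>" by simp
        also have "\<dots> \<le> \<epsilon> * \<delta>" using \<kappa>(4) \<delta>(1) by (intro mult_right_mono) auto
        finally show "\<bar>(\<Sum>i\<in>J. jump N h \<delta> i) - e * \<delta> * (c * (\<alpha> + \<beta> * k))\<bar> \<le> \<epsilon> * \<delta>" .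
      qed
    qed
  qed
qed

end

section \<open>Column heights of a discretized graph\<close>

definition strip :: "nat \<Rightarrow> int \<Rightarrow> real set" where
  "strip N i = {x. (of_int i - 1/2) / real N \<le> x \<and> x < (of_int i + 1/2) / real N}"

text \<open>Integer bounds for the increments of \<open>f\<close> over one lattice spacing pass to the heights: a column and its
  neighbour see values of \<open>f\<close> at points that correspond to each other by a translation by \<open>1 / N\<close>.
  This is exact, whereas \<open>tracks\<close> would only give bounds up to rounding.\<close>

definition slope_controlled :: "(real \<Rightarrow> real) \<Rightarrow> nat \<Rightarrow> (int \<Rightarrow> int) \<Rightarrow> bool" where
  "slope_controlled f N h \<longleftrightarrow>
     (\<forall>i a b. (\<forall>x\<in>strip N i. of_int a / N \<le> f (x + 1 / N) - f x \<and> f (x + 1 / N) - f x \<le> of_int b / N)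
        \<longrightarrow> a \<le> step h i \<and> step h i \<le> b)"

lemma strip_shift:
  assumes "N > 0"
  shows "x + 1 / N \<in> strip N (i + 1) \<longleftrightarrow> x \<in> strip N i"
  by (auto simp: strip_def add_divide_distrib diff_divide_distrib)

lemma strip_near:
  assumes "N > 0" "x \<in> strip N i"
  shows "\<bar>x - of_int i / N\<bar> \<le> 1 / (2 * real N)"
proof -
  define d where "d = 1 / (2 * real N)"
  have "(of_int i - 1/2) / real N = of_int i / N - d" "(of_int i + 1/2) / real N = of_int i / N + d"
    by (simp_all add: d_def diff_divide_distrib add_divide_distrib)
  then show ?thesis using assms(2) unfolding strip_def mem_Collect_eq d_def[symmetric] by auto
qed

text \<open>The predicate \<open>Q i j\<close> stands for the statement that the site \<open>(i, j)\<close> belongs to the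
  upper phase.\<close>

lemma height_function_exists:
  assumes up: "\<And>i j j'. Q i j \<Longrightarrow> j \<le> j' \<Longrightarrow> Q i j'"
    and lo: "\<And>i j. Q i j \<Longrightarrow> real N * f (of_int i / N) \<le> of_int j + 2"
    and hi: "\<And>i j. \<not> Q i j \<Longrightarrow> of_int j - 2 \<le> real N * f (of_int i / N)"
    and shift: "\<And>i j a b. (\<forall>x\<in>strip N i. of_int a / N \<le> f (x + 1 / N) - f x \<and> f (x + 1 / N) - f x \<le> of_int b / N)
       \<Longrightarrow> (Q i j \<longrightarrow> Q (i + 1) (j + b)) \<and> (Q (i + 1) j \<longrightarrow> Q i (j - a))"
  obtains h where "\<And>i j. Q i j \<longleftrightarrow> h i < j" "tracks f N h" "slope_controlled f N h"
proof -
  have "\<exists>m. \<forall>j. Q i j \<longleftrightarrow> m < j" for i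
  proof -
    define l where "l = \<lfloor>real N * f (of_int i / N)\<rfloor> - 3"
    have nl: "\<not> Q i l"
    proof
      assume "Q i l" from lo[OF this] show False unfolding l_def by linarith
    qed
    have "Q i (l + int 7)"
    proof (rule ccontr)
      assume "\<not> Q i (l + int 7)" from hi[OF this] show False unfolding l_def by simp linarith
    qed
    then have ex: "\<exists>n. Q i (l + int n)" by blast
    define n where "n = (LEAST n. Q i (l + int n))"
    have Qn: "Q i (l + int n)" unfolding n_def using ex by (rule LeastI_ex)
    then have n0: "n \<noteq> 0" using nl by (intro notI) simp
    have "\<not> Q i (l + int m)" if "m < n" for m
      using not_less_Least[of m "\<lambda>n. Q i (l + int n)"] that unfolding n_def by blast
    then have "\<not> Q i (l + int (n - 1))" using n0 by (metis diff_less less_one neq0_conv)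
    then have "Q i j \<longleftrightarrow> l + int n - 1 < j" for j
      using up[OF Qn, of j] up[of i j "l + int (n - 1)"] n0 by (cases "l + int n \<le> j") (auto simp: of_nat_diff)
    then show ?thesis by blast
  qed
  then obtain h where h: "\<And>i j. Q i j \<longleftrightarrow> h i < j" by metis
  show thesis
  proof (rule that[OF h])
    show "tracks f N h" unfolding tracks_def
    proof
      fix i
      have "Q i (h i + 1)" "\<not> Q i (h i)" by (simp_all add: h)
      then show "\<bar>of_int (h i) - real N * f (of_int i / real N)\<bar> \<le> 3" using lo[of i "h i + 1"] hi[of i "h i"] by simp
    qed
    show "slope_controlled f N h" unfolding slope_controlled_def
    proof (intro allI impI)
      fix i a b
      assume c: "\<forall>x\<in>strip N i. of_int a / N \<le> f (x + 1 / N) - f x \<and> f (x + 1 / N) - f x \<le> of_int b / N"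
      show "a \<le> step h i \<and> step h i \<le> b"
        using shift[OF c, of "h i + 1"] shift[OF c, of "h (i + 1) + 1"] by (simp add: h step_def)
    qed
  qed
qed

text \<open>The two cases differ in the strictness of the inequality because a cell contains its lower but
  not its upper edge.\<close>

lemma cell_meets_epigraph_iff:
  assumes "N > 0"
  shows "(\<exists>z\<in>cell N (i, j). f (Re z) \<le> Im z) \<longleftrightarrow> (\<exists>x\<in>strip N i. f x < (of_int j + 1/2) / N)"
    and "(\<exists>z\<in>cell N (i, j). Im z \<le> f (Re z)) \<longleftrightarrow> (\<exists>x\<in>strip N i. (of_int j - 1/2) / N \<le> f x)"
proof -
  have c: "z \<in> cell N (i, j) \<longleftrightarrow> Re z \<in> strip N i \<and> Im z \<in> strip N j" for z
    by (auto simp: cell_def strip_def diff_divide_distrib add_divide_distrib)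
  have jlt: "(of_int j - 1/2) / real N < (of_int j + 1/2) / N"
    using assms by (intro divide_strict_right_mono) auto
  show "(\<exists>z\<in>cell N (i, j). f (Re z) \<le> Im z) \<longleftrightarrow> (\<exists>x\<in>strip N i. f x < (of_int j + 1/2) / N)"
  proof
    assume "\<exists>x\<in>strip N i. f x < (of_int j + 1/2) / N"
    then obtain x where x: "x \<in> strip N i" "f x < (of_int j + 1/2) / N" by blast
    define y where "y = max (f x) ((of_int j - 1/2) / N)"
    have "y \<in> strip N j" using x(2) jlt by (auto simp: y_def strip_def)
    then show "\<exists>z\<in>cell N (i, j). f (Re z) \<le> Im z"
      using x(1) by (intro bexI[of _ "Complex x y"]) (auto simp: c y_def)
  next
    assume "\<exists>z\<in>cell N (i, j). f (Re z) \<le> Im z"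
    then obtain z where "z \<in> cell N (i, j)" "f (Re z) \<le> Im z" by blast
    then show "\<exists>x\<in>strip N i. f x < (of_int j + 1/2) / N"
      unfolding c by (intro bexI[of _ "Re z"]) (auto simp: strip_def)
  qed
  show "(\<exists>z\<in>cell N (i, j). Im z \<le> f (Re z)) \<longleftrightarrow> (\<exists>x\<in>strip N i. (of_int j - 1/2) / N \<le> f x)"
  proof
    assume "\<exists>x\<in>strip N i. (of_int j - 1/2) / N \<le> f x"
    then obtain x where x: "x \<in> strip N i" "(of_int j - 1/2) / N \<le> f x" by blast
    then show "\<exists>z\<in>cell N (i, j). Im z \<le> f (Re z)"
      using jlt by (intro bexI[of _ "Complex x ((of_int j - 1/2) / N)"]) (simp_all add: c, simp add: strip_def)
  next
    assume "\<exists>z\<in>cell N (i, j). Im z \<le> f (Re z)"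
    then obtain z where "z \<in> cell N (i, j)" "Im z \<le> f (Re z)" by blast
    then show "\<exists>x\<in>strip N i. (of_int j - 1/2) / N \<le> f x"
      unfolding c by (intro bexI[of _ "Re z"]) (auto simp: strip_def)
  qed
qed

lemma epigraph_heights:
  assumes N: "N > 0" and lip: "\<And>x y. \<bar>f x - f y\<bar> \<le> 2 * \<bar>x - y\<bar>"
  obtains h where "\<And>i j. (\<exists>z\<in>cell N (i, j). f (Re z) \<le> Im z) \<longleftrightarrow> h i < j"
    and "tracks f N h" and "slope_controlled f N h"
proof -
  define Q where "Q i j \<longleftrightarrow> (\<exists>x\<in>strip N i. f x < (of_int j + 1/2) / N)" for i j :: int
  have fx: "\<bar>real N * f x - real N * f (of_int i / N)\<bar> \<le> 1" if "x \<in> strip N i" for x i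
  proof -
    have "\<bar>f x - f (of_int i / N)\<bar> \<le> 2 * (1 / (2 * N))" 
      using order_trans[OF lip mult_left_mono[OF strip_near[OF N that]]] by simp
    then have "real N * \<bar>f x - f (of_int i / N)\<bar> \<le> 1" using N by (simp add: field_simps)
    then show ?thesis using N by (simp add: abs_mult flip: right_diff_distrib)
  qed
  have mid: "of_int i / N \<in> strip N i" for i
    using N by (simp add: strip_def divide_strict_right_mono divide_right_mono)
  obtain h where "\<And>i j. Q i j \<longleftrightarrow> h i < j" "tracks f N h" "slope_controlled f N h"
  proof (rule height_function_exists[of Q N f])
    fix i j j' :: int assume "Q i j" "j \<le> j'"
    moreover have "(of_int j + 1/2) / real N \<le> (of_int j' + 1/2) / N" if "j \<le> j'"
      using that by (intro divide_right_mono) auto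
    ultimately show "Q i j'" unfolding Q_def by force
  next
    fix i j :: int assume "Q i j"
    then obtain x where x: "x \<in> strip N i" "f x < (of_int j + 1/2) / N" unfolding Q_def by blast
    then have "real N * f x < of_int j + 1/2" using N by (simp add: field_simps)
    then show "real N * f (of_int i / N) \<le> of_int j + 2" using fx[OF x(1)] by linarith
  next
    fix i j :: int assume "\<not> Q i j"
    then have "f (of_int i / N) \<ge> (of_int j + 1/2) / N" using mid unfolding Q_def by force
    then have "real N * f (of_int i / N) \<ge> of_int j + 1/2" using N by (simp add: field_simps)
    then show "of_int j - 2 \<le> real N * f (of_int i / N)" by linarith
  next
    fix i j a b :: int
    assume c: "\<forall>x\<in>strip N i. of_int a / N \<le> f (x + 1 / N) - f x \<and> f (x + 1 / N) - f x \<le> of_int b / N"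
    have "Q (i + 1) (j + b)" if q: "Q i j"
    proof -
      obtain x where x: "x \<in> strip N i" "f x < (of_int j + 1/2) / N" using q unfolding Q_def by blast
      have "(of_int (j + b) + 1/2) / real N = (of_int j + 1/2) / N + of_int b / N" by (simp add: add_divide_distrib)
      then have "f (x + 1 / N) < (of_int (j + b) + 1/2) / N" using c x by force
      then show ?thesis unfolding Q_def using x(1) strip_shift[OF N] by blast
    qed
    moreover have "Q i (j - a)" if q: "Q (i + 1) j"
    proof -
      obtain x where x: "x \<in> strip N (i + 1)" "f x < (of_int j + 1/2) / N" using q unfolding Q_def by blast
      have x': "x - 1 / N \<in> strip N i" using strip_shift[OF N, of "x - 1 / N" i] x(1) by simp
      have "(of_int (j - a) + 1/2) / real N = (of_int j + 1/2) / N - of_int a / N"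
        by (simp add: add_divide_distrib diff_divide_distrib)
      then have "f (x - 1 / N) < (of_int (j - a) + 1/2) / N" using c x x' by force
      then show ?thesis unfolding Q_def using x' by blast
    qed
    ultimately show "(Q i j \<longrightarrow> Q (i + 1) (j + b)) \<and> (Q (i + 1) j \<longrightarrow> Q i (j - a))" by blast
  next
    fix h assume "\<And>i j. Q i j \<longleftrightarrow> h i < j" "tracks f N h" "slope_controlled f N h"
    then show thesis by (rule that)
  qed
  then show thesis using that by (simp add: Q_def cell_meets_epigraph_iff[OF N])
qed

lemma hypograph_heights:
  assumes N: "N > 0" and lip: "\<And>x y. \<bar>f x - f y\<bar> \<le> 2 * \<bar>x - y\<bar>"
  obtains h where "\<And>i j. (\<exists>z\<in>cell N (i, j). Im z \<le> f (Re z)) \<longleftrightarrow> \<not> h i < j"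
    and "tracks f N h" and "slope_controlled f N h"
proof -
  define Q where "Q i j \<longleftrightarrow> \<not> (\<exists>x\<in>strip N i. (of_int j - 1/2) / N \<le> f x)" for i j :: int
  have fx: "\<bar>real N * f x - real N * f (of_int i / N)\<bar> \<le> 1" if "x \<in> strip N i" for x i
  proof -
    have "\<bar>f x - f (of_int i / N)\<bar> \<le> 2 * (1 / (2 * N))" 
      using order_trans[OF lip mult_left_mono[OF strip_near[OF N that]]] by simp
    then have "real N * \<bar>f x - f (of_int i / N)\<bar> \<le> 1" using N by (simp add: field_simps)
    then show ?thesis using N by (simp add: abs_mult flip: right_diff_distrib)
  qed
  have mid: "of_int i / N \<in> strip N i" for i
    using N by (simp add: strip_def divide_strict_right_mono divide_right_mono)
  obtain h where "\<And>i j. Q i j \<longleftrightarrow> h i < j" "tracks f N h" "slope_controlled f N h"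
  proof (rule height_function_exists[of Q N f])
    fix i j j' :: int assume "Q i j" "j \<le> j'"
    moreover have "(of_int j - 1/2) / real N \<le> (of_int j' - 1/2) / N" if "j \<le> j'"
      using that by (intro divide_right_mono) auto
    ultimately show "Q i j'" unfolding Q_def by force
  next
    fix i j :: int assume "Q i j"
    then have "f (of_int i / N) < (of_int j - 1/2) / N" using mid unfolding Q_def by force
    then have "real N * f (of_int i / N) < of_int j - 1/2" using N by (simp add: field_simps)
    then show "real N * f (of_int i / N) \<le> of_int j + 2" by linarith
  next
    fix i j :: int assume "\<not> Q i j"
    then obtain x where x: "x \<in> strip N i" "(of_int j - 1/2) / N \<le> f x" unfolding Q_def by blast
    then have "real N * f x \<ge> of_int j - 1/2" using N by (simp add: field_simps)
    then show "of_int j - 2 \<le> real N * f (of_int i / N)" using fx[OF x(1)] by linarith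
  next
    fix i j a b :: int
    assume c: "\<forall>x\<in>strip N i. of_int a / N \<le> f (x + 1 / N) - f x \<and> f (x + 1 / N) - f x \<le> of_int b / N"
    have "\<not> Q i j" if q: "\<not> Q (i + 1) (j + b)"
    proof -
      obtain x where x: "x \<in> strip N (i + 1)" "(of_int (j + b) - 1/2) / N \<le> f x" using q unfolding Q_def by blast
      have x': "x - 1 / N \<in> strip N i" using strip_shift[OF N, of "x - 1 / N" i] x(1) by simp
      have "(of_int (j + b) - 1/2) / real N = (of_int j - 1/2) / N + of_int b / N"
        by (simp add: add_divide_distrib diff_divide_distrib)
      then have "(of_int j - 1/2) / N \<le> f (x - 1 / N)" using c x x' by force
      then show ?thesis unfolding Q_def using x' by blast
    qed
    moreover have "\<not> Q (i + 1) j" if q: "\<not> Q i (j - a)"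
    proof -
      obtain x where x: "x \<in> strip N i" "(of_int (j - a) - 1/2) / N \<le> f x" using q unfolding Q_def by blast
      have "(of_int (j - a) - 1/2) / real N = (of_int j - 1/2) / N - of_int a / N"
        by (simp add: diff_divide_distrib)
      then have "(of_int j - 1/2) / N \<le> f (x + 1 / N)" using c x by force
      then show ?thesis unfolding Q_def using x(1) strip_shift[OF N] by blast
    qed
    ultimately show "(Q i j \<longrightarrow> Q (i + 1) (j + b)) \<and> (Q (i + 1) j \<longrightarrow> Q i (j - a))" by blast
  next
    fix h assume "\<And>i j. Q i j \<longleftrightarrow> h i < j" "tracks f N h" "slope_controlled f N h"
    then show thesis by (rule that)
  qed
  moreover have "(\<exists>z\<in>cell N (i, j). Im z \<le> f (Re z)) \<longleftrightarrow> \<not> Q i j" for i j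
    by (simp add: Q_def cell_meets_epigraph_iff[OF N])
  ultimately show thesis using that by metis
qed

section \<open>Arcs that are graphs\<close>

text \<open>For a slope \<open>k\<close> that is the tangent of the angle \<open>\<phi>\<close>, the first case is \<open>sin \<phi> * cos \<phi>\<close>: the
  weight \<open>cos \<phi>\<close> for each unit of height. For a slope greater than one every column contains a step
  \<open>D > 0\<close>, which counts with \<open>cos \<phi>\<close> once and with \<open>sin \<phi>\<close> for the remaining height \<open>D - 1\<close>;
  per unit of length this amounts to
  \<open>cos \<phi> * (cos \<phi> - sin \<phi>) + (sin \<phi>)\<^sup>2 = 1 - sin \<phi> * cos \<phi>\<close>.\<close>

definition tilt :: "real \<Rightarrow> real" where
  "tilt k = (if \<bar>k\<bar> \<le> 1 then k / (1 + k\<^sup>2) else sgn k - k / (1 + k\<^sup>2))"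

text \<open>Strict, so that the graph is transversal to circles around its points.\<close>

definition shallow :: "(real \<Rightarrow> real) \<Rightarrow> bool" where
  "shallow f \<longleftrightarrow> (\<forall>x y. x \<noteq> y \<longrightarrow> \<bar>f y - f x\<bar> < \<bar>y - x\<bar>)"

lemma shallowD: "shallow f \<Longrightarrow> x \<noteq> y \<Longrightarrow> \<bar>f y - f x\<bar> < \<bar>y - x\<bar>"
  by (simp add: shallow_def)

lemma shallow_le: "shallow f \<Longrightarrow> \<bar>f y - f x\<bar> \<le> \<bar>y - x\<bar>"
  using shallowD[of f x y] by (cases "x = y") auto

definition monotone_with_sign :: "real \<Rightarrow> (real \<Rightarrow> real) \<Rightarrow> bool" where
  "monotone_with_sign \<zeta> f \<longleftrightarrow> (\<forall>x y. x \<le> y \<longrightarrow> 0 \<le> \<zeta> * (f y - f x) \<and> \<zeta> * (f y - f x) \<le> 2 * (y - x))"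

text \<open>A graph with increments controlled on the whole line, and with a continuous derivative near the base
  point. The two modes make sure that the heights of the discretized graph have no deep notches. The
  monotone mode is needed for a diagonal tangent, where the absolute value of the slope may oscillate around one.\<close>

locale chart =
  fixes f k :: "real \<Rightarrow> real" and us R :: real
  assumes R: "R > 0"
    and deriv: "\<And>u. \<bar>u - us\<bar> < R \<Longrightarrow> (f has_real_derivative k u) (at u)"
    and cont: "\<And>u. \<bar>u - us\<bar> < R \<Longrightarrow> isCont k u"
    and mode: "shallow f \<or>
      (\<exists>\<zeta>\<in>{1, -1}. monotone_with_sign \<zeta> f \<and> (\<forall>u. \<bar>u - us\<bar> < R \<longrightarrow> 0 < \<zeta> * k u))"
begin

lemma lip: "\<bar>f x - f y\<bar> \<le> 2 * \<bar>x - y\<bar>"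
proof (cases "shallow f")
  case True
  have "\<bar>f x - f y\<bar> \<le> \<bar>x - y\<bar>" by (rule shallow_le[OF True])
  then show ?thesis by (rule order_trans) simp
next
  case False
  then obtain \<zeta> where z: "\<zeta> \<in> {1, -1}" "monotone_with_sign \<zeta> f" using mode by blast
  have *: "\<bar>f y - f x\<bar> \<le> 2 * (y - x)" if "x \<le> y" for x y
  proof -
    have "0 \<le> \<zeta> * (f y - f x)" "\<zeta> * (f y - f x) \<le> 2 * (y - x)"
      using z(2) that unfolding monotone_with_sign_def by blast+
    then show ?thesis using z(1) by auto
  qed
  show ?thesis using *[of x y] *[of y x] by (cases "x \<le> y") (auto simp: abs_minus_commute)
qed

text \<open>The product of the slopes of the chord from the base point and of the graph is greater
  than minus one, so the distance from the base point increases at a positive rate along the arc.\<close>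

lemma transversality:
  assumes e: "e = 1 \<or> e = -1" and u1: "e * (u1 - us) > 0"
  obtains c0 where "c0 > 0"
    and "\<And>u. e * (u - us) \<ge> 0 \<Longrightarrow>
      ((dist (graph f u) (graph f us))\<^sup>2 - (dist (graph f u1) (graph f us))\<^sup>2) * (e * (u - u1)) \<ge> c0 * (u - u1)\<^sup>2"
proof -
  have expand: "((dist (graph f u) (graph f us))\<^sup>2 - (dist (graph f u1) (graph f us))\<^sup>2) * (e * (u - u1))
     = (e * (u - us) + e * (u1 - us)) * (u - u1)\<^sup>2 + e * (u - u1) * (f u - f u1) * ((f u - f us) + (f u1 - f us))" for u
  proof -
    have "((U\<^sup>2 + F\<^sup>2) - (V\<^sup>2 + G\<^sup>2)) * (e * (U - V)) = (e * U + e * V) * (U - V)\<^sup>2 + e * (U - V) * (F - G) * (F + G)"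
      for U V F G :: real by (simp add: power2_eq_square algebra_simps)
    moreover have "(dist (graph f v) (graph f us))\<^sup>2 = (v - us)\<^sup>2 + (f v - f us)\<^sup>2" for v
      by (simp add: graph_def dist_norm cmod_power2)
    moreover have "u - u1 = (u - us) - (u1 - us)" "f u - f u1 = (f u - f us) - (f u1 - f us)" by simp_all
    ultimately show ?thesis by (simp only:)
  qed
  \<comment> \<open>In the shallow case the second summand is dominated by the first one; in the monotone case it is
    nonnegative.\<close>
  show thesis
  proof (cases "shallow f")
    case True
    define c0 where "c0 = e * (u1 - us) - \<bar>f u1 - f us\<bar>"
    note S = shallow_le[OF True]
    have e1: "\<bar>e\<bar> = 1" using e by auto
    have "\<bar>f u1 - f us\<bar> < \<bar>u1 - us\<bar>" by (rule shallowD[OF True]) (use u1 in auto)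
    moreover have "\<bar>u1 - us\<bar> = e * (u1 - us)" using u1 e by auto
    ultimately have "c0 > 0" by (simp add: c0_def)
    moreover have "((dist (graph f u) (graph f us))\<^sup>2 - (dist (graph f u1) (graph f us))\<^sup>2) * (e * (u - u1)) \<ge> c0 * (u - u1)\<^sup>2"
      if u: "e * (u - us) \<ge> 0" for u
    proof -
      have "\<bar>e * (u - u1) * (f u - f u1) * ((f u - f us) + (f u1 - f us))\<bar>
        = \<bar>u - u1\<bar> * \<bar>f u - f u1\<bar> * \<bar>(f u - f us) + (f u1 - f us)\<bar>" by (simp add: abs_mult e1)
      also have "\<dots> \<le> \<bar>u - u1\<bar> * \<bar>u - u1\<bar> * (\<bar>f u - f us\<bar> + \<bar>f u1 - f us\<bar>)"
        by (intro mult_mono S) auto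
      also have "\<dots> \<le> \<bar>u - u1\<bar> * \<bar>u - u1\<bar> * (\<bar>u - us\<bar> + \<bar>f u1 - f us\<bar>)"
        by (intro mult_left_mono add_right_mono S) auto
      also have "\<bar>u - us\<bar> = e * (u - us)" using u e by auto
      also have "\<bar>u - u1\<bar> * \<bar>u - u1\<bar> = (u - u1)\<^sup>2" by (simp add: power2_eq_square)
      finally have "e * (u - u1) * (f u - f u1) * ((f u - f us) + (f u1 - f us))
        \<ge> - ((u - u1)\<^sup>2 * (e * (u - us) + \<bar>f u1 - f us\<bar>))" by linarith
      then show ?thesis unfolding expand c0_def by (simp add: algebra_simps)
    qed
    ultimately show thesis using that by blast
  next
    case False
    then obtain \<zeta> where z: "\<zeta> \<in> {1, -1}" "monotone_with_sign \<zeta> f" using mode by blast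
    have mono: "0 \<le> (y - x) * (\<zeta> * (f y - f x))" for x y
    proof (cases "x \<le> y")
      case True
      then show ?thesis using z(2) unfolding monotone_with_sign_def by simp
    next
      case False
      then have "0 \<le> \<zeta> * (f x - f y)" "0 \<le> x - y" using z(2) unfolding monotone_with_sign_def by auto
      then have "0 \<le> (x - y) * (\<zeta> * (f x - f y))" by simp
      then show ?thesis by (simp add: algebra_simps)
    qed
    have zz: "\<zeta> * \<zeta> = 1" "e * e = 1" using z(1) e by auto
    have side: "0 \<le> e * (\<zeta> * (f u - f us))" if u: "e * (u - us) \<ge> 0" for u
    proof -
      have m: "0 \<le> \<zeta> * (f y - f x)" if "x \<le> y" for x y using z(2) that unfolding monotone_with_sign_def by blast
      show ?thesis using e u m[of us u] m[of u us] by (auto simp: algebra_simps)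
    qed
    have "((dist (graph f u) (graph f us))\<^sup>2 - (dist (graph f u1) (graph f us))\<^sup>2) * (e * (u - u1)) \<ge> e * (u1 - us) * (u - u1)\<^sup>2"
      if u: "e * (u - us) \<ge> 0" for u
    proof -
      have "0 \<le> ((u - u1) * (\<zeta> * (f u - f u1))) * (e * (\<zeta> * (f u - f us)) + e * (\<zeta> * (f u1 - f us)))"
        by (rule mult_nonneg_nonneg[OF mono add_nonneg_nonneg[OF side[OF u] side]]) (use u1 in simp)
      also have "\<dots> = (\<zeta> * \<zeta>) * (e * (u - u1) * (f u - f u1) * ((f u - f us) + (f u1 - f us)))"
        by (simp add: algebra_simps)
      finally have "0 \<le> e * (u - u1) * (f u - f u1) * ((f u - f us) + (f u1 - f us))" by (simp only: zz mult_1)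
      moreover have "e * (u - us) * (u - u1)\<^sup>2 \<ge> 0" using u by simp
      ultimately show ?thesis unfolding expand distrib_right by linarith
    qed
    then show thesis using that u1 by blast
  qed
qed

lemma increment_lower_bound:
  assumes slope: "\<And>v. \<bar>v - u1\<bar> < d \<Longrightarrow> (f has_real_derivative k v) (at v) \<and> a \<le> \<zeta> * k v"
    and xy: "x \<le> y" "\<bar>x - u1\<bar> < d" "\<bar>y - u1\<bar> < d"
  shows "a * (y - x) \<le> \<zeta> * (f y - f x)"
proof (cases "x = y")
  case False
  then have "x < y" using xy(1) by simp
  moreover have "\<bar>v - u1\<bar> < d" if "x \<le> v" "v \<le> y" for v using xy(2,3) that by linarith
  ultimately obtain v where v: "x < v" "v < y" "f y - f x = (y - x) * k v"
    using MVT2[of x y f k] slope by auto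
  have "\<bar>v - u1\<bar> < d" using xy v by linarith
  then have "a * (y - x) \<le> (\<zeta> * k v) * (y - x)" using slope \<open>x < y\<close> by (intro mult_right_mono) auto
  then show ?thesis by (simp add: v(3) ac_simps)
qed simp

lemma steps_of_increments:
  fixes a b :: int
  assumes d: "d > 0"
    and inc: "\<And>x y. x \<le> y \<Longrightarrow> \<bar>x - u1\<bar> < d \<Longrightarrow> \<bar>y - u1\<bar> < d \<Longrightarrow>
      of_int a * (y - x) \<le> f y - f x \<and> f y - f x \<le> of_int b * (y - x)"
  shows "\<forall>\<^sub>F N in sequentially. \<forall>h. slope_controlled f N h \<longrightarrow>
     (\<forall>i. \<bar>of_int i / N - u1\<bar> < d / 2 \<longrightarrow> a \<le> step h i \<and> step h i \<le> b)"
proof -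
  have "(\<lambda>N. 2 / real N) \<longlonglongrightarrow> 0" by (rule lim_const_over_n)
  then have "\<forall>\<^sub>F N in sequentially. 2 / real N < d / 2" using d by (intro order_tendstoD(2)) auto
  then show ?thesis using eventually_gt_at_top[of 0]
  proof eventually_elim
    case (elim N)
    show ?case
    proof (intro allI impI)
      fix h i assume h: "slope_controlled f N h" and i: "\<bar>of_int i / N - u1\<bar> < d / 2"
      have "of_int a / N \<le> f (x + 1 / N) - f x \<and> f (x + 1 / N) - f x \<le> of_int b / N" if x: "x \<in> strip N i" for x
      proof -
        have n: "0 < 1 / real N" "2 * (1 / real N) < d / 2" using elim by auto
        have "\<bar>x - of_int i / N\<bar> \<le> 1 / N / 2" using strip_near[OF elim(2) x] by simp
        moreover have "\<bar>x - u1\<bar> < d \<and> \<bar>x + m - u1\<bar> < d"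
          if "\<bar>x - v\<bar> \<le> m / 2" "\<bar>v - u1\<bar> < d / 2" "0 < m" "2 * m < d / 2" for v m using that by linarith
        ultimately have "\<bar>x - u1\<bar> < d" "\<bar>x + 1 / N - u1\<bar> < d" using i n by blast+
        then show ?thesis using inc[of x "x + 1 / N"] n by simp
      qed
      then show "a \<le> step h i \<and> step h i \<le> b" using h unfolding slope_controlled_def by blast
    qed
  qed
qed

text \<open>If the slope at the end is less than one in absolute value, the steps are -1, 0 and 1, and a
  step equals its sign. If it is greater, every column has a step of a fixed sign. If it is equal to one
  in absolute value, the cosine and the sine of the angle agree up to sign, so that \<open>1\<close> and \<open>D - 1\<close>
  have projections that add up to \<open>D\<close> times the cosine.\<close>

lemma step_pattern:
  assumes u1: "\<bar>u1 - us\<bar> < R"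
  defines "c \<equiv> 1 / sqrt (1 + (k u1)\<^sup>2)"
  obtains \<rho> \<alpha> \<beta> where "\<rho> > 0" "c * (\<alpha> + \<beta> * k u1) = tilt (k u1)"
    "\<forall>\<^sub>F N in sequentially. \<forall>h. slope_controlled f N h \<longrightarrow> (\<forall>i. \<bar>of_int i / N - u1\<bar> < \<rho> \<longrightarrow>
        c * of_int (sgn (step h i)) + k u1 * c * (of_int \<bar>step h i\<bar> - of_int \<bar>sgn (step h i)\<bar>)
        = \<alpha> + \<beta> * of_int (step h i))"
proof -
  note conclude = that
  have p: "1 + (k u1)\<^sup>2 > 0" by (simp add: add_pos_nonneg)
  have cc: "c * c = 1 / (1 + (k u1)\<^sup>2)" using p by (simp add: c_def)
  define d0 where "d0 = R - \<bar>u1 - us\<bar>"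
  have d0: "d0 > 0" "\<And>v. \<bar>v - u1\<bar> < d0 \<Longrightarrow> \<bar>v - us\<bar> < R" using u1 by (auto simp: d0_def)
  have kcont: "\<exists>d>0. d \<le> d0 \<and> (\<forall>v. \<bar>v - u1\<bar> < d \<longrightarrow> P (k v))" if "open {x. P x}" "P (k u1)" for P
  proof -
    have "\<forall>\<^sub>F v in nhds u1. k v \<in> {x. P x}"
      using cont[OF u1] that topological_tendstoD[of k "k u1" "nhds u1" "{x. P x}"]
      by (auto simp: isCont_def tendsto_at_iff_tendsto_nhds)
    then obtain d where d: "d > 0" "\<And>v. \<bar>v - u1\<bar> < d \<Longrightarrow> P (k v)"
      unfolding eventually_nhds_metric by (auto simp: dist_real_def)
    then show ?thesis using d0 by (intro exI[of _ "min d d0"]) auto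
  qed
  have small: thesis if d: "d > 0" and inc: "\<And>x y. x \<le> y \<Longrightarrow> \<bar>x - u1\<bar> < d \<Longrightarrow> \<bar>y - u1\<bar> < d \<Longrightarrow> \<bar>f y - f x\<bar> \<le> y - x"
    and k1: "\<bar>k u1\<bar> \<le> 1" for d
  proof (rule conclude[of "d / 2" 0 c])
    show "d / 2 > 0" using d by simp
    show "c * (0 + c * k u1) = tilt (k u1)" using cc k1 by (simp add: tilt_def mult.assoc[symmetric])
    have "\<forall>\<^sub>F N in sequentially. \<forall>h. slope_controlled f N h \<longrightarrow>
     (\<forall>i. \<bar>of_int i / N - u1\<bar> < d / 2 \<longrightarrow> - 1 \<le> step h i \<and> step h i \<le> 1)"
      using steps_of_increments[OF d, of u1 "-1" 1] inc by (force simp: abs_le_iff)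
    then show "\<forall>\<^sub>F N in sequentially. \<forall>h. slope_controlled f N h \<longrightarrow> (\<forall>i. \<bar>of_int i / N - u1\<bar> < d / 2 \<longrightarrow>
        c * of_int (sgn (step h i)) + k u1 * c * (of_int \<bar>step h i\<bar> - of_int \<bar>sgn (step h i)\<bar>)
        = 0 + c * of_int (step h i))"
    proof eventually_elim
      case (elim N)
      have "sgn m = m \<and> \<bar>m\<bar> = \<bar>sgn m\<bar>" if "- 1 \<le> m \<and> m \<le> 1" for m :: int using that by (auto simp: sgn_if)
      then show ?case using elim by auto
    qed
  qed
  show thesis
  proof (cases "shallow f")
    case True
    have "\<bar>f y - f x\<bar> \<le> y - x" if "x \<le> y" for x y
      using shallow_le[OF True, of y x] that by simp
    moreover have "\<bar>k u1\<bar> \<le> 1"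
      proof (rule ccontr)
        assume k1: "\<not> \<bar>k u1\<bar> \<le> 1"
        have op: "open {x::real. 1 < \<bar>x\<bar>}" by (intro open_Collect_less continuous_intros)
        obtain d where d: "d > 0" "d \<le> d0" "\<And>v. \<bar>v - u1\<bar> < d \<Longrightarrow> 1 < \<bar>k v\<bar>" using kcont[OF op] k1 by auto
        obtain v where v: "u1 < v" "v < u1 + d / 2" "f (u1 + d / 2) - f u1 = (u1 + d / 2 - u1) * k v"
        proof -
          have "\<And>x. u1 \<le> x \<Longrightarrow> x \<le> u1 + d / 2 \<Longrightarrow> (f has_real_derivative k x) (at x)"
            using d(1,2) by (intro deriv d0(2)) auto
          then show thesis using MVT2[of u1 "u1 + d / 2" f k] d(1) that by auto
        qed
        have "\<bar>f (u1 + d / 2) - f u1\<bar> = d / 2 * \<bar>k v\<bar>" unfolding v(3) using d(1) by (simp add: abs_mult)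
        moreover have "\<bar>f (u1 + d / 2) - f u1\<bar> < d / 2" using shallowD[OF True, of u1 "u1 + d / 2"] d(1) by simp
        moreover have "d / 2 * 1 < d / 2 * \<bar>k v\<bar>" using d(1) d(3)[of v] v by (intro mult_strict_left_mono) auto
        ultimately show False by linarith
    qed
    ultimately show thesis using small[of 1] by auto
  next
    case False
    then obtain \<zeta> where z: "\<zeta> = 1 \<or> \<zeta> = -1" "monotone_with_sign \<zeta> f" "\<And>u. \<bar>u - us\<bar> < R \<Longrightarrow> 0 < \<zeta> * k u"
      using mode by blast
    have zz: "\<zeta> * \<zeta> = 1" using z(1) by auto
    have kpos: "\<zeta> * k u1 > 0" by (rule z(3)[OF u1])
    have absk: "\<bar>k u1\<bar> = \<zeta> * k u1" using z(1) kpos by auto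
    define zi :: int where "zi = (if \<zeta> = 1 then 1 else - 1)"
    have zi: "of_int zi = \<zeta>" using z(1) by (auto simp: zi_def)
    consider "\<zeta> * k u1 < 1" | "\<zeta> * k u1 = 1" | "\<zeta> * k u1 > 1" by linarith
    then show thesis
    proof cases
      case 1
      have "open {x. \<zeta> * x < 1}" by (intro open_Collect_less continuous_intros)
      then obtain d where d: "d > 0" "d \<le> d0" "\<And>v. \<bar>v - u1\<bar> < d \<Longrightarrow> \<zeta> * k v < 1"
        using kcont[of "\<lambda>x. \<zeta> * x < 1"] 1 by auto
      have h: "(f has_real_derivative k v) (at v) \<and> 0 \<le> \<zeta> * k v \<and> \<zeta> * k v \<le> 1" if "\<bar>v - u1\<bar> < d" for v
        using deriv[OF d0(2)] z(3)[OF d0(2)] d(2) d(3)[OF that] that by (auto intro: less_imp_le)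
      have "\<bar>f y - f x\<bar> \<le> y - x" if "x \<le> y" "\<bar>x - u1\<bar> < d" "\<bar>y - u1\<bar> < d" for x y
        using increment_lower_bound[of u1 d 0 \<zeta>, OF _ that] increment_lower_bound[of u1 d "-1" "- \<zeta>", OF _ that] h z(1) by auto
      then show thesis using small[OF d(1)] 1 absk by auto
    next
      \<comment> \<open>The steps 0, 1 and 2 may all occur near the end, in unknown proportions. Since the tangent is
        diagonal, only the sign of the steps matters for the identity.\<close>
      case 2
      have "\<forall>\<^sub>F N in sequentially. \<forall>h. slope_controlled f N h \<longrightarrow>
          (\<forall>i. \<bar>of_int i / N - u1\<bar> < 1 / 2 \<longrightarrow> 0 \<le> zi * step h i)"
      proof (cases "\<zeta> = 1")
        case True
        have "\<forall>\<^sub>F N in sequentially. \<forall>h. slope_controlled f N h \<longrightarrow>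
          (\<forall>i. \<bar>of_int i / N - u1\<bar> < 1 / 2 \<longrightarrow> 0 \<le> step h i \<and> step h i \<le> 2)"
          by (rule steps_of_increments) (use z(2) True in \<open>auto simp: monotone_with_sign_def\<close>)
        then show ?thesis by eventually_elim (auto simp: zi_def True)
      next
        case False
        then have "\<zeta> = -1" using z(1) by simp
        have "\<forall>\<^sub>F N in sequentially. \<forall>h. slope_controlled f N h \<longrightarrow>
          (\<forall>i. \<bar>of_int i / N - u1\<bar> < 1 / 2 \<longrightarrow> - 2 \<le> step h i \<and> step h i \<le> 0)"
          by (rule steps_of_increments) (use z(2) \<open>\<zeta> = -1\<close> in \<open>force simp: monotone_with_sign_def\<close>)+
        then show ?thesis by eventually_elim (auto simp: zi_def False)
      qed
      then have ev: "\<forall>\<^sub>F N in sequentially. \<forall>h. slope_controlled f N h \<longrightarrow> (\<forall>i. \<bar>of_int i / N - u1\<bar> < 1 / 2 \<longrightarrow>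
        c * of_int (sgn (step h i)) + k u1 * c * (of_int \<bar>step h i\<bar> - of_int \<bar>sgn (step h i)\<bar>)
        = 0 + c * of_int (step h i))"
      proof eventually_elim
        case (elim N)
        have k: "k u1 = \<zeta>" using 2 z(1) by auto
        have "c * of_int (sgn m) + k u1 * c * (of_int \<bar>m\<bar> - of_int \<bar>sgn m\<bar>) = 0 + c * of_int m"
          if "0 \<le> zi * m" for m :: int
          using that z(1) unfolding k by (auto simp: zi_def sgn_if algebra_simps)
        then show ?case using elim by blast
      qed
      have "c * (0 + c * k u1) = tilt (k u1)" using cc absk 2 by (simp add: tilt_def mult.assoc[symmetric])
      then show thesis using that[of "1/2" 0 c] ev by simp
    next
      case 3
      have "open {x. \<zeta> * x > 1}" by (intro open_Collect_less continuous_intros)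
      then obtain d where d: "d > 0" "d \<le> d0" "\<And>v. \<bar>v - u1\<bar> < d \<Longrightarrow> \<zeta> * k v > 1"
        using kcont[of "\<lambda>x. \<zeta> * x > 1"] 3 by auto
      have h: "(f has_real_derivative k v) (at v) \<and> 1 \<le> \<zeta> * k v" if "\<bar>v - u1\<bar> < d" for v
        using deriv[OF d0(2)] d(2) d(3)[OF that] that by (auto intro: less_imp_le)
      have inc: "1 * (y - x) \<le> \<zeta> * (f y - f x)" if "x \<le> y" "\<bar>x - u1\<bar> < d" "\<bar>y - u1\<bar> < d" for x y
        by (rule increment_lower_bound[OF h that])
      have "\<forall>\<^sub>F N in sequentially. \<forall>h. slope_controlled f N h \<longrightarrow>
          (\<forall>i. \<bar>of_int i / N - u1\<bar> < d / 2 \<longrightarrow> 1 \<le> zi * step h i)"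
      proof (cases "\<zeta> = 1")
        case True
        have "\<forall>\<^sub>F N in sequentially. \<forall>h. slope_controlled f N h \<longrightarrow>
          (\<forall>i. \<bar>of_int i / N - u1\<bar> < d / 2 \<longrightarrow> 1 \<le> step h i \<and> step h i \<le> 2)"
          by (rule steps_of_increments[OF d(1)]) (use z(2) inc True in \<open>auto simp: monotone_with_sign_def\<close>)
        then show ?thesis by eventually_elim (auto simp: zi_def True)
      next
        case False
        then have m1: "\<zeta> = -1" using z(1) by simp
        have "\<forall>\<^sub>F N in sequentially. \<forall>h. slope_controlled f N h \<longrightarrow>
          (\<forall>i. \<bar>of_int i / N - u1\<bar> < d / 2 \<longrightarrow> - 2 \<le> step h i \<and> step h i \<le> - 1)"
        proof (rule steps_of_increments[OF d(1)])
          fix x y assume xy: "x \<le> y" "\<bar>x - u1\<bar> < d" "\<bar>y - u1\<bar> < d"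
          have "\<zeta> * (f y - f x) \<le> 2 * (y - x)" using z(2) xy(1) unfolding monotone_with_sign_def by blast
          then show "of_int (-2) * (y - x) \<le> f y - f x \<and> f y - f x \<le> of_int (-1) * (y - x)"
            using inc[OF xy] m1 by (simp add: algebra_simps)
        qed
        then show ?thesis by eventually_elim (force simp: zi_def False)
      qed
      then have ev: "\<forall>\<^sub>F N in sequentially. \<forall>h. slope_controlled f N h \<longrightarrow> (\<forall>i. \<bar>of_int i / N - u1\<bar> < d / 2 \<longrightarrow>
        c * of_int (sgn (step h i)) + k u1 * c * (of_int \<bar>step h i\<bar> - of_int \<bar>sgn (step h i)\<bar>)
        = (c * \<zeta> - k u1 * c) + \<zeta> * (k u1 * c) * of_int (step h i))"
      proof eventually_elim
        case (elim N)
        have "c * of_int (sgn m) + k u1 * c * (of_int \<bar>m\<bar> - of_int \<bar>sgn m\<bar>) = (c * \<zeta> - k u1 * c) + \<zeta> * (k u1 * c) * of_int m"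
          if "1 \<le> zi * m" for m :: int
          using that z(1) by (auto simp: zi_def sgn_if algebra_simps)
        then show ?case using elim by blast
      qed
      have "sgn (k u1) = \<zeta>" using z(1) kpos by auto
      have "c * ((c * \<zeta> - k u1 * c) + \<zeta> * (k u1 * c) * k u1) = (c * c) * (\<zeta> * (1 + (k u1)\<^sup>2) - k u1)"
        by (simp add: algebra_simps power2_eq_square)
      also have "\<dots> = tilt (k u1)"
        using 3 absk p \<open>sgn (k u1) = \<zeta>\<close> by (simp add: tilt_def cc diff_divide_distrib)
      finally show thesis using that[of "d / 2" "c * \<zeta> - k u1 * c" "\<zeta> * (k u1 * c)"] ev d(1) by simp
    qed
  qed
qed

end

lemma window_weight_swap: "window_weight N s r x0 x1 \<delta> = window_weight N s r x1 x0 \<delta>"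
  by (simp add: fun_eq_iff window_weight_def ac_simps)

lemma window_weight_far:
  assumes "\<delta> > 0" "infdist x0 (cell N x) \<ge> \<delta>"
  shows "window_weight N s r x0 x1 \<delta> x = 1 - half_weight N s r x1 \<delta> x / \<delta>"
  using assms by (simp add: window_weight_def half_weight_def)

context chart
begin

lemma far_from_graph:
  assumes N: "N > 0" and h: "tracks f N h" and nz: "step h i \<noteq> 0" and far: "\<delta> + 8 / N \<le> \<bar>of_int i / N - v\<bar>"
  shows "infdist (graph f v) (cell N (left_site h i)) \<ge> \<delta>" "infdist (graph f v) (cell N (right_site h i)) \<ge> \<delta>"
proof -
  have *: "infdist (graph f v) (cell N x) \<ge> \<delta>"
    if "\<And>a. a \<in> cell N x \<Longrightarrow> dist a (graph f (of_int i / N)) \<le> 8 / N" for x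
  proof -
    have "\<delta> \<le> dist (graph f v) a" if "a \<in> cell N x" for a
      using \<open>\<And>a. a \<in> cell N x \<Longrightarrow> dist a (graph f (of_int i / N)) \<le> 8 / N\<close>[OF that] far
        abs_le_dist_graph[of "of_int i / N" v f] dist_triangle[of "graph f (of_int i / N)" "graph f v" a]
      by (simp add: dist_commute)
    moreover have "cell N x \<noteq> {}" using centre_in_cell[OF N, of x] by blast
    ultimately show ?thesis by (simp add: infdist_notempty cINF_greatest)
  qed
  show "infdist (graph f v) (cell N (left_site h i)) \<ge> \<delta>" "infdist (graph f v) (cell N (right_site h i)) \<ge> \<delta>"
    by (rule *, erule step_geometry(3)[OF N lip h nz], rule *, erule step_geometry(4)[OF N lip h nz])
qed

text \<open>The point over \<open>v\<close> is the other end of the arc, on the other side of \<open>us\<close>; it is too far away to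
  influence the weights on this half.\<close>

lemma half_arc_sum:
  assumes e: "e = 1 \<or> e = -1" and u1: "e * (u1 - us) > 0" "\<bar>u1 - us\<bar> < R" and v: "e * (v - us) < 0"
    and r: "r > 0" "dist (graph f u1) (graph f us) = r" and \<epsilon>: "\<epsilon> > 0"
  obtains \<delta>0 where "\<delta>0 > 0" and "\<And>\<delta>. 0 < \<delta> \<Longrightarrow> \<delta> < \<delta>0 \<Longrightarrow> \<forall>\<^sub>F N in sequentially. \<forall>h J.
      tracks f N h \<longrightarrow> slope_controlled f N h \<longrightarrow> finite J \<longrightarrow> (\<forall>i\<in>J. e * (of_int i / N - us) \<ge> 0) \<longrightarrow>
      (\<forall>i. e * (of_int i / N - us) > 0 \<longrightarrow> \<bar>of_int i / N - u1\<bar> \<le> 2 * \<delta> \<longrightarrow> i \<in> J) \<longrightarrow>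
      \<bar>step_sum h (window_weight N (graph f us) r (graph f v) (graph f u1) \<delta>) J + e * tilt (k u1)\<bar> \<le> \<epsilon>"
proof -
  obtain c0 where c0: "c0 > 0"
    "\<And>u. e * (u - us) \<ge> 0 \<Longrightarrow>
      ((dist (graph f u) (graph f us))\<^sup>2 - (dist (graph f u1) (graph f us))\<^sup>2) * (e * (u - u1)) \<ge> c0 * (u - u1)\<^sup>2"
    using transversality[OF e u1(1)] by blast
  interpret arc_end f us r u1 "k u1" e c0
    using e lip r c0 u1 deriv by unfold_locales auto
  obtain \<rho> \<alpha> \<beta> where pat: "\<rho> > 0" "c * (\<alpha> + \<beta> * k u1) = tilt (k u1)"
    "\<forall>\<^sub>F N in sequentially. \<forall>h. slope_controlled f N h \<longrightarrow> (\<forall>i. \<bar>of_int i / N - u1\<bar> < \<rho> \<longrightarrow>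
        c * of_int (sgn (step h i)) + k u1 * c * (of_int \<bar>step h i\<bar> - of_int \<bar>sgn (step h i)\<bar>)
        = \<alpha> + \<beta> * of_int (step h i))"
    using step_pattern[OF u1(2), folded c_def] by blast
  obtain \<delta>1 where \<delta>1: "\<delta>1 > 0" "\<And>\<delta>. 0 < \<delta> \<Longrightarrow> \<delta> < \<delta>1 \<Longrightarrow> \<forall>\<^sub>F N in sequentially. \<forall>h J.
      tracks f N h \<longrightarrow>
      (\<forall>i. \<bar>of_int i / N - u1\<bar> < \<rho> \<longrightarrow>
        c * of_int (sgn (step h i)) + k u1 * c * (of_int \<bar>step h i\<bar> - of_int \<bar>sgn (step h i)\<bar>)
        = \<alpha> + \<beta> * of_int (step h i)) \<longrightarrow>
      finite J \<longrightarrow> (\<forall>i\<in>J. e * (of_int i / N - us) \<ge> 0) \<longrightarrow>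
      (\<forall>i. e * (of_int i / N - us) > 0 \<longrightarrow> \<bar>of_int i / N - u1\<bar> \<le> 2 * \<delta> \<longrightarrow> i \<in> J) \<longrightarrow>
      \<bar>(\<Sum>i\<in>J. jump N h \<delta> i) - e * \<delta> * (c * (\<alpha> + \<beta> * k u1))\<bar> \<le> \<epsilon> * \<delta>"
    using end_sum[OF \<epsilon> pat(1), of \<alpha> \<beta>] by blast
  define \<delta>0 where "\<delta>0 = min \<delta>1 (\<bar>v - us\<bar> / 2)"
  show thesis
  proof (rule that[of \<delta>0])
    show "\<delta>0 > 0" using \<delta>1(1) v by (auto simp: \<delta>0_def)
    fix \<delta> assume \<delta>: "0 < \<delta>" "\<delta> < \<delta>0"
    then have \<delta>': "\<delta> < \<delta>1" "\<delta> < \<bar>v - us\<bar> / 2" by (auto simp: \<delta>0_def)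
    have "(\<lambda>N. 8 / real N) \<longlonglongrightarrow> 0" by (rule lim_const_over_n)
    then have "\<forall>\<^sub>F N in sequentially. 8 / real N < \<bar>v - us\<bar> / 2" using v by (intro order_tendstoD(2)) auto
    with \<delta>1(2)[OF \<delta>(1) \<delta>'(1)] pat(3) eventually_gt_at_top[of 0]
    show "\<forall>\<^sub>F N in sequentially. \<forall>h J.
      tracks f N h \<longrightarrow> slope_controlled f N h \<longrightarrow> finite J \<longrightarrow> (\<forall>i\<in>J. e * (of_int i / N - us) \<ge> 0) \<longrightarrow>
      (\<forall>i. e * (of_int i / N - us) > 0 \<longrightarrow> \<bar>of_int i / N - u1\<bar> \<le> 2 * \<delta> \<longrightarrow> i \<in> J) \<longrightarrow>
      \<bar>step_sum h (window_weight N (graph f us) r (graph f v) (graph f u1) \<delta>) J + e * tilt (k u1)\<bar> \<le> \<epsilon>"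
    proof eventually_elim
      case (elim N)
      show ?case
      proof (intro allI impI)
        fix h J
        assume h: "tracks f N h" "slope_controlled f N h" and J: "finite J" "\<forall>i\<in>J. e * (of_int i / N - us) \<ge> 0"
          "\<forall>i. e * (of_int i / N - us) > 0 \<longrightarrow> \<bar>of_int i / N - u1\<bar> \<le> 2 * \<delta> \<longrightarrow> i \<in> J"
        let ?W = "window_weight N (graph f us) r (graph f v) (graph f u1) \<delta>"
        have main: "\<bar>(\<Sum>i\<in>J. jump N h \<delta> i) - e * \<delta> * tilt (k u1)\<bar> \<le> \<epsilon> * \<delta>"
          unfolding pat(2)[symmetric] using elim(1,2) h J by blast
        have "of_int (sgn (step h i)) * (?W (right_site h i) - ?W (left_site h i)) = - (jump N h \<delta> i / \<delta>)" if i: "i \<in> J" for i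
        proof (cases "step h i = 0")
          case nz: False
          have "\<bar>v - us\<bar> \<le> \<bar>of_int i / N - v\<bar>" using e v bspec[OF J(2) i] by auto
          moreover have "p + q \<le> z" if "a \<le> z" "p < a / 2" "q < a / 2" for a p q z :: real using that by linarith
          ultimately have far: "\<delta> + 8 / N \<le> \<bar>of_int i / N - v\<bar>" using \<delta>'(2) elim(4) by blast
          note f = far_from_graph[OF elim(3) h(1) nz far]
          show ?thesis unfolding window_weight_far[OF \<delta>(1) f(1)] window_weight_far[OF \<delta>(1) f(2)]
            by (simp add: algebra_simps diff_divide_distrib)
        qed simp
        then have "step_sum h ?W J = (\<Sum>i\<in>J. - (jump N h \<delta> i / \<delta>))"
          unfolding step_sum_def by (intro sum.cong refl) blast
        also have "\<dots> = - ((\<Sum>i\<in>J. jump N h \<delta> i) / \<delta>)" by (simp only: sum_negf sum_divide_distrib)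
        finally have "step_sum h ?W J + e * tilt (k u1)
           = - (((\<Sum>i\<in>J. jump N h \<delta> i) - e * \<delta> * tilt (k u1)) / \<delta>)" using \<delta>(1) by (simp add: diff_divide_distrib)
        moreover have "\<bar>(\<Sum>i\<in>J. jump N h \<delta> i) - e * \<delta> * tilt (k u1)\<bar> / \<delta> \<le> \<epsilon>"
          using main \<delta>(1) by (simp add: pos_divide_le_eq)
        ultimately show "\<bar>step_sum h ?W J + e * tilt (k u1)\<bar> \<le> \<epsilon>"
          using \<delta>(1) by (simp only: abs_minus abs_divide abs_of_pos)
      qed
    qed
  qed
qed

lemma arc_sum:
  assumes u: "uL < us" "us < uR" "\<bar>uL - us\<bar> < R" "\<bar>uR - us\<bar> < R"
    and r: "r > 0" "dist (graph f uL) (graph f us) = r" "dist (graph f uR) (graph f us) = r" and \<epsilon>: "\<epsilon> > 0"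
  obtains \<delta>0 where "\<delta>0 > 0" and "\<And>\<delta>. 0 < \<delta> \<Longrightarrow> \<delta> < \<delta>0 \<Longrightarrow> \<forall>\<^sub>F N in sequentially. \<forall>h B.
      tracks f N h \<longrightarrow> slope_controlled f N h \<longrightarrow> real N * (\<bar>us\<bar> + 2 * r + 1) \<le> of_int B \<longrightarrow>
      \<bar>step_sum h (window_weight N (graph f us) r (graph f uL) (graph f uR) \<delta>) {-B..B}
        + (tilt (k uR) - tilt (k uL))\<bar> \<le> \<epsilon>"
proof -
  obtain d1 where d1: "d1 > 0" "\<And>\<delta>. 0 < \<delta> \<Longrightarrow> \<delta> < d1 \<Longrightarrow> \<forall>\<^sub>F N in sequentially. \<forall>h J.
      tracks f N h \<longrightarrow> slope_controlled f N h \<longrightarrow> finite J \<longrightarrow> (\<forall>i\<in>J. 1 * (of_int i / N - us) \<ge> 0) \<longrightarrow>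
      (\<forall>i. 1 * (of_int i / N - us) > 0 \<longrightarrow> \<bar>of_int i / N - uR\<bar> \<le> 2 * \<delta> \<longrightarrow> i \<in> J) \<longrightarrow>
      \<bar>step_sum h (window_weight N (graph f us) r (graph f uL) (graph f uR) \<delta>) J + 1 * tilt (k uR)\<bar> \<le> \<epsilon> / 2"
    using half_arc_sum[of 1 uR uL r "\<epsilon> / 2"] u r \<epsilon> by auto
  obtain d2 where d2: "d2 > 0" "\<And>\<delta>. 0 < \<delta> \<Longrightarrow> \<delta> < d2 \<Longrightarrow> \<forall>\<^sub>F N in sequentially. \<forall>h J.
      tracks f N h \<longrightarrow> slope_controlled f N h \<longrightarrow> finite J \<longrightarrow> (\<forall>i\<in>J. - 1 * (of_int i / N - us) \<ge> 0) \<longrightarrow>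
      (\<forall>i. - 1 * (of_int i / N - us) > 0 \<longrightarrow> \<bar>of_int i / N - uL\<bar> \<le> 2 * \<delta> \<longrightarrow> i \<in> J) \<longrightarrow>
      \<bar>step_sum h (window_weight N (graph f us) r (graph f uR) (graph f uL) \<delta>) J + - 1 * tilt (k uL)\<bar> \<le> \<epsilon> / 2"
    using half_arc_sum[of "-1" uL uR r "\<epsilon> / 2"] u r \<epsilon> by auto
  have uLR: "\<bar>uL - us\<bar> \<le> r" "\<bar>uR - us\<bar> \<le> r" using abs_le_dist_graph[of _ us f] r by metis+
  show thesis
  proof (rule that[of "min (min d1 d2) (r / 2)"])
    show "min (min d1 d2) (r / 2) > 0" using d1(1) d2(1) r(1) by simp
    fix \<delta> assume \<delta>: "0 < \<delta>" "\<delta> < min (min d1 d2) (r / 2)"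
    then have \<delta>': "\<delta> < d1" "\<delta> < d2" "2 * \<delta> < r" by auto
    from d1(2)[OF \<delta>(1) \<delta>'(1)] d2(2)[OF \<delta>(1) \<delta>'(2)] eventually_gt_at_top[of 0]
    show "\<forall>\<^sub>F N in sequentially. \<forall>h B.
      tracks f N h \<longrightarrow> slope_controlled f N h \<longrightarrow> real N * (\<bar>us\<bar> + 2 * r + 1) \<le> of_int B \<longrightarrow>
      \<bar>step_sum h (window_weight N (graph f us) r (graph f uL) (graph f uR) \<delta>) {-B..B}
        + (tilt (k uR) - tilt (k uL))\<bar> \<le> \<epsilon>"
    proof eventually_elim
      case (elim N)
      show ?case
      proof (intro allI impI)
        fix h B
        assume h: "tracks f N h" "slope_controlled f N h" and B: "real N * (\<bar>us\<bar> + 2 * r + 1) \<le> of_int B"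
        let ?S = "step_sum h (window_weight N (graph f us) r (graph f uL) (graph f uR) \<delta>)"
        define JR where "JR = {i\<in>{-B..B}. us \<le> of_int i / N}"
        define JL where "JL = {i\<in>{-B..B}. of_int i / N < us}"
        have inB: "i \<in> {-B..B}" if "\<bar>of_int i / N - w\<bar> \<le> 2 * \<delta>" "\<bar>w - us\<bar> \<le> r" for i w
        proof -
          have "\<bar>of_int i / real N\<bar> \<le> \<bar>us\<bar> + 2 * r + 1" using that \<delta>'(3) r(1) by linarith
          then have "real N * \<bar>of_int i / real N\<bar> \<le> of_int B" using B by (meson mult_left_mono of_nat_0_le_iff order_trans)
          then have "\<bar>real_of_int i\<bar> \<le> of_int B" using elim(3) by simp
          then show ?thesis by (auto simp: abs_le_iff)
        qed
        have fin: "finite JR" "finite JL"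
          unfolding JR_def JL_def by (rule finite_subset[of _ "{-B..B}"]; auto)+
        have "\<bar>?S JR + 1 * tilt (k uR)\<bar> \<le> \<epsilon> / 2"
        proof (rule elim(1)[rule_format, OF h])
          show "finite JR" by (rule fin)
        qed (use inB uLR in \<open>auto simp: JR_def\<close>)
        moreover have "\<bar>?S JL + - 1 * tilt (k uL)\<bar> \<le> \<epsilon> / 2"
          unfolding window_weight_swap[of N "graph f us" r "graph f uL"]
        proof (rule elim(2)[rule_format, OF h])
          show "finite JL" by (rule fin)
        qed (use inB uLR in \<open>auto simp: JL_def\<close>)
        moreover have "?S {-B..B} = ?S JR + ?S JL"
        proof -
          have "{-B..B} = JR \<union> JL" by (auto simp: JR_def JL_def)
          moreover have "JR \<inter> JL = {}" by (auto simp: JR_def JL_def)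
          ultimately show ?thesis using fin by (simp add: step_sum_def sum.union_disjoint)
        qed
        ultimately show "\<bar>?S {-B..B} + (tilt (k uR) - tilt (k uL))\<bar> \<le> \<epsilon>" by linarith
      qed
    qed
  qed
qed

lemma continuous_f: "continuous_on A f"
  unfolding continuous_on_iff
proof (intro ballI allI impI)
  fix x e :: real assume e: "e > 0"
  have "\<bar>f y - f x\<bar> < e" if "\<bar>y - x\<bar> < e / 2" for y
    by (rule order.strict_trans1[OF lip[of y x]]) (use that in simp)
  then show "\<exists>d>0. \<forall>y\<in>A. dist y x < d \<longrightarrow> dist (f y) (f x) < e"
    using e by (intro exI[of _ "e / 2"]) (auto simp: dist_real_def)
qed

lemma continuous_dist_graph: "continuous_on A (\<lambda>u. dist (graph f u) (graph f us))"
  unfolding graph_def by (intro continuous_intros continuous_f)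

lemma endpoint_exists:
  assumes e: "e = 1 \<or> e = -1" and r: "r > 0"
  shows "\<exists>!u. e * (u - us) \<ge> 0 \<and> dist (graph f u) (graph f us) = r"
proof -
  have "\<exists>x\<ge>0. x \<le> r \<and> dist (graph f (us + e * x)) (graph f us) = r"
  proof (rule IVT')
    show "dist (graph f (us + e * 0)) (graph f us) \<le> r" using r by simp
    show "r \<le> dist (graph f (us + e * r)) (graph f us)"
      using abs_le_dist_graph[of "us + e * r" us f] e r by auto
    have "continuous_on {0..r} ((\<lambda>u. dist (graph f u) (graph f us)) \<circ> (\<lambda>x. us + e * x))"
      by (intro continuous_on_compose continuous_intros continuous_dist_graph)
    then show "continuous_on {0..r} (\<lambda>x. dist (graph f (us + e * x)) (graph f us))" by (simp add: o_def)
  qed (use r in simp)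
  then obtain x where x: "0 \<le> x" "dist (graph f (us + e * x)) (graph f us) = r" by blast
  define u1 where "u1 = us + e * x"
  have "x \<noteq> 0" using x r by auto
  then have u1: "e * (u1 - us) > 0" "dist (graph f u1) (graph f us) = r" using e x by (auto simp: u1_def)
  obtain c0 where c0: "c0 > 0"
    "\<And>u. e * (u - us) \<ge> 0 \<Longrightarrow>
      ((dist (graph f u) (graph f us))\<^sup>2 - (dist (graph f u1) (graph f us))\<^sup>2) * (e * (u - u1)) \<ge> c0 * (u - u1)\<^sup>2"
    using transversality[OF e u1(1)] by blast
  have "u = u1" if "e * (u - us) \<ge> 0" "dist (graph f u) (graph f us) = r" for u
  proof (rule ccontr)
    assume "u \<noteq> u1"
    then have "c0 * (u - u1)\<^sup>2 > 0" using c0(1) by simp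
    then show False using c0(2)[OF that(1)] that(2) u1(2) by simp
  qed
  then show ?thesis using u1 by (intro ex1I[of _ u1]) (auto intro: less_imp_le)
qed

definition endpoint :: "real \<Rightarrow> real \<Rightarrow> real" where
  "endpoint e r = (THE u. e * (u - us) \<ge> 0 \<and> dist (graph f u) (graph f us) = r)"

lemma endpoint:
  assumes "e = 1 \<or> e = -1" "r > 0"
  shows "e * (endpoint e r - us) > 0" "dist (graph f (endpoint e r)) (graph f us) = r" "\<bar>endpoint e r - us\<bar> \<le> r"
    and "e * (u - us) \<ge> 0 \<Longrightarrow> dist (graph f u) (graph f us) = r \<Longrightarrow> u = endpoint e r"
proof -
  note ex1 = endpoint_exists[OF assms]
  have *: "e * (endpoint e r - us) \<ge> 0" "dist (graph f (endpoint e r)) (graph f us) = r"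
    using theI'[OF ex1] unfolding endpoint_def by blast+
  then have "endpoint e r \<noteq> us" using assms by auto
  then show "e * (endpoint e r - us) > 0" using * assms by auto
  show "dist (graph f (endpoint e r)) (graph f us) = r" by (rule *)
  show "\<bar>endpoint e r - us\<bar> \<le> r" using abs_le_dist_graph[of "endpoint e r" us f] * by simp
  show "e * (u - us) \<ge> 0 \<Longrightarrow> dist (graph f u) (graph f us) = r \<Longrightarrow> u = endpoint e r"
    using ex1 * by blast
qed

text \<open>The distance along the graph is asymptotic to \<open>sqrt (1 + (k us)\<^sup>2)\<close> times the horizontal
  distance.\<close>

lemma endpoint_asymptotics:
  assumes e: "e = 1 \<or> e = -1"
  shows "filterlim (endpoint e) (at us) (at_right 0)"
    and "((\<lambda>r. (endpoint e r - us) / r) \<longlongrightarrow> e / sqrt (1 + (k us)\<^sup>2)) (at_right 0)"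
proof -
  have pos: "\<forall>\<^sub>F r in at_right 0. (0::real) < r" by (simp add: eventually_at_right_less)
  have "((\<lambda>r. endpoint e r - us) \<longlongrightarrow> 0) (at_right 0)"
  proof (rule tendsto_0_le[where K = 1])
    show "((\<lambda>r::real. r) \<longlongrightarrow> 0) (at_right 0)" by (rule tendsto_ident_at)
    show "\<forall>\<^sub>F r in at_right 0. norm (endpoint e r - us) \<le> norm r * 1"
      using pos by eventually_elim (use endpoint(3)[OF e] in auto)
  qed
  then have "(endpoint e \<longlongrightarrow> us) (at_right 0)" by (rule LIM_zero_cancel)
  moreover have "\<forall>\<^sub>F r in at_right 0. endpoint e r \<noteq> us"
    using pos by eventually_elim (use endpoint(1)[OF e] in force)
  ultimately show lim: "filterlim (endpoint e) (at us) (at_right 0)"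
    by (simp add: filterlim_at)
  have q: "sqrt (1 + x\<^sup>2) \<noteq> 0" for x :: real
    using zero_le_power2[of x] real_sqrt_gt_zero[of "1 + x\<^sup>2"] by linarith
  have "(f has_real_derivative k us) (at us)" using deriv R by simp
  then have "((\<lambda>u. (f u - f us) / (u - us)) \<longlongrightarrow> k us) (at us)" by (simp add: has_field_derivative_iff)
  then have "((\<lambda>u. e / sqrt (1 + ((f u - f us) / (u - us))\<^sup>2)) \<longlongrightarrow> e / sqrt (1 + (k us)\<^sup>2)) (at us)"
    by (intro tendsto_intros q)
  from filterlim_compose[OF this lim]
  have "((\<lambda>r. e / sqrt (1 + ((f (endpoint e r) - f us) / (endpoint e r - us))\<^sup>2)) \<longlongrightarrow> e / sqrt (1 + (k us)\<^sup>2)) (at_right 0)" .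
  moreover have "\<forall>\<^sub>F r in at_right 0. e / sqrt (1 + ((f (endpoint e r) - f us) / (endpoint e r - us))\<^sup>2) = (endpoint e r - us) / r"
    using pos
  proof eventually_elim
    case (elim r)
    define U where "U = endpoint e r - us"
    define F where "F = f (endpoint e r) - f us"
    have U: "e * U > 0" using endpoint(1)[OF e elim] by (simp add: U_def)
    then have U0: "U \<noteq> 0" by auto
    have "r = sqrt (U\<^sup>2 + F\<^sup>2)"
      using endpoint(2)[OF e elim] by (simp add: graph_def dist_norm cmod_def U_def F_def)
    also have "U\<^sup>2 + F\<^sup>2 = U\<^sup>2 * (1 + (F / U)\<^sup>2)" using U0 by (simp add: power_divide algebra_simps)
    also have "sqrt \<dots> = \<bar>U\<bar> * sqrt (1 + (F / U)\<^sup>2)" by (simp add: real_sqrt_mult)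
    finally have "r = e * U * sqrt (1 + (F / U)\<^sup>2)" using e U by auto
    moreover have "sqrt (1 + (F / U)\<^sup>2) \<noteq> 0" by (rule q)
    ultimately show ?case unfolding U_def[symmetric] F_def[symmetric] using e U0 by (auto simp: field_simps)
  qed
  ultimately show "((\<lambda>r. (endpoint e r - us) / r) \<longlongrightarrow> e / sqrt (1 + (k us)\<^sup>2)) (at_right 0)"
    by (rule Lim_transform_eventually)
qed

end

section \<open>The drift around a point of a graph\<close>

text \<open>At the slopes 1 and -1, where the two branches meet, the derivatives of both are zero and
  agree with the formula.\<close>

lemma tilt_has_derivative:
  assumes "\<bar>a\<bar> \<le> 1"
  shows "(tilt has_real_derivative (1 - a\<^sup>2) / (1 + a\<^sup>2)\<^sup>2) (at a)"
proof -
  define \<psi> where "\<psi> x = x / (1 + x\<^sup>2)" for x :: real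
  have p: "1 + x\<^sup>2 \<noteq> 0" for x :: real using zero_le_power2[of x] by linarith
  have \<psi>: "(\<psi> has_real_derivative (1 - a\<^sup>2) / (1 + a\<^sup>2)\<^sup>2) (at a)" for a
    unfolding \<psi>_def by (rule derivative_eq_intros refl p | simp)+ (simp add: power2_eq_square)
  show ?thesis
  proof (cases "\<bar>a\<bar> = 1")
    case False
    show ?thesis
    proof (rule has_field_derivative_transform_within_open[OF \<psi>])
      show "open {-1<..<1::real}" by simp
    qed (use assms False in \<open>auto simp: \<psi>_def tilt_def abs_if split: if_splits\<close>)
  next
    case True
    then have a: "a = 1 \<or> a = -1" by linarith
    have "((\<lambda>x. (\<psi> x - \<psi> a) / (x - a)) \<longlongrightarrow> 0) (at a)"
      using \<psi>[of a] a by (auto simp: has_field_derivative_iff)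
    then have "((\<lambda>x. \<bar>(\<psi> x - \<psi> a) / (x - a)\<bar>) \<longlongrightarrow> 0) (at a)" by (rule tendsto_rabs_zero)
    moreover have "\<forall>\<^sub>F x in at a. \<bar>(\<psi> x - \<psi> a) / (x - a)\<bar> = \<bar>(tilt x - tilt a) / (x - a)\<bar>"
    proof -
      have "\<forall>\<^sub>F x in at a. x \<in> ball a 1" by (rule eventually_at_in_open'[of "ball a 1"]) auto
      then show ?thesis
      proof eventually_elim
        case (elim x)
        then have "sgn x = a" using a by (auto simp: dist_real_def sgn_if)
        then have "\<bar>tilt x - tilt a\<bar> = \<bar>\<psi> x - \<psi> a\<bar>"
          using a unfolding tilt_def \<psi>_def[symmetric] by (auto simp: \<psi>_def[of 1] \<psi>_def[of "-1"])
        then show ?case by (simp add: abs_divide)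
      qed
    qed
    ultimately have "((\<lambda>x. \<bar>(tilt x - tilt a) / (x - a)\<bar>) \<longlongrightarrow> 0) (at a)" by (rule Lim_transform_eventually)
    then have "((\<lambda>x. (tilt x - tilt a) / (x - a)) \<longlongrightarrow> 0) (at a)" by (rule tendsto_rabs_zero_cancel)
    then show ?thesis using a by (auto simp: has_field_derivative_iff)
  qed
qed

lemma window_weight_support:
  assumes "N > 0" "\<delta> > 0" "window_weight N s r x0 x1 \<delta> x \<noteq> 0" "dist x0 s = r" "dist x1 s = r"
  obtains z where "z \<in> cell N x" "dist z s \<le> r + \<delta>"
proof -
  have near: "\<exists>z\<in>cell N x. dist z s \<le> r + \<delta>" if p: "dist p s = r" "infdist p (cell N x) < \<delta>" for p
  proof -
    have ne: "cell N x \<noteq> {}" using centre_in_cell[OF assms(1), of x] by blast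
    then have "(INF a\<in>cell N x. dist p a) < \<delta>" using p by (simp add: infdist_notempty)
    then obtain a where "a \<in> cell N x" "dist p a < \<delta>"
      using ne by (subst (asm) cINF_less_iff) auto
    then show ?thesis using p(1) dist_triangle[of a s p] by (intro bexI[of _ a]) (auto simp: dist_commute)
  qed
  show thesis
  proof (cases "cell N x \<inter> cball s r \<noteq> {} \<or> infdist x0 (cell N x) < \<delta> \<or> infdist x1 (cell N x) < \<delta>")
    case True
    moreover have "\<exists>z\<in>cell N x. dist z s \<le> r + \<delta>" if "cell N x \<inter> cball s r \<noteq> {}"
      using that assms(2) by (force simp: dist_commute)
    ultimately show thesis using near assms(4,5) that by blast
  next
    case False
    then have "window_weight N s r x0 x1 \<delta> x = 0" using assms(2) by (auto simp: window_weight_def)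
    then show thesis using assms(3) by simp
  qed
qed

lemma dist_centre_neighbour:
  assumes "N > 0" "y \<in> neighbours x"
  shows "dist (centre N y) (centre N x) \<le> 1 / N"
  using assms by (auto simp: neighbours_def centre_def dist_norm cmod_def diff_divide_distrib[symmetric] power_divide
      real_sqrt_divide)

text \<open>The limit as \<open>N\<close> tends to infinity and then \<open>\<delta>\<close> to zero, in a form that covers the lower and the
  upper limit in \<open>N\<close> at once.\<close>

definition has_drift_limit :: "complex set \<Rightarrow> complex \<Rightarrow> real \<Rightarrow> complex \<Rightarrow> complex \<Rightarrow> real \<Rightarrow> bool" where
  "has_drift_limit \<Omega> s r p q g \<longleftrightarrow>
     (\<forall>\<epsilon>>0. \<exists>\<delta>0>0. \<forall>\<delta>. 0 < \<delta> \<longrightarrow> \<delta> < \<delta>0 \<longrightarrow> (\<forall>\<^sub>F N in sequentially. \<forall>F.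
        finite F \<longrightarrow> {x. cell N x \<inter> (cball s r \<union> cball p \<delta> \<union> cball q \<delta>) \<noteq> {}} \<subseteq> F \<longrightarrow>
        \<bar>(\<Sum>x\<in>F. signed_rate (initial_config N \<Omega>) x * window_weight N s r p q \<delta> x) - g\<bar> \<le> \<epsilon>))"

context chart
begin

lemma heights_have_no_deep_notch:
  assumes N: "N > 0" and h: "slope_controlled f N h"
  shows "no_deep_notch h"
proof (cases "shallow f")
  case True
  have b: "\<bar>f (x + 1 / N) - f x\<bar> \<le> 1 / N" for x using shallow_le[OF True, of "x + 1 / N" x] by simp
  have "of_int (-1) / N \<le> f (x + 1 / N) - f x \<and> f (x + 1 / N) - f x \<le> of_int 1 / N" for x
    using b[of x] by auto
  then have "-1 \<le> step h i \<and> step h i \<le> 1" for i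
    using h unfolding slope_controlled_def by blast
  then have "-1 \<le> step h i \<and> step h i \<le> 1 \<and> - 1 \<le> step h (i - 1) \<and> step h (i - 1) \<le> 1" for i by blast
  then show ?thesis unfolding no_deep_notch_def step_def by (smt (verit))
next
  case False
  then obtain \<zeta> where z: "\<zeta> = 1 \<or> \<zeta> = -1" "monotone_with_sign \<zeta> f" using mode by blast
  have inc: "0 \<le> \<zeta> * (f (x + 1 / N) - f x) \<and> \<zeta> * (f (x + 1 / N) - f x) \<le> 2 / N" for x
    using z(2) unfolding monotone_with_sign_def by (drule_tac spec[of _ x], drule_tac spec[of _ "x + 1 / N"]) simp
  have "(\<forall>i. 0 \<le> step h i) \<or> (\<forall>i. step h i \<le> 0)"
  proof (cases "\<zeta> = 1")
    case True
    have "of_int 0 / N \<le> f (x + 1 / N) - f x \<and> f (x + 1 / N) - f x \<le> of_int 2 / N" for x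
      using inc[of x] True by simp
    then have "0 \<le> step h i" for i using h unfolding slope_controlled_def by blast
    then show ?thesis by blast
  next
    case False
    have "of_int (-2) / N \<le> f (x + 1 / N) - f x \<and> f (x + 1 / N) - f x \<le> of_int 0 / N" for x
      using inc[of x] False z(1) by auto
    then have "step h i \<le> 0" for i using h unfolding slope_controlled_def by blast
    then show ?thesis by blast
  qed
  then show ?thesis
  proof
    assume a: "\<forall>i. 0 \<le> step h i"
    have "h (i - 1) \<le> h i \<and> h i \<le> h (i + 1)" for i using a[rule_format, of i] a[rule_format, of "i - 1"] by (simp add: step_def)
    then show ?thesis unfolding no_deep_notch_def by (smt (verit))
  next
    assume a: "\<forall>i. step h i \<le> 0"
    have "h (i - 1) \<ge> h i \<and> h i \<ge> h (i + 1)" for i using a[rule_format, of i] a[rule_format, of "i - 1"] by (simp add: step_def)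
    then show ?thesis unfolding no_deep_notch_def by (smt (verit))
  qed
qed

text \<open>If the region lies below the graph, the phases are exchanged, which changes the sign of all signed
  rates.\<close>

lemma initial_config_heap:
  assumes N: "N > 0" and \<omega>: "\<omega> = 1 \<or> \<omega> = -1"
    and side: "\<And>z. z \<in> U \<Longrightarrow> z \<in> \<Omega> \<longleftrightarrow> (if \<omega> = 1 then f (Re z) \<le> Im z else Im z \<le> f (Re z))"
  obtains h where "tracks f N h" "slope_controlled f N h"
    "\<And>x. cell N x \<subseteq> U \<Longrightarrow> (\<And>y. y \<in> neighbours x \<Longrightarrow> cell N y \<subseteq> U) \<Longrightarrow>
       signed_rate (initial_config N \<Omega>) x = \<omega> * signed_rate (heap_config h) x"
proof (cases "\<omega> = 1")
  case True
  obtain h where h: "\<And>i j. (\<exists>z\<in>cell N (i, j). f (Re z) \<le> Im z) \<longleftrightarrow> h i < j" "tracks f N h" "slope_controlled f N h"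
    using epigraph_heights[OF N lip] by blast
  have "initial_config N \<Omega> x = heap_config h x" if "cell N x \<subseteq> U" for x
  proof -
    have "cell N x \<inter> \<Omega> \<noteq> {} \<longleftrightarrow> (\<exists>z\<in>cell N x. f (Re z) \<le> Im z)"
      using side that True by auto
    then show ?thesis using h(1)[of "fst x" "snd x"] by (simp add: initial_config_def heap_config_def)
  qed
  then show thesis using True h by (intro that[of h]) (auto intro!: signed_rate_cong)
next
  case False
  obtain h where h: "\<And>i j. (\<exists>z\<in>cell N (i, j). Im z \<le> f (Re z)) \<longleftrightarrow> \<not> h i < j" "tracks f N h" "slope_controlled f N h"
    using hypograph_heights[OF N lip] by blast
  have "initial_config N \<Omega> x = (if heap_config h x = Plus then Minus else Plus)" if "cell N x \<subseteq> U" for x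
  proof -
    have "cell N x \<inter> \<Omega> \<noteq> {} \<longleftrightarrow> (\<exists>z\<in>cell N x. Im z \<le> f (Re z))"
      using side that False by auto
    then show ?thesis using h(1)[of "fst x" "snd x"] by (simp add: initial_config_def heap_config_def)
  qed
  then have "signed_rate (initial_config N \<Omega>) x = - signed_rate (heap_config h) x"
    if "cell N x \<subseteq> U" "\<And>y. y \<in> neighbours x \<Longrightarrow> cell N y \<subseteq> U" for x
    unfolding signed_rate_flip_all[of "heap_config h", symmetric] using that by (intro signed_rate_cong) auto
  moreover have "\<omega> = - 1" using \<omega> False by blast
  ultimately show thesis using h by (intro that[of h]) simp_all
qed

text \<open>The sign \<open>\<omega>\<close> is 1 if the region lies above the graph and -1 if it lies below.\<close>

lemma local_drift:
  assumes \<omega>: "\<omega> = 1 \<or> \<omega> = -1"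
    and side: "\<And>z. z \<in> ball (graph f us) R' \<Longrightarrow> z \<in> \<Omega> \<longleftrightarrow> (if \<omega> = 1 then f (Re z) \<le> Im z else Im z \<le> f (Re z))"
    and r: "0 < r" "r < R" "r < R'"
    and ends: "{x0, x1} = {graph f (endpoint (-1) r), graph f (endpoint 1 r)}"
  shows "has_drift_limit \<Omega> (graph f us) r x0 x1 ((- \<omega> / 2) * (tilt (k (endpoint 1 r)) - tilt (k (endpoint (-1) r))))"
  unfolding has_drift_limit_def
proof (intro allI impI)
  fix \<epsilon> :: real assume \<epsilon>: "\<epsilon> > 0"
  define uL where "uL = endpoint (-1) r"
  define uR where "uR = endpoint 1 r"
  have uL: "uL < us" "dist (graph f uL) (graph f us) = r" "\<bar>uL - us\<bar> < R"
    and uR: "us < uR" "dist (graph f uR) (graph f us) = r" "\<bar>uR - us\<bar> < R"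
    using endpoint(1-3)[of "-1" r] endpoint(1-3)[of 1 r] r by (simp_all add: uL_def uR_def)
  have W: "window_weight N s r x0 x1 \<delta> = window_weight N s r (graph f uL) (graph f uR) \<delta>" for N s \<delta>
  proof -
    have "(x0 = graph f uL \<and> x1 = graph f uR) \<or> (x0 = graph f uR \<and> x1 = graph f uL)"
      using ends unfolding uL_def uR_def by (auto simp: doubleton_eq_iff)
    then show ?thesis using window_weight_swap by auto
  qed
  obtain d where d: "d > 0" "\<And>\<delta>. 0 < \<delta> \<Longrightarrow> \<delta> < d \<Longrightarrow> \<forall>\<^sub>F N in sequentially. \<forall>h B.
      tracks f N h \<longrightarrow> slope_controlled f N h \<longrightarrow> real N * (\<bar>us\<bar> + 2 * r + 1) \<le> of_int B \<longrightarrow>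
      \<bar>step_sum h (window_weight N (graph f us) r (graph f uL) (graph f uR) \<delta>) {-B..B}
        + (tilt (k uR) - tilt (k uL))\<bar> \<le> \<epsilon>"
    using arc_sum[OF uL(1) uR(1) uL(3) uR(3) r(1) uL(2) uR(2) \<epsilon>] by blast
  define \<delta>0 where "\<delta>0 = min d (min r ((R' - r) / 2))"
  show "\<exists>\<delta>0>0. \<forall>\<delta>. 0 < \<delta> \<longrightarrow> \<delta> < \<delta>0 \<longrightarrow> (\<forall>\<^sub>F N in sequentially. \<forall>F.
      finite F \<longrightarrow> {x. cell N x \<inter> (cball (graph f us) r \<union> cball x0 \<delta> \<union> cball x1 \<delta>) \<noteq> {}} \<subseteq> F \<longrightarrow>
      \<bar>(\<Sum>x\<in>F. signed_rate (initial_config N \<Omega>) x * window_weight N (graph f us) r x0 x1 \<delta> x)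
        - (- \<omega> / 2) * (tilt (k (endpoint 1 r)) - tilt (k (endpoint (-1) r)))\<bar> \<le> \<epsilon>)"
  proof (intro exI[of _ \<delta>0] conjI allI impI)
    show "\<delta>0 > 0" using d(1) r by (simp add: \<delta>0_def)
    fix \<delta> assume \<delta>: "0 < \<delta>" "\<delta> < \<delta>0"
    then have \<delta>': "\<delta> < d" "\<delta> < r" "\<delta> < (R' - r) / 2" by (auto simp: \<delta>0_def)
    have "(\<lambda>N. 3 / real N) \<longlonglongrightarrow> 0" by (rule lim_const_over_n)
    then have "\<forall>\<^sub>F N in sequentially. 3 / real N < (R' - r) / 2" using r by (intro order_tendstoD(2)) auto
    with d(2)[OF \<delta>(1) \<delta>'(1)] eventually_gt_at_top[of 0]
    show "\<forall>\<^sub>F N in sequentially. \<forall>F.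
      finite F \<longrightarrow> {x. cell N x \<inter> (cball (graph f us) r \<union> cball x0 \<delta> \<union> cball x1 \<delta>) \<noteq> {}} \<subseteq> F \<longrightarrow>
      \<bar>(\<Sum>x\<in>F. signed_rate (initial_config N \<Omega>) x * window_weight N (graph f us) r x0 x1 \<delta> x)
        - (- \<omega> / 2) * (tilt (k (endpoint 1 r)) - tilt (k (endpoint (-1) r)))\<bar> \<le> \<epsilon>"
      unfolding uL_def[symmetric] uR_def[symmetric]
    proof eventually_elim
      case (elim N)
      show ?case
      proof (intro allI impI)
        fix F :: "site set"
        assume F: "finite F" "{x. cell N x \<inter> (cball (graph f us) r \<union> cball x0 \<delta> \<union> cball x1 \<delta>) \<noteq> {}} \<subseteq> F"
        let ?s = "graph f us"
        define M where "M = window_weight N ?s r x0 x1 \<delta>"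
        obtain h where h: "tracks f N h" "slope_controlled f N h"
          "\<And>x. cell N x \<subseteq> ball ?s R' \<Longrightarrow> (\<And>y. y \<in> neighbours x \<Longrightarrow> cell N y \<subseteq> ball ?s R') \<Longrightarrow>
            signed_rate (initial_config N \<Omega>) x = \<omega> * signed_rate (heap_config h) x"
          using initial_config_heap[OF elim(2) \<omega> side] by blast
        define B where "B = \<lceil>real N * (\<bar>us\<bar> + 2 * r + 1)\<rceil>"
        have supp: "x \<in> F" "\<bar>fst x\<bar> < B" "signed_rate (initial_config N \<Omega>) x = \<omega> * signed_rate (heap_config h) x"
          if nzM: "M x \<noteq> 0" for x
        proof -
          have d01: "dist x0 ?s = r" "dist x1 ?s = r"
            using ends uL(2) uR(2) unfolding uL_def uR_def by (auto simp: doubleton_eq_iff)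
          obtain z where z: "z \<in> cell N x" "dist z ?s \<le> r + \<delta>"
            using window_weight_support[OF elim(2) \<delta>(1) nzM[unfolded M_def] d01] by blast
          have n: "0 < 1 / real N" "3 / real N = 3 * (1 / N)" "1 / real N \<le> 1" using elim(2) by auto
          have c: "dist (centre N x) ?s \<le> r + \<delta> + 1 / N"
            using dist_centre_cell[OF elim(2) z(1)] z(2) dist_triangle[of "centre N x" ?s z] by (simp add: dist_commute)
          have sub: "cell N y \<subseteq> ball ?s R'" if "dist (centre N y) ?s \<le> r + \<delta> + 2 * (1 / N)" for y
          proof
            fix a assume "a \<in> cell N y"
            then have "dist a ?s \<le> 1 / N + (r + \<delta> + 2 * (1 / N))"
              using that dist_centre_cell[OF elim(2), of a y] dist_triangle[of a ?s "centre N y"] by linarith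
            moreover have "p < R'" if "p \<le> q + (r + \<delta> + 2 * q)" "\<delta> < w" "3 * q < w" "r + 2 * w = R'" for p q w :: real
              using that by linarith
            moreover have "3 * (1 / real N) < (R' - r) / 2" "r + 2 * ((R' - r) / 2) = R'" using elim(3) by (simp_all add: field_simps)
            ultimately have "dist a ?s < R'" using \<delta>'(3) by blast
            then show "a \<in> ball ?s R'" by (simp add: dist_commute)
          qed
          have x: "cell N x \<subseteq> ball ?s R'" using c n(1) by (intro sub) linarith
          have y: "cell N y \<subseteq> ball ?s R'" if "y \<in> neighbours x" for y
            using dist_centre_neighbour[OF elim(2) that] c dist_triangle[of "centre N y" ?s "centre N x"]
            by (intro sub) linarith
          show "signed_rate (initial_config N \<Omega>) x = \<omega> * signed_rate (heap_config h) x" by (rule h(3)[OF x y])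
          have "\<bar>of_int (fst x) / real N - us\<bar> \<le> r + \<delta> + 1 / N"
            using c abs_Re_le_cmod[of "centre N x - ?s"] by (simp add: dist_norm centre_def graph_def)
          then have "\<bar>of_int (fst x) / real N\<bar> < \<bar>us\<bar> + 2 * r + 1" using \<delta>'(2) n(3) by linarith
          then have "real N * \<bar>of_int (fst x) / real N\<bar> < real N * (\<bar>us\<bar> + 2 * r + 1)" using elim(2) by (intro mult_strict_left_mono) auto
          moreover have "real N * \<bar>of_int (fst x) / real N\<bar> = \<bar>real_of_int (fst x)\<bar>" using elim(2) by simp
          ultimately have "\<bar>real_of_int (fst x)\<bar> < real N * (\<bar>us\<bar> + 2 * r + 1)" by (simp only:)
          then show "\<bar>fst x\<bar> < B" unfolding B_def less_ceiling_iff by simp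
          show "x \<in> F"
          proof -
            have "cell N x \<inter> (cball ?s r \<union> cball x0 \<delta> \<union> cball x1 \<delta>) \<noteq> {}"
            proof (rule ccontr)
              assume "\<not> ?thesis"
              then have *: "cell N x \<inter> cball ?s r = {}" "cell N x \<inter> cball x0 \<delta> = {}" "cell N x \<inter> cball x1 \<delta> = {}" by auto
              have "\<delta> \<le> infdist p (cell N x)" if "cell N x \<inter> cball p \<delta> = {}" for p
              proof -
                have "cell N x \<noteq> {}" using z(1) by blast
                moreover have "\<delta> \<le> dist p a" if "a \<in> cell N x" for a
                  using \<open>cell N x \<inter> cball p \<delta> = {}\<close> that by (metis disjoint_iff linear mem_cball)
                ultimately show ?thesis by (simp add: infdist_notempty cINF_greatest)
              qed
              then have "M x = 0" using * \<delta>(1) by (simp add: M_def window_weight_def min_absorb1)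
              then show False using nzM by simp
            qed
            then show ?thesis using F(2) by blast
          qed
        qed
        have "(\<Sum>x\<in>F. signed_rate (initial_config N \<Omega>) x * M x) = (\<Sum>x\<in>F. \<omega> * (signed_rate (heap_config h) x * M x))"
          using supp(3) by (intro sum.cong refl) (metis mult.assoc mult_zero_right)
        also have "\<dots> = \<omega> * (\<Sum>x\<in>F. signed_rate (heap_config h) x * M x)" by (simp only: sum_distrib_left)
        also have "(\<Sum>x\<in>F. signed_rate (heap_config h) x * M x)
           = 1/2 * step_sum h M {-B..B}"
          by (rule sum_signed_rate_heap[OF heights_have_no_deep_notch[OF elim(2) h(2)] F(1)]) (use supp in blast)
        finally have eq: "(\<Sum>x\<in>F. signed_rate (initial_config N \<Omega>) x * M x)
           = \<omega> / 2 * step_sum h M {-B..B}" by simp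
        have le: "\<bar>step_sum h M {-B..B}
           + (tilt (k uR) - tilt (k uL))\<bar> \<le> \<epsilon>" (is "\<bar>?S + ?T\<bar> \<le> \<epsilon>")
          unfolding M_def W by (rule elim(1)[rule_format, OF h(1,2)]) (simp add: B_def)
        have "(\<Sum>x\<in>F. signed_rate (initial_config N \<Omega>) x * M x) - (- \<omega> / 2) * ?T = \<omega> / 2 * (?S + ?T)"
          unfolding eq by (simp add: ring_distribs)
        then have "\<bar>(\<Sum>x\<in>F. signed_rate (initial_config N \<Omega>) x * M x) - (- \<omega> / 2) * ?T\<bar> = \<bar>\<omega> / 2\<bar> * \<bar>?S + ?T\<bar>"
          by (simp only: abs_mult)
        also have "\<bar>\<omega> / 2\<bar> = 1 / 2" using \<omega> by auto
        also have "1 / 2 * \<bar>?S + ?T\<bar> \<le> \<epsilon>" using le \<epsilon> by simp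
        finally show "\<bar>(\<Sum>x\<in>F. signed_rate (initial_config N \<Omega>) x * window_weight N ?s r x0 x1 \<delta> x) - (- \<omega> / 2) * ?T\<bar> \<le> \<epsilon>"
          unfolding M_def .
      qed
    qed
  qed
qed

text \<open>Both end points are at the distance \<open>r / sqrt (1 + (k us)\<^sup>2) + o(r)\<close> from \<open>us\<close>
  in the horizontal direction, one on each side.\<close>

lemma local_drift_over_radius:
  assumes k2: "(k has_real_derivative k2) (at us)" and k1: "\<bar>k us\<bar> \<le> 1"
  shows "((\<lambda>r. (- \<omega> / 2) * (tilt (k (endpoint 1 r)) - tilt (k (endpoint (-1) r))) / (2 * r))
     \<longlongrightarrow> (- \<omega> / 2) * ((1 - (k us)\<^sup>2) / (1 + (k us)\<^sup>2)\<^sup>2 * k2 / sqrt (1 + (k us)\<^sup>2))) (at_right 0)"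
proof -
  define D where "D = (1 - (k us)\<^sup>2) / (1 + (k us)\<^sup>2)\<^sup>2 * k2"
  have "((\<lambda>u. tilt (k u)) has_real_derivative D) (at us)"
    unfolding D_def using DERIV_chain2[OF tilt_has_derivative[OF k1] k2] .
  then have T: "((\<lambda>u. (tilt (k u) - tilt (k us)) / (u - us)) \<longlongrightarrow> D) (at us)"
    by (simp add: has_field_derivative_iff)
  have one: "((\<lambda>r. (tilt (k (endpoint e r)) - tilt (k us)) / r) \<longlongrightarrow> D * (e / sqrt (1 + (k us)\<^sup>2))) (at_right 0)"
    if e: "e = 1 \<or> e = -1" for e
  proof -
    have "((\<lambda>r. (tilt (k (endpoint e r)) - tilt (k us)) / (endpoint e r - us) * ((endpoint e r - us) / r))
       \<longlongrightarrow> D * (e / sqrt (1 + (k us)\<^sup>2))) (at_right 0)"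
      by (intro tendsto_mult filterlim_compose[OF T endpoint_asymptotics(1)[OF e]] endpoint_asymptotics(2)[OF e])
    moreover have "\<forall>\<^sub>F r in at_right 0. (tilt (k (endpoint e r)) - tilt (k us)) / (endpoint e r - us) * ((endpoint e r - us) / r)
       = (tilt (k (endpoint e r)) - tilt (k us)) / r"
    proof -
      have "\<forall>\<^sub>F r in at_right 0. (0::real) < r" by (simp add: eventually_at_right_less)
      then show ?thesis by eventually_elim (use endpoint(1)[OF e] in force)
    qed
    ultimately show ?thesis by (rule Lim_transform_eventually)
  qed
  have "((\<lambda>r. (- \<omega> / 4) * ((tilt (k (endpoint 1 r)) - tilt (k us)) / r - (tilt (k (endpoint (-1) r)) - tilt (k us)) / r))
     \<longlongrightarrow> (- \<omega> / 4) * (D * (1 / sqrt (1 + (k us)\<^sup>2)) - D * (- 1 / sqrt (1 + (k us)\<^sup>2)))) (at_right 0)"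
    by (intro tendsto_mult tendsto_diff tendsto_const one) auto
  moreover have "(- \<omega> / 4) * ((tilt (k (endpoint 1 r)) - tilt (k us)) / r - (tilt (k (endpoint (-1) r)) - tilt (k us)) / r)
     = (- \<omega> / 2) * (tilt (k (endpoint 1 r)) - tilt (k (endpoint (-1) r))) / (2 * r)" for r
    by (simp add: diff_divide_distrib[symmetric])
  moreover have "(- \<omega> / 4) * (D * (1 / sqrt (1 + (k us)\<^sup>2)) - D * (- 1 / sqrt (1 + (k us)\<^sup>2)))
     = (- \<omega> / 2) * (D / sqrt (1 + (k us)\<^sup>2))" by simp
  ultimately show ?thesis by (simp only: D_def)
qed

end

section \<open>Local graph coordinates for a regular curve\<close>

lemma increments_of_derivative:
  fixes g :: "real \<Rightarrow> real"
  assumes "\<And>\<tau>. \<bar>\<tau>\<bar> \<le> b \<Longrightarrow> (g has_real_derivative g' \<tau>) (at \<tau>)" "\<And>\<tau>. \<bar>\<tau>\<bar> \<le> b \<Longrightarrow> g' \<tau> > 0"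
    and "\<bar>\<tau>\<bar> \<le> b" "\<bar>\<tau>'\<bar> \<le> b" "\<tau> < \<tau>'"
  shows "g \<tau> < g \<tau>'"
proof (rule DERIV_pos_imp_increasing[OF assms(5)])
  fix v assume "\<tau> \<le> v" "v \<le> \<tau>'"
  then have "\<bar>v\<bar> \<le> b" using assms(3,4) by linarith
  then show "\<exists>y. (g has_real_derivative y) (at v) \<and> 0 < y" using assms(1,2) by blast
qed

text \<open>If the tangent is not diagonal, the slopes are less than one in absolute value near the base point;
  otherwise the curve is monotone there with slopes between zero and two in absolute value.\<close>

lemma chart_exists:
  fixes x y x' y' :: "real \<Rightarrow> real"
  assumes dx: "\<And>\<tau>. (x has_real_derivative x' \<tau>) (at \<tau>)" and dy: "\<And>\<tau>. (y has_real_derivative y' \<tau>) (at \<tau>)"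
    and cx: "continuous_on UNIV x'" and cy: "continuous_on UNIV y'"
    and d2: "(x' has_real_derivative x2) (at 0)" "(y' has_real_derivative y2) (at 0)"
    and pos: "x' 0 > 0" and diag: "\<bar>y' 0\<bar> \<le> x' 0"
  obtains f k R \<tau>1 where "chart f k (x 0) R" "\<tau>1 > 0"
    "\<And>\<tau>. \<bar>\<tau>\<bar> \<le> \<tau>1 \<Longrightarrow> f (x \<tau>) = y \<tau>"
    "\<And>u. \<bar>u - x 0\<bar> < R \<Longrightarrow> \<exists>\<tau>. \<bar>\<tau>\<bar> \<le> \<tau>1 \<and> u = x \<tau>"
    "k (x 0) = y' 0 / x' 0"
    "(k has_real_derivative (y2 * x' 0 - y' 0 * x2) / (x' 0) ^ 3) (at (x 0))"
proof -
  have near: "\<exists>d>0. \<forall>\<tau>. \<bar>\<tau>\<bar> \<le> d \<longrightarrow> g \<tau> > 0" if g: "continuous_on UNIV g" "g 0 > 0" for g :: "real \<Rightarrow> real"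
  proof -
    have "isCont g 0" using g(1) by (simp add: continuous_on_eq_continuous_at)
    then have "\<forall>\<^sub>F \<tau> in nhds 0. g \<tau> > 0"
      using g(2) order_tendstoD(1)[of g "g 0" "nhds 0" 0] by (simp add: isCont_def tendsto_at_iff_tendsto_nhds)
    then obtain d where d: "d > 0" "\<And>\<tau>. \<bar>\<tau>\<bar> < d \<Longrightarrow> g \<tau> > 0"
      unfolding eventually_nhds_metric by (auto simp: dist_real_def)
    then show ?thesis by (intro exI[of _ "d / 2"]) auto
  qed
  obtain \<tau>1 where \<tau>1: "\<tau>1 > 0" "\<And>\<tau>. \<bar>\<tau>\<bar> \<le> \<tau>1 \<Longrightarrow> x' \<tau> > 0"
    and md: "(\<forall>\<tau>. \<bar>\<tau>\<bar> \<le> \<tau>1 \<longrightarrow> \<bar>y' \<tau>\<bar> < x' \<tau>) \<or>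
      (\<exists>\<zeta>\<in>{1,-1}. \<forall>\<tau>. \<bar>\<tau>\<bar> \<le> \<tau>1 \<longrightarrow> 0 < \<zeta> * y' \<tau> \<and> \<zeta> * y' \<tau> < 2 * x' \<tau>)"
  proof -
    obtain d0 where d0: "d0 > 0" "\<And>\<tau>. \<bar>\<tau>\<bar> \<le> d0 \<Longrightarrow> x' \<tau> > 0" using near[OF cx pos] by blast
    show thesis
    proof (cases "\<bar>y' 0\<bar> < x' 0")
      case True
      have "continuous_on UNIV (\<lambda>\<tau>. x' \<tau> - \<bar>y' \<tau>\<bar>)" by (intro continuous_intros cx cy)
      then obtain d where d: "d > 0" "\<And>\<tau>. \<bar>\<tau>\<bar> \<le> d \<Longrightarrow> x' \<tau> - \<bar>y' \<tau>\<bar> > 0" using near[of "\<lambda>\<tau>. x' \<tau> - \<bar>y' \<tau>\<bar>"] True by auto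
      show thesis using d0 d by (intro that[of "min d0 d"] disjI1) force+
    next
      case False
      then have eq: "\<bar>y' 0\<bar> = x' 0" using diag by linarith
      define \<zeta> where "\<zeta> = sgn (y' 0)"
      have \<zeta>: "\<zeta> \<in> {1, -1}" "\<zeta> * y' 0 = x' 0" using eq pos by (auto simp: \<zeta>_def sgn_if abs_if split: if_splits)
      have "continuous_on UNIV (\<lambda>\<tau>. \<zeta> * y' \<tau>)" "continuous_on UNIV (\<lambda>\<tau>. 2 * x' \<tau> - \<zeta> * y' \<tau>)"
        by (intro continuous_intros cx cy)+
      then obtain d e where d: "d > 0" "\<And>\<tau>. \<bar>\<tau>\<bar> \<le> d \<Longrightarrow> \<zeta> * y' \<tau> > 0"
        and e: "e > 0" "\<And>\<tau>. \<bar>\<tau>\<bar> \<le> e \<Longrightarrow> 2 * x' \<tau> - \<zeta> * y' \<tau> > 0"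
        using near[of "\<lambda>\<tau>. \<zeta> * y' \<tau>"] near[of "\<lambda>\<tau>. 2 * x' \<tau> - \<zeta> * y' \<tau>"] \<zeta>(2) pos by auto
      show thesis using d0 d e \<zeta>(1) by (intro that[of "min d0 (min d e)"] disjI2 bexI[of _ \<zeta>]) force+
    qed
  qed
  have xmono: "x \<tau> < x \<tau>'" if "\<bar>\<tau>\<bar> \<le> \<tau>1" "\<bar>\<tau>'\<bar> \<le> \<tau>1" "\<tau> < \<tau>'" for \<tau> \<tau>'
    by (rule increments_of_derivative[of \<tau>1 x x']) (use dx \<tau>1 that in auto)
  define a where "a = x (- \<tau>1)"
  define b where "b = x \<tau>1"
  have ab: "a < x 0" "x 0 < b" using xmono[of "- \<tau>1" 0] xmono[of 0 \<tau>1] \<tau>1(1) by (auto simp: a_def b_def)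
  have xc: "isCont x \<tau>" for \<tau> using dx DERIV_isCont by blast
  have onto: "\<exists>\<tau>. \<bar>\<tau>\<bar> \<le> \<tau>1 \<and> x \<tau> = v" if "a \<le> v" "v \<le> b" for v
    using IVT[of x "- \<tau>1" v \<tau>1] that \<tau>1(1) xc unfolding a_def b_def by (auto simp: abs_le_iff)
  define g where "g v = (SOME \<tau>. \<bar>\<tau>\<bar> \<le> \<tau>1 \<and> x \<tau> = v)" for v
  have g: "\<bar>g v\<bar> \<le> \<tau>1" "x (g v) = v" if "a \<le> v" "v \<le> b" for v
    using someI_ex[OF onto[OF that]] unfolding g_def by blast+
  have xrange: "a \<le> x \<tau> \<and> x \<tau> \<le> b" if "\<bar>\<tau>\<bar> \<le> \<tau>1" for \<tau>
    using xmono[of "-\<tau>1" \<tau>] xmono[of \<tau> \<tau>1] that \<tau>1(1) unfolding a_def b_def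
    by (cases "\<tau> = - \<tau>1"; cases "\<tau> = \<tau>1") (auto simp: abs_le_iff intro: less_imp_le)
  have gx: "g (x \<tau>) = \<tau>" if "\<bar>\<tau>\<bar> \<le> \<tau>1" for \<tau>
  proof (rule ccontr)
    assume ne: "g (x \<tau>) \<noteq> \<tau>"
    have "\<bar>g (x \<tau>)\<bar> \<le> \<tau>1" "x (g (x \<tau>)) = x \<tau>" using g[of "x \<tau>"] xrange[OF that] by auto
    then show False using xmono[of "g (x \<tau>)" \<tau>] xmono[of \<tau> "g (x \<tau>)"] ne that by (metis less_irrefl linorder_neqE_linordered_idom)
  qed
  have gint: "\<bar>g v\<bar> < \<tau>1" if "a < v" "v < b" for v
    using g[of v] that unfolding a_def b_def by (metis abs_if abs_minus_cancel dual_order.strict_iff_order less_irrefl minus_minus)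
  \<comment> \<open>Beyond the time interval the graph is continued horizontally, which preserves the bounds on
    the increments and makes them global.\<close>
  define cl where "cl u = max a (min b u)" for u
  define f where "f u = y (g (cl u))" for u
  define k where "k u = y' (g u) / x' (g u)" for u
  define R where "R = min (x 0 - a) (b - x 0)"
  have R: "R > 0" using ab by (simp add: R_def)
  have Rab: "a < u" "u < b" if "\<bar>u - x 0\<bar> < R" for u using that by (auto simp: R_def)
  have gcont: "isCont g u" if "a < u" "u < b" for u
  proof -
    have i: "\<bar>g u\<bar> < \<tau>1" by (rule gint[OF that])
    have "isCont g (x (g u))"
      by (rule isCont_inverse_function[where d = "\<tau>1 - \<bar>g u\<bar>" and f = x]) (use i gx xc in auto)
    then show ?thesis using g that by simp
  qed
  have gder: "(g has_real_derivative inverse (x' (g u))) (at u)" if "a < u" "u < b" for u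
  proof (rule DERIV_inverse_function[where f = x and a = a and b = b])
    show "x' (g u) \<noteq> 0" using \<tau>1(2)[of "g u"] g[of u] that by force
  qed (use dx that g gcont in auto)
  have fder: "(f has_real_derivative k u) (at u)" if "a < u" "u < b" for u
  proof (rule has_field_derivative_transform_within_open[where S = "{a<..<b}"])
    show "((\<lambda>u. y (g u)) has_real_derivative k u) (at u)"
      using DERIV_chain2[OF dy gder[OF that]] by (simp add: k_def divide_inverse)
  qed (use that in \<open>auto simp: f_def cl_def\<close>)
  have kcont: "isCont k u" if "a < u" "u < b" for u
  proof -
    have "x' (g u) \<noteq> 0" using \<tau>1(2)[of "g u"] g[of u] that by force
    moreover have "isCont x' v" "isCont y' v" for v using cx cy by (auto simp: continuous_on_eq_continuous_at)
    ultimately show ?thesis unfolding k_def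
      by (intro continuous_divide isCont_o2[OF gcont[OF that]]) auto
  qed
  have clm: "a \<le> cl u" "cl u \<le> b" "u \<le> v \<Longrightarrow> cl u \<le> cl v" "u \<le> v \<Longrightarrow> cl v - cl u \<le> v - u" for u v
    using ab by (auto simp: cl_def max_def min_def)
  have gmono: "g u < g v" if "a \<le> u" "u < v" "v \<le> b" for u v
  proof (rule ccontr)
    assume "\<not> g u < g v"
    then have "x (g v) \<le> x (g u)" using xmono[of "g v" "g u"] g[of u] g[of v] that by (cases "g u = g v") auto
    then show False using g[of u] g[of v] that by simp
  qed
  have mode: "shallow f \<or> (\<exists>\<zeta>\<in>{1, -1}. monotone_with_sign \<zeta> f \<and> (\<forall>u. \<bar>u - x 0\<bar> < R \<longrightarrow> 0 < \<zeta> * k u))"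
    using md
  proof
    assume A: "\<forall>\<tau>. \<bar>\<tau>\<bar> \<le> \<tau>1 \<longrightarrow> \<bar>y' \<tau>\<bar> < x' \<tau>"
    have st: "\<bar>y \<tau>' - y \<tau>\<bar> < x \<tau>' - x \<tau>" if "\<bar>\<tau>\<bar> \<le> \<tau>1" "\<bar>\<tau>'\<bar> \<le> \<tau>1" "\<tau> < \<tau>'" for \<tau> \<tau>'
    proof -
      have "x \<tau> - y \<tau> < x \<tau>' - y \<tau>'"
        by (rule increments_of_derivative[of \<tau>1 "\<lambda>\<tau>. x \<tau> - y \<tau>" "\<lambda>\<tau>. x' \<tau> - y' \<tau>"])
          (use A that in \<open>force intro!: derivative_intros dx dy\<close>)+
      moreover have "x \<tau> + y \<tau> < x \<tau>' + y \<tau>'"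
        by (rule increments_of_derivative[of \<tau>1 "\<lambda>\<tau>. x \<tau> + y \<tau>" "\<lambda>\<tau>. x' \<tau> + y' \<tau>"])
          (use A that in \<open>force intro!: derivative_intros dx dy\<close>)+
      ultimately show ?thesis by linarith
    qed
    have lt: "\<bar>f v - f u\<bar> < v - u" if "u < v" for u v
    proof (cases "cl u = cl v")
      case False
      then have c: "cl u < cl v" using clm(3)[of u v] that by simp
      have "\<bar>f v - f u\<bar> < x (g (cl v)) - x (g (cl u))"
        unfolding f_def by (rule st[OF g(1) g(1) gmono[OF _ c]]) (use clm in auto)
      also have "\<dots> = cl v - cl u" using g(2) clm by simp
      also have "\<dots> \<le> v - u" using clm(4) that by simp
      finally show ?thesis .
    qed (use that in \<open>simp add: f_def\<close>)
    have "shallow f" unfolding shallow_def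
    proof (intro allI impI)
      fix u v :: real assume "u \<noteq> v"
      then show "\<bar>f v - f u\<bar> < \<bar>v - u\<bar>" using lt[of u v] lt[of v u] by (cases "u < v") auto
    qed
    then show ?thesis ..
  next
    assume "\<exists>\<zeta>\<in>{1,-1}. \<forall>\<tau>. \<bar>\<tau>\<bar> \<le> \<tau>1 \<longrightarrow> 0 < \<zeta> * y' \<tau> \<and> \<zeta> * y' \<tau> < 2 * x' \<tau>"
    then obtain \<zeta> where z: "\<zeta> \<in> {1,-1}" "\<And>\<tau>. \<bar>\<tau>\<bar> \<le> \<tau>1 \<Longrightarrow> 0 < \<zeta> * y' \<tau>" "\<And>\<tau>. \<bar>\<tau>\<bar> \<le> \<tau>1 \<Longrightarrow> \<zeta> * y' \<tau> < 2 * x' \<tau>" by blast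
    have st: "0 < \<zeta> * (y \<tau>' - y \<tau>) \<and> \<zeta> * (y \<tau>' - y \<tau>) < 2 * (x \<tau>' - x \<tau>)" if "\<bar>\<tau>\<bar> \<le> \<tau>1" "\<bar>\<tau>'\<bar> \<le> \<tau>1" "\<tau> < \<tau>'" for \<tau> \<tau>'
    proof -
      have "\<zeta> * y \<tau> < \<zeta> * y \<tau>'"
        by (rule increments_of_derivative[of \<tau>1 "\<lambda>\<tau>. \<zeta> * y \<tau>" "\<lambda>\<tau>. \<zeta> * y' \<tau>"])
          (use z that in \<open>auto intro!: DERIV_cmult dy\<close>)
      moreover have "2 * x \<tau> - \<zeta> * y \<tau> < 2 * x \<tau>' - \<zeta> * y \<tau>'"
        by (rule increments_of_derivative[of \<tau>1 "\<lambda>\<tau>. 2 * x \<tau> - \<zeta> * y \<tau>" "\<lambda>\<tau>. 2 * x' \<tau> - \<zeta> * y' \<tau>"])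
          (use z that in \<open>auto intro!: DERIV_cmult DERIV_diff dx dy\<close>)
      ultimately show ?thesis by (simp add: algebra_simps)
    qed
    have "0 \<le> \<zeta> * (f v - f u) \<and> \<zeta> * (f v - f u) \<le> 2 * (v - u)" if "u \<le> v" for u v
    proof (cases "cl u = cl v")
      case False
      then have c: "cl u < cl v" using clm(3)[of u v] that by simp
      have "0 < \<zeta> * (f v - f u) \<and> \<zeta> * (f v - f u) < 2 * (x (g (cl v)) - x (g (cl u)))"
        unfolding f_def by (rule st[OF g(1) g(1) gmono[OF _ c]]) (use clm in auto)
      moreover have "x (g (cl v)) - x (g (cl u)) = cl v - cl u" using g(2) clm by simp
      moreover have "cl v - cl u \<le> v - u" using clm(4) that by simp
      ultimately show ?thesis by auto
    qed (use that in \<open>simp add: f_def\<close>)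
    then have "monotone_with_sign \<zeta> f" by (simp add: monotone_with_sign_def)
    moreover have "0 < \<zeta> * k u" if "\<bar>u - x 0\<bar> < R" for u
    proof -
      have gu: "\<bar>g u\<bar> \<le> \<tau>1" using g(1)[of u] Rab[OF that] by simp
      have "\<zeta> * k u = (\<zeta> * y' (g u)) / x' (g u)" by (simp add: k_def)
      then show ?thesis using z(2)[OF gu] \<tau>1(2)[OF gu] by simp
    qed
    ultimately show ?thesis using z(1) by blast
  qed
  have g0: "g (x 0) = 0" using gx[of 0] \<tau>1(1) by simp
  show thesis
  proof (rule that[of f k R \<tau>1])
    show "chart f k (x 0) R"
      by unfold_locales (use R fder kcont Rab mode in auto)
    show "\<tau>1 > 0" by (rule \<tau>1(1))
    show "f (x \<tau>) = y \<tau>" if "\<bar>\<tau>\<bar> \<le> \<tau>1" for \<tau>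
    proof -
      have "cl (x \<tau>) = x \<tau>" using xrange[OF that] by (simp add: cl_def)
      then show ?thesis using gx[OF that] by (simp add: f_def)
    qed
    show "\<exists>\<tau>. \<bar>\<tau>\<bar> \<le> \<tau>1 \<and> u = x \<tau>" if "\<bar>u - x 0\<bar> < R" for u
      using g[of u] Rab[OF that] by (intro exI[of _ "g u"]) auto
    show "k (x 0) = y' 0 / x' 0" by (simp add: k_def g0)
    have g': "(g has_real_derivative inverse (x' 0)) (at (x 0))" using gder[OF ab] by (simp add: g0)
    have X: "((\<lambda>u. x' (g u)) has_real_derivative x2 * inverse (x' 0)) (at (x 0))"
      by (rule DERIV_chain2[OF _ g']) (simp add: g0 d2)
    have Y: "((\<lambda>u. y' (g u)) has_real_derivative y2 * inverse (x' 0)) (at (x 0))"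
      by (rule DERIV_chain2[OF _ g']) (simp add: g0 d2)
    have "((\<lambda>u. y' (g u) / x' (g u)) has_real_derivative
       (y2 * inverse (x' 0) * x' (g (x 0)) - y' (g (x 0)) * (x2 * inverse (x' 0))) / (x' (g (x 0)) * x' (g (x 0)))) (at (x 0))"
      by (rule DERIV_divide[OF Y X]) (use pos in \<open>simp add: g0\<close>)
    also have "(y2 * inverse (x' 0) * x' (g (x 0)) - y' (g (x 0)) * (x2 * inverse (x' 0))) / (x' (g (x 0)) * x' (g (x 0)))
      = (y2 * x' 0 - y' 0 * x2) / (x' 0) ^ 3"
      using pos by (simp add: g0 field_simps power3_eq_cube)
    finally show "(k has_real_derivative (y2 * x' 0 - y' 0 * x2) / (x' 0) ^ 3) (at (x 0))"
      by (simp add: k_def[abs_def])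
  qed
qed

context chart
begin

text \<open>This locates the two normal directions at the base point above and below the graph.\<close>

lemma normal_side:
  assumes k1: "\<bar>k us\<bar> \<le> 1" and x': "x' > 0" and \<epsilon>: "\<epsilon> > 0"
  shows "f (us - \<epsilon> * (k us * x')) < f us + \<epsilon> * x'" "f us - \<epsilon> * x' < f (us + \<epsilon> * (k us * x'))"
proof -
  have "f (us - \<epsilon> * (k us * x')) < f us + \<epsilon> * x' \<and> f us - \<epsilon> * x' < f (us + \<epsilon> * (k us * x'))"
  proof (cases "shallow f")
    case True
    have ex: "\<epsilon> * x' > 0" using x' \<epsilon> by simp
    have "\<bar>\<epsilon> * (k us * x')\<bar> = \<bar>k us\<bar> * (\<epsilon> * x')" using x' \<epsilon> by (simp add: abs_mult)
    then have le: "\<bar>\<epsilon> * (k us * x')\<bar> \<le> \<epsilon> * x'" using k1 ex by (simp add: mult_left_le_one_le)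
    have "\<bar>f (us + v) - f us\<bar> < \<epsilon> * x'" if "\<bar>v\<bar> \<le> \<epsilon> * x'" for v
      using shallowD[OF True, of us "us + v"] that ex by (cases "v = 0") auto
    from this[of "- (\<epsilon> * (k us * x'))"] this[of "\<epsilon> * (k us * x')"] le
    have "\<bar>f (us - \<epsilon> * (k us * x')) - f us\<bar> < \<epsilon> * x'" "\<bar>f (us + \<epsilon> * (k us * x')) - f us\<bar> < \<epsilon> * x'" by simp_all
    then show ?thesis by linarith
  next
    case False
    then obtain \<zeta> where z0: "\<zeta> \<in> {1, -1}" "monotone_with_sign \<zeta> f" "\<And>u. \<bar>u - us\<bar> < R \<Longrightarrow> 0 < \<zeta> * k u"
      using mode by blast
    have z: "\<zeta> = 1 \<or> \<zeta> = -1" "monotone_with_sign \<zeta> f" "0 < \<zeta> * k us"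
      using z0(1,2) z0(3)[of us] R by auto
    define v where "v = \<epsilon> * (k us * x')"
    have ex: "\<epsilon> * x' > 0" using x' \<epsilon> by simp
    have "\<zeta> * v = (\<zeta> * k us) * (\<epsilon> * x')" by (simp add: v_def)
    then have zv: "\<zeta> * v > 0" using mult_pos_pos[OF z(3) ex] by (simp only:)
    have m: "0 \<le> \<zeta> * (f q - f p)" if "p \<le> q" for p q using z(2) that by (simp add: monotone_with_sign_def)
    have "f (us - v) \<le> f us \<and> f us \<le> f (us + v)"
      using z(1)
    proof
      assume "\<zeta> = 1"
      then show ?thesis using m[of "us - v" us] m[of us "us + v"] zv by simp
    next
      assume "\<zeta> = -1"
      then show ?thesis using m[of us "us - v"] m[of "us + v" us] zv by simp
    qed
    then show ?thesis using ex unfolding v_def by linarith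
  qed
  then show "f (us - \<epsilon> * (k us * x')) < f us + \<epsilon> * x'" "f us - \<epsilon> * x' < f (us + \<epsilon> * (k us * x'))" by auto
qed

text \<open>The strips above and below the graph are connected and do not meet \<open>K\<close>, so each lies
  in one of the two open sets; the normal directions tell in which one.\<close>

lemma sides_of_graph:
  assumes AB: "open A" "open B" "A \<inter> B = {}" "A \<union> B = - K"
    and K: "r1 > 0" "\<And>z. z \<in> K \<Longrightarrow> z \<in> ball (graph f us) r1 \<Longrightarrow> Im z = f (Re z)"
    and graph_in: "\<And>u. \<bar>u - us\<bar> < R \<Longrightarrow> graph f u \<in> K"
    and k1: "\<bar>k us\<bar> \<le> 1" and x': "x' > 0" and \<omega>: "\<omega> = 1 \<or> \<omega> = -1"
    and normal: "\<epsilon>0 > 0" "\<And>\<epsilon>::real. 0 < \<epsilon> \<Longrightarrow> \<epsilon> < \<epsilon>0 \<Longrightarrow>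
      graph f us + \<i> * of_real (\<omega> * \<epsilon>) * Complex x' (k us * x') \<in> A \<and>
      graph f us - \<i> * of_real (\<omega> * \<epsilon>) * Complex x' (k us * x') \<in> B"
  obtains R' where "R' > 0" "R' \<le> R" "R' \<le> r1"
    "\<And>z. z \<in> ball (graph f us) R' \<Longrightarrow> z \<in> A \<union> K \<longleftrightarrow> (if \<omega> = 1 then f (Re z) \<le> Im z else Im z \<le> f (Re z))"
proof -
  define \<rho> where "\<rho> = min R (r1 / 8)"
  have \<rho>: "\<rho> > 0" "\<rho> \<le> R" "8 * \<rho> \<le> r1" using R K(1) by (auto simp: \<rho>_def)
  let ?I = "{us - \<rho><..<us + \<rho>}"
  define up where "up = (\<lambda>(u, v). Complex u (f u + v)) ` (?I \<times> {0<..<4 * \<rho>})"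
  define down where "down = (\<lambda>(u, v). Complex u (f u + v)) ` (?I \<times> {- (4 * \<rho>)<..<0})"
  have ctn: "continuous_on S (\<lambda>p. Complex (fst p) (f (fst p) + snd p))" for S
  proof -
    have "continuous_on S (\<lambda>p. f (fst p))" by (rule continuous_on_compose2[OF continuous_f[of UNIV]]) (auto intro: continuous_intros)
    then show ?thesis by (intro continuous_intros)
  qed
  have con: "connected up" "connected down" unfolding up_def down_def
    by (rule connected_continuous_image, simp add: case_prod_beta ctn,
        intro connected_Times convex_connected convex_real_interval)+
  have inball: "Complex u (f u + v) \<in> ball (graph f us) r1" if "u \<in> ?I" "\<bar>v\<bar> < 4 * \<rho>" for u v
  proof -
    have "dist (graph f us) (Complex u (f u + v)) \<le> \<bar>us - u\<bar> + \<bar>f us - (f u + v)\<bar>"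
      using cmod_le[of "graph f us - Complex u (f u + v)"] by (simp add: dist_norm graph_def)
    also have "\<bar>f us - (f u + v)\<bar> \<le> \<bar>f us - f u\<bar> + \<bar>v\<bar>" by linarith
    also have "\<bar>f us - f u\<bar> \<le> 2 * \<bar>us - u\<bar>" by (rule lip)
    finally have d: "dist (graph f us) (Complex u (f u + v)) \<le> 3 * \<bar>us - u\<bar> + \<bar>v\<bar>" by simp
    have "\<bar>us - u\<bar> < \<rho>" using that(1) by auto
    moreover have "p < r1" if "p \<le> 3 * a + b" "a < \<rho>" "b < 4 * \<rho>" for p a b using that \<rho> by linarith
    ultimately show ?thesis using d that(2) by (simp only: mem_ball)
  qed
  have disj: "up \<inter> K = {}" "down \<inter> K = {}"
  proof -
    have *: "Complex u (f u + v) \<notin> K" if "u \<in> ?I" "\<bar>v\<bar> < 4 * \<rho>" "v \<noteq> 0" for u v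
      using K(2)[OF _ inball[OF that(1,2)]] that(3) by auto
    show "up \<inter> K = {}" "down \<inter> K = {}" unfolding up_def down_def using * by force+
  qed
  have whole: "S \<subseteq> P" if "connected S" "S \<inter> K = {}" "S \<inter> P \<noteq> {}" "{P, Q} = {A, B}" for S P Q
  proof -
    have PQ: "open P" "open Q" "P \<inter> Q = {}" "P \<union> Q = - K" using AB that(4) by (auto simp: doubleton_eq_iff)
    have "S \<inter> Q = {}"
      using connectedD[OF that(1) PQ(1,2)] PQ(3,4) that(2,3) by blast
    then show ?thesis using PQ(4) that(2) by blast
  qed
  define y' where "y' = k us * x'"
  have small: "\<exists>\<epsilon>. 0 < \<epsilon> \<and> \<epsilon> < \<epsilon>0 \<and> \<epsilon> * (\<bar>y'\<bar> + x') < \<rho>"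
  proof -
    have p: "\<bar>y'\<bar> + x' > 0" using x' by simp
    define \<epsilon> where "\<epsilon> = min (\<epsilon>0 / 2) (\<rho> / (2 * (\<bar>y'\<bar> + x')))"
    have "\<epsilon> * (\<bar>y'\<bar> + x') \<le> \<rho> / (2 * (\<bar>y'\<bar> + x')) * (\<bar>y'\<bar> + x')" using p by (intro mult_right_mono) (auto simp: \<epsilon>_def)
    also have "\<dots> = \<rho> / 2"
    proof -
      have "\<rho> / (2 * w) * w = \<rho> / 2" if "w > 0" for w using that by simp
      then show ?thesis using p by blast
    qed
    finally show ?thesis using p \<rho> normal(1) by (intro exI[of _ \<epsilon>]) (auto simp: \<epsilon>_def)
  qed
  then obtain \<epsilon> where \<epsilon>: "0 < \<epsilon>" "\<epsilon> < \<epsilon>0" "\<epsilon> * (\<bar>y'\<bar> + x') < \<rho>" by blast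
  have ey: "\<epsilon> * \<bar>y'\<bar> < \<rho>" "\<epsilon> * x' < \<rho>"
  proof -
    have "\<epsilon> * \<bar>y'\<bar> + \<epsilon> * x' < \<rho>" using \<epsilon>(3) by (simp add: distrib_left)
    moreover have "\<epsilon> * \<bar>y'\<bar> \<ge> 0" "\<epsilon> * x' \<ge> 0" using \<epsilon>(1) x' by auto
    ultimately show "\<epsilon> * \<bar>y'\<bar> < \<rho>" "\<epsilon> * x' < \<rho>" by linarith+
  qed
  then have ey': "\<bar>\<epsilon> * y'\<bar> < \<rho>" using \<epsilon>(1) by (simp add: abs_mult)
  define zp where "zp = graph f us + \<i> * of_real \<epsilon> * Complex x' y'"
  define zm where "zm = graph f us - \<i> * of_real \<epsilon> * Complex x' y'"
  have zc: "zp = Complex (us - \<epsilon> * y') (f us + \<epsilon> * x')" "zm = Complex (us + \<epsilon> * y') (f us - \<epsilon> * x')"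
    by (simp_all add: zp_def zm_def graph_def complex_eq_iff)
  have "zp \<in> up"
  proof -
    define v where "v = f us + \<epsilon> * x' - f (us - \<epsilon> * y')"
    have "v > 0" using normal_side(1)[OF k1 x' \<epsilon>(1)] by (simp add: v_def y'_def)
    moreover have "v < 4 * \<rho>"
    proof -
      have "\<bar>f (us - \<epsilon> * y') - f us\<bar> \<le> 2 * \<bar>\<epsilon> * y'\<bar>" using lip[of "us - \<epsilon> * y'" us] by simp
      then show ?thesis using ey' ey unfolding v_def by linarith
    qed
    ultimately show ?thesis unfolding up_def zc using ey'
      by (intro image_eqI[of _ _ "(us - \<epsilon> * y', v)"]) (auto simp: v_def)
  qed
  have "zm \<in> down"
  proof -
    define v where "v = f us - \<epsilon> * x' - f (us + \<epsilon> * y')"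
    have "v < 0" using normal_side(2)[OF k1 x' \<epsilon>(1)] by (simp add: v_def y'_def)
    moreover have "- (4 * \<rho>) < v"
    proof -
      have "\<bar>f (us + \<epsilon> * y') - f us\<bar> \<le> 2 * \<bar>\<epsilon> * y'\<bar>" using lip[of "us + \<epsilon> * y'" us] by simp
      then show ?thesis using ey' ey unfolding v_def by linarith
    qed
    ultimately show ?thesis unfolding down_def zc using ey'
      by (intro image_eqI[of _ _ "(us + \<epsilon> * y', v)"]) (auto simp: v_def)
  qed
  have sides: "(if \<omega> = 1 then up \<subseteq> A \<and> down \<subseteq> B else up \<subseteq> B \<and> down \<subseteq> A)"
  proof (cases "\<omega> = 1")
    case True
    then have "zp \<in> A" "zm \<in> B" using normal(2)[OF \<epsilon>(1,2)] by (auto simp: zp_def zm_def y'_def)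
    then show ?thesis using True whole[OF con(1) disj(1), of A B] whole[OF con(2) disj(2), of B A]
        \<open>zp \<in> up\<close> \<open>zm \<in> down\<close> by auto
  next
    case False
    then have "\<omega> = - 1" using \<omega> by simp
    then have "zm \<in> A" "zp \<in> B" using normal(2)[OF \<epsilon>(1,2)] by (auto simp: zp_def zm_def y'_def)
    then show ?thesis using False whole[OF con(1) disj(1), of B A] whole[OF con(2) disj(2), of A B]
        \<open>zp \<in> up\<close> \<open>zm \<in> down\<close> by auto
  qed
  show thesis
  proof (rule that[of \<rho>])
    show "\<rho> > 0" "\<rho> \<le> R" "\<rho> \<le> r1" using \<rho> by auto
    fix z assume z: "z \<in> ball (graph f us) \<rho>"
    define v where "v = Im z - f (Re z)"
    have re: "\<bar>Re z - us\<bar> < \<rho>" "\<bar>Im z - f us\<bar> < \<rho>"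
      using z abs_Re_le_cmod[of "z - graph f us"] abs_Im_le_cmod[of "z - graph f us"]
      by (auto simp: dist_norm norm_minus_commute graph_def)
    have zv: "z = Complex (Re z) (f (Re z) + v)" by (simp add: v_def)
    have I: "Re z \<in> ?I" using re(1) by auto
    have "\<bar>f (Re z) - f us\<bar> < 2 * \<rho>"
      by (rule order.strict_trans1[OF lip]) (use re(1) in simp)
    then have v4: "\<bar>v\<bar> < 4 * \<rho>" using re unfolding v_def by linarith
    consider "v = 0" | "v > 0" | "v < 0" by linarith
    then show "z \<in> A \<union> K \<longleftrightarrow> (if \<omega> = 1 then f (Re z) \<le> Im z else Im z \<le> f (Re z))"
    proof cases
      case 1
      then have "z = graph f (Re z)" by (simp add: v_def graph_def complex_eq_iff)
      moreover have "graph f (Re z) \<in> K" using graph_in re(1) \<rho>(2) by simp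
      ultimately show ?thesis using 1 by (auto simp: v_def)
    next
      case 2
      then have "z \<in> up" unfolding up_def using zv I v4 by (intro image_eqI[of _ _ "(Re z, v)"]) auto
      then show ?thesis using 2 sides AB disj unfolding v_def by (cases "\<omega> = 1") auto
    next
      case 3
      then have "z \<in> down" unfolding down_def using zv I v4 by (intro image_eqI[of _ _ "(Re z, v)"]) auto
      then show ?thesis using 3 sides AB disj unfolding v_def by (cases "\<omega> = 1") auto
    qed
  qed
qed

lemma circle_meets_graph:
  assumes "r > 0"
  shows "{z \<in> sphere (graph f us) r. Im z = f (Re z)} = {graph f (endpoint (-1) r), graph f (endpoint 1 r)}"
    and "graph f (endpoint (-1) r) \<noteq> graph f (endpoint 1 r)"
proof -
  have p1: "(1::real) = 1 \<or> (1::real) = -1" and m1: "(-1::real) = 1 \<or> (-1::real) = -1" by auto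
  note R = endpoint[OF p1 assms] and L = endpoint[OF m1 assms]
  have "z \<in> {graph f (endpoint (-1) r), graph f (endpoint 1 r)}" if z: "z \<in> sphere (graph f us) r" "Im z = f (Re z)" for z
  proof -
    have zg: "z = graph f (Re z)" using z(2) by (simp add: graph_def complex_eq_iff)
    then have "dist (graph f (Re z)) (graph f us) = r" using z(1) by (simp add: dist_commute)
    then have "Re z = endpoint 1 r \<or> Re z = endpoint (-1) r"
      using R(4)[of "Re z"] L(4)[of "Re z"] by (cases "us \<le> Re z") auto
    then show ?thesis using zg by auto
  qed
  then show "{z \<in> sphere (graph f us) r. Im z = f (Re z)} = {graph f (endpoint (-1) r), graph f (endpoint 1 r)}"
    using R(2) L(2) by (auto simp: dist_commute graph_def)
  show "graph f (endpoint (-1) r) \<noteq> graph f (endpoint 1 r)"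
    using R(1) L(1) by (auto simp: graph_def)
qed

end

text \<open>The sets \<open>A\<close> and \<open>B\<close> stand for the inside and the outside of the Jordan curve \<open>K\<close>. Only their
  topological separation and the position of the normals are used, so that the statement can be
  applied to a reflected curve as well.\<close>

lemma drift_in_graph_coordinates:
  fixes x y x' y' :: "real \<Rightarrow> real" and K :: "complex set"
  assumes dx: "\<And>\<tau>. (x has_real_derivative x' \<tau>) (at \<tau>)" and dy: "\<And>\<tau>. (y has_real_derivative y' \<tau>) (at \<tau>)"
    and cx: "continuous_on UNIV x'" and cy: "continuous_on UNIV y'"
    and d2: "(x' has_real_derivative x2) (at 0)" "(y' has_real_derivative y2) (at 0)"
    and pos: "x' 0 > 0" and diag: "\<bar>y' 0\<bar> \<le> x' 0"
    and AB: "open A" "open B" "A \<inter> B = {}" "A \<union> B = - K"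
    and curve: "\<And>\<tau>. Complex (x \<tau>) (y \<tau>) \<in> K"
    and isolated: "\<And>\<tau>1. \<tau>1 > 0 \<Longrightarrow> \<exists>r1>0. \<forall>z\<in>K \<inter> ball (Complex (x 0) (y 0)) r1. \<exists>\<tau>. \<bar>\<tau>\<bar> \<le> \<tau>1 \<and> z = Complex (x \<tau>) (y \<tau>)"
    and \<omega>: "\<omega> = 1 \<or> \<omega> = -1"
    and normal: "\<epsilon>0 > 0" "\<And>\<epsilon>::real. 0 < \<epsilon> \<Longrightarrow> \<epsilon> < \<epsilon>0 \<Longrightarrow>
      Complex (x 0) (y 0) + \<i> * of_real (\<omega> * \<epsilon>) * Complex (x' 0) (y' 0) \<in> A \<and>
      Complex (x 0) (y 0) - \<i> * of_real (\<omega> * \<epsilon>) * Complex (x' 0) (y' 0) \<in> B"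
  defines "s \<equiv> Complex (x 0) (y 0)" and "n \<equiv> (x' 0)\<^sup>2 + (y' 0)\<^sup>2"
  obtains G where
    "\<forall>\<^sub>F r in at_right 0. \<exists>p q. p \<noteq> q \<and> sphere s r \<inter> K = {p, q} \<and> has_drift_limit (A \<union> K) s r p q (G r)"
    "((\<lambda>r. G r / (2 * r)) \<longlongrightarrow>
       - (\<omega> / 2) * (((x' 0)\<^sup>2 - (y' 0)\<^sup>2) / n) * ((x' 0 * y2 - x2 * y' 0) / n powr (3/2))) (at_right 0)"
proof -
  obtain f k R \<tau>1 where ch: "chart f k (x 0) R" and \<tau>1: "\<tau>1 > 0"
    and fx: "\<And>\<tau>. \<bar>\<tau>\<bar> \<le> \<tau>1 \<Longrightarrow> f (x \<tau>) = y \<tau>"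
    and onto: "\<And>u. \<bar>u - x 0\<bar> < R \<Longrightarrow> \<exists>\<tau>. \<bar>\<tau>\<bar> \<le> \<tau>1 \<and> u = x \<tau>"
    and k0: "k (x 0) = y' 0 / x' 0"
    and k2: "(k has_real_derivative (y2 * x' 0 - y' 0 * x2) / (x' 0) ^ 3) (at (x 0))"
    using chart_exists[OF dx dy cx cy d2 pos diag] by blast
  interpret chart f k "x 0" R by (rule ch)
  have s: "s = graph f (x 0)" using fx[of 0] \<tau>1 by (simp add: s_def graph_def)
  have k1: "\<bar>k (x 0)\<bar> \<le> 1" using pos diag by (simp add: k0 abs_divide)
  have kx: "k (x 0) * x' 0 = y' 0" using pos by (simp add: k0)
  obtain r1 where r1: "r1 > 0" "\<And>z. z \<in> K \<Longrightarrow> z \<in> ball s r1 \<Longrightarrow> \<exists>\<tau>. \<bar>\<tau>\<bar> \<le> \<tau>1 \<and> z = Complex (x \<tau>) (y \<tau>)"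
    using isolated[OF \<tau>1] unfolding s_def by blast
  have Kg: "Im z = f (Re z)" if "z \<in> K" "z \<in> ball s r1" for z
    using r1(2)[OF that] fx by auto
  have gK: "graph f u \<in> K" if "\<bar>u - x 0\<bar> < R" for u
    using onto[OF that] fx curve by (auto simp: graph_def)
  obtain R' where R': "R' > 0" "R' \<le> R" "R' \<le> r1"
    "\<And>z. z \<in> ball s R' \<Longrightarrow> z \<in> A \<union> K \<longleftrightarrow> (if \<omega> = 1 then f (Re z) \<le> Im z else Im z \<le> f (Re z))"
  proof (rule sides_of_graph[OF AB r1(1) _ gK k1 pos \<omega> normal(1)])
    show "Im z = f (Re z)" if "z \<in> K" "z \<in> ball (graph f (x 0)) r1" for z using Kg that by (simp add: s)
    show "graph f (x 0) + \<i> * of_real (\<omega> * \<epsilon>) * Complex (x' 0) (k (x 0) * x' 0) \<in> A \<and>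
      graph f (x 0) - \<i> * of_real (\<omega> * \<epsilon>) * Complex (x' 0) (k (x 0) * x' 0) \<in> B"
      if "0 < \<epsilon>" "\<epsilon> < \<epsilon>0" for \<epsilon>
      using normal(2)[OF that] unfolding kx s[symmetric] s_def .
  qed (use that s in auto)
  define G where "G r = (- \<omega> / 2) * (tilt (k (endpoint 1 r)) - tilt (k (endpoint (-1) r)))" for r
  show thesis
  proof (rule that[of G])
    have "\<forall>\<^sub>F r in at_right 0. 0 < r \<and> r < R'"
      using R'(1) by (auto simp: eventually_at_right_field intro!: exI[of _ R'])
    then show "\<forall>\<^sub>F r in at_right 0. \<exists>p q. p \<noteq> q \<and> sphere s r \<inter> K = {p, q} \<and> has_drift_limit (A \<union> K) s r p q (G r)"
    proof eventually_elim
      case (elim r)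
      define p where "p = graph f (endpoint (-1) r)"
      define q where "q = graph f (endpoint 1 r)"
      have r: "0 < r" "r < R" "r < R'" "r < r1" using elim R' by auto
      note circ = circle_meets_graph[OF r(1), folded p_def q_def s]
      have "p \<in> K" "q \<in> K"
        unfolding p_def q_def using endpoint(3)[of 1 r] endpoint(3)[of "-1" r] r by (auto intro!: gK)
      moreover have "p \<in> sphere s r" "q \<in> sphere s r" using circ(1) by blast+
      moreover have "z \<in> {p, q}" if "z \<in> sphere s r" "z \<in> K" for z
        using circ(1) Kg[OF that(2)] that(1) r(4) by auto
      ultimately have "sphere s r \<inter> K = {p, q}" by blast
      moreover have "has_drift_limit (A \<union> K) s r p q (G r)"
        unfolding G_def s by (rule local_drift[OF \<omega> R'(4)[unfolded s] r(1-3)]) (auto simp: p_def q_def)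
      ultimately show ?case using circ(2) by blast
    qed
    have n: "n > 0" using pos by (simp add: n_def add_pos_nonneg)
    have "n powr (3/2) = n powr (1 + 1/2)" by simp
    also have "\<dots> = n powr 1 * n powr (1/2)" by (rule powr_add)
    also have "\<dots> = n * sqrt n" using n by (simp add: powr_half_sqrt)
    finally have npow: "n powr (3/2) = n * sqrt n" .
    have q1: "1 + (k (x 0))\<^sup>2 = n / (x' 0)\<^sup>2" using pos by (simp add: k0 n_def power_divide field_simps)
    have q2: "sqrt (1 + (k (x 0))\<^sup>2) = sqrt n / x' 0" using pos by (simp add: q1 real_sqrt_divide)
    have q3: "1 - (k (x 0))\<^sup>2 = ((x' 0)\<^sup>2 - (y' 0)\<^sup>2) / (x' 0)\<^sup>2" using pos by (simp add: k0 power_divide field_simps)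
    have "(1 - (k (x 0))\<^sup>2) / (1 + (k (x 0))\<^sup>2)\<^sup>2 * ((y2 * x' 0 - y' 0 * x2) / (x' 0) ^ 3) / sqrt (1 + (k (x 0))\<^sup>2)
      = (((x' 0)\<^sup>2 - (y' 0)\<^sup>2) / n) * ((x' 0 * y2 - x2 * y' 0) / n powr (3/2))"
    proof -
      have alg: "(d / a\<^sup>2) / (n / a\<^sup>2)\<^sup>2 * (b / a ^ 3) / (w / a) = (d / n) * (b / (n * w))"
        if "a > 0" "w > 0" for a b d w :: real
        using that n by (simp add: field_simps power2_eq_square power3_eq_cube)
      show ?thesis unfolding q1[symmetric] q2 q3 npow unfolding q1
        using alg[of "x' 0" "sqrt n" "(x' 0)\<^sup>2 - (y' 0)\<^sup>2" "y2 * x' 0 - y' 0 * x2"] pos n by (simp add: mult.commute)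
    qed
    moreover have "((\<lambda>r. G r / (2 * r)) \<longlongrightarrow> (- \<omega> / 2) * ((1 - (k (x 0))\<^sup>2) / (1 + (k (x 0))\<^sup>2)\<^sup>2 *
        ((y2 * x' 0 - y' 0 * x2) / (x' 0) ^ 3) / sqrt (1 + (k (x 0))\<^sup>2))) (at_right 0)"
      unfolding G_def by (rule local_drift_over_radius[OF k2 k1])
    ultimately show "((\<lambda>r. G r / (2 * r)) \<longlongrightarrow>
       - (\<omega> / 2) * (((x' 0)\<^sup>2 - (y' 0)\<^sup>2) / n) * ((x' 0 * y2 - x2 * y' 0) / n powr (3/2))) (at_right 0)"
      by (simp only: minus_divide_left mult.assoc)
  qed
qed

section \<open>The inside of a Jordan curve lies on its left\<close>

locale jordan_C2 =
  fixes \<gamma> :: "real \<Rightarrow> complex"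
  assumes curve: "C2_jordan_curve \<gamma>"
begin

definition "velocity t = vector_derivative \<gamma> (at t)"
definition "acceleration t = vector_derivative (\<lambda>u. vector_derivative \<gamma> (at u)) (at t)"

lemma regularity:
  shows "(\<gamma> has_vector_derivative velocity t) (at t)" "continuous_on UNIV velocity"
    "(velocity has_vector_derivative acceleration t) (at t)" "velocity t \<noteq> 0"
proof -
  have C: "\<gamma> C1_differentiable_on UNIV" "(\<lambda>t. vector_derivative \<gamma> (at t)) C1_differentiable_on UNIV"
    "vector_derivative \<gamma> (at t) \<noteq> 0"
    using curve by (auto simp: C2_jordan_curve_def)
  show "(\<gamma> has_vector_derivative velocity t) (at t)" "continuous_on UNIV velocity"
    using C(1) unfolding C1_differentiable_on_eq velocity_def[abs_def] by (auto simp: vector_derivative_works)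
  show "(velocity has_vector_derivative acceleration t) (at t)"
    using C(2) unfolding C1_differentiable_on_eq velocity_def[abs_def] acceleration_def by (auto simp: vector_derivative_works)
  show "velocity t \<noteq> 0" using C(3) by (simp add: velocity_def)
qed

lemma continuous: "continuous_on A \<gamma>"
  using regularity(1) by (meson continuous_at_imp_continuous_on has_vector_derivative_continuous)

lemma periodic: "\<gamma> (t + of_int n) = \<gamma> t"
proof (induction n rule: int_induct[where k = 0])
  case (step1 i)
  have "\<gamma> (t + of_int i + 1) = \<gamma> (t + of_int i)" using curve by (simp add: C2_jordan_curve_def)
  then show ?case using step1 by (simp add: add.assoc)
next
  case (step2 i)
  have "\<gamma> (t + of_int (i - 1) + 1) = \<gamma> (t + of_int (i - 1))" using curve unfolding C2_jordan_curve_def by blast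
  moreover have "t + of_int (i - 1) + 1 = t + of_int i" by simp
  ultimately show ?case using step2 by (simp only:)
qed simp

lemma path_image_eq_range: "path_image \<gamma> = range \<gamma>"
proof -
  have "\<gamma> t \<in> \<gamma> ` {0..1}" for t
  proof (rule image_eqI)
    show "\<gamma> t = \<gamma> (frac t)" using periodic[of "frac t" "\<lfloor>t\<rfloor>"] by (simp add: frac_def)
    show "frac t \<in> {0..1}" using frac_lt_1[of t] by (simp add: less_imp_le)
  qed
  then show ?thesis by (auto simp: path_image_def)
qed

lemma injective:
  assumes "\<gamma> a = \<gamma> b" "\<bar>a - b\<bar> < 1"
  shows "a = b"
proof -
  have "\<gamma> (frac a) = \<gamma> (frac b)"
    using assms(1) periodic[of "frac a" "\<lfloor>a\<rfloor>"] periodic[of "frac b" "\<lfloor>b\<rfloor>"] by (simp add: frac_def)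
  moreover have "loop_free \<gamma>" using curve by (simp add: C2_jordan_curve_def simple_path_def)
  moreover have "frac a \<in> {0..1}" "frac b \<in> {0..1}" "frac a \<noteq> 1" "frac b \<noteq> 1"
    using frac_lt_1[of a] frac_lt_1[of b] by auto
  ultimately have "frac a = frac b" unfolding loop_free_def by blast
  then have "a - b = of_int (\<lfloor>a\<rfloor> - \<lfloor>b\<rfloor>)" by (simp add: frac_def)
  moreover from this have "\<lfloor>a\<rfloor> - \<lfloor>b\<rfloor> = 0" using assms(2) by linarith
  ultimately show ?thesis by simp
qed

lemma path: "path \<gamma>" "pathfinish \<gamma> = pathstart \<gamma>" "bounded (path_image \<gamma>)" "closed (path_image \<gamma>)"
proof -
  show p: "path \<gamma>" unfolding path_def by (rule continuous)
  show "pathfinish \<gamma> = pathstart \<gamma>" using periodic[of 0 1] by (simp add: pathfinish_def pathstart_def)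
  show "bounded (path_image \<gamma>)" "closed (path_image \<gamma>)"
    using p by (auto simp: bounded_path_image closed_path_image)
qed

text \<open>Starting at another time, one may assume that a given point of the curve is not an end point of the
  parameter interval.\<close>

lemma shifted_path:
  defines "\<eta> a \<equiv> (\<lambda>u. \<gamma> (a + u))"
  shows "path_image (\<eta> a) = path_image \<gamma>" "valid_path (\<eta> a)"
    "z \<notin> path_image \<gamma> \<Longrightarrow> winding_number (\<eta> a) z = winding_number \<gamma> z"
    "vector_derivative (\<eta> a) (at u) = velocity (a + u)"
proof -
  define b where "b = frac a"
  have b: "b \<in> {0..1}" using frac_lt_1[of a] by (simp add: b_def less_imp_le)
  have ab: "\<gamma> (a + u) = \<gamma> (b + u)" for u
    using periodic[of "b + u" "\<lfloor>a\<rfloor>"] by (simp add: b_def frac_def add.commute)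
  have sh: "shiftpath b \<gamma> u = \<eta> a u" for u
    using ab[of u] periodic[of "b + u" "-1"] by (simp add: \<eta>_def shiftpath_def algebra_simps)
  have "path_image (shiftpath b \<gamma>) = path_image \<gamma>" using path(2) b by (intro path_image_shiftpath) auto
  then show "path_image (\<eta> a) = path_image \<gamma>" unfolding sh[abs_def] by simp
  have der: "((\<eta> a) has_vector_derivative velocity (a + u)) (at u)" for u
  proof -
    have "(\<gamma> \<circ> (\<lambda>u. a + u) has_vector_derivative 1 *\<^sub>R velocity (a + u)) (at u)"
      by (rule vector_diff_chain_at) (auto intro!: derivative_eq_intros regularity(1))
    then show ?thesis by (simp add: \<eta>_def o_def)
  qed
  then show vd: "vector_derivative (\<eta> a) (at u) = velocity (a + u)" for u by (rule vector_derivative_at)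
  have "continuous_on UNIV (velocity \<circ> (\<lambda>u. a + u))"
    by (intro continuous_on_compose continuous_intros continuous_on_subset[OF regularity(2)]) auto
  then have "(\<eta> a) C1_differentiable_on {0..1}"
    unfolding C1_differentiable_on_eq vd using der
    by (auto intro: continuous_on_subset differentiableI_vector simp: o_def)
  then show "valid_path (\<eta> a)" unfolding valid_path_def by (rule C1_differentiable_imp_piecewise)
  assume "z \<notin> path_image \<gamma>"
  then have "winding_number (shiftpath b \<gamma>) z = winding_number \<gamma> z" using path b by (intro winding_number_shiftpath)
  then show "winding_number (\<eta> a) z = winding_number \<gamma> z" unfolding sh[abs_def] by simp
qed

lemma winding_number_cases:
  assumes "z \<notin> path_image \<gamma>"
  obtains "z \<in> inside (path_image \<gamma>)" "winding_number \<gamma> z = 1" | "z \<in> outside (path_image \<gamma>)" "winding_number \<gamma> z = 0"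
proof -
  have "z \<in> inside (path_image \<gamma>) \<or> z \<in> outside (path_image \<gamma>)" using assms inside_Un_outside by blast
  then show thesis
  proof
    assume "z \<in> inside (path_image \<gamma>)"
    then show thesis using that(1) curve by (auto simp: C2_jordan_curve_def)
  next
    assume "z \<in> outside (path_image \<gamma>)"
    then show thesis using that(2) winding_number_zero_in_outside[OF path(1,2)] by auto
  qed
qed

lemma near_point:
  obtains \<tau>1 where "0 < \<tau>1" "\<tau>1 < 1/2"
    "\<And>\<tau>. \<bar>\<tau>\<bar> \<le> \<tau>1 \<Longrightarrow> cmod ((\<gamma> (t + \<tau>) - \<gamma> t) / velocity t - \<tau>) \<le> \<bar>\<tau>\<bar> / 10"
    "\<And>\<tau>. \<bar>\<tau>\<bar> \<le> \<tau>1 \<Longrightarrow> cmod (velocity (t + \<tau>) / velocity t - 1) \<le> 1 / 10"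
proof -
  define d where "d = velocity t"
  have d: "cmod d > 0" using regularity(4)[of t] by (simp add: d_def)
  have "(\<gamma> has_derivative (\<lambda>h. h *\<^sub>R d)) (at t)" using regularity(1)[of t] by (simp add: has_vector_derivative_def d_def)
  then obtain e1 where e1: "e1 > 0" "\<And>y. \<bar>y - t\<bar> < e1 \<Longrightarrow> cmod (\<gamma> y - \<gamma> t - (y - t) *\<^sub>R d) \<le> (cmod d / 10) * \<bar>y - t\<bar>"
    unfolding has_derivative_at_alt using d by (metis real_norm_def zero_less_divide_iff zero_less_numeral)
  have "isCont velocity t" using regularity(2) by (simp add: continuous_on_eq_continuous_at)
  then obtain e2 where e2: "e2 > 0" "\<And>y. dist y t < e2 \<Longrightarrow> dist (velocity y) (velocity t) < cmod d / 10"
    unfolding continuous_at_eps_delta using d by (metis zero_less_divide_iff zero_less_numeral)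
  define \<tau>1 where "\<tau>1 = min (1/4) (min (e1 / 2) (e2 / 2))"
  have \<tau>1: "0 < \<tau>1" "\<tau>1 < 1/2" "\<tau>1 < e1" "\<tau>1 < e2" using e1(1) e2(1) by (auto simp: \<tau>1_def)
  show thesis
  proof (rule that[of \<tau>1])
    fix \<tau> assume \<tau>: "\<bar>\<tau>\<bar> \<le> \<tau>1"
    have "(\<gamma> (t + \<tau>) - \<gamma> t) / d - \<tau> = (\<gamma> (t + \<tau>) - \<gamma> t - \<tau> *\<^sub>R d) / d"
      using d by (simp add: field_simps scaleR_conv_of_real)
    then have "cmod ((\<gamma> (t + \<tau>) - \<gamma> t) / d - \<tau>) = cmod (\<gamma> (t + \<tau>) - \<gamma> t - \<tau> *\<^sub>R d) / cmod d"
      by (simp add: norm_divide)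
    also have "\<dots> \<le> ((cmod d / 10) * \<bar>\<tau>\<bar>) / cmod d"
      using e1(2)[of "t + \<tau>"] \<tau> \<tau>1 by (intro divide_right_mono) auto
    finally show "cmod ((\<gamma> (t + \<tau>) - \<gamma> t) / velocity t - \<tau>) \<le> \<bar>\<tau>\<bar> / 10" using d by (simp add: d_def)
    have "velocity (t + \<tau>) / d - 1 = (velocity (t + \<tau>) - d) / d" using d by (simp add: diff_divide_distrib)
    then have "cmod (velocity (t + \<tau>) / d - 1) = cmod (velocity (t + \<tau>) - d) / cmod d" by (simp add: norm_divide)
    also have "\<dots> \<le> (cmod d / 10) / cmod d"
      using e2(2)[of "t + \<tau>"] \<tau> \<tau>1 by (intro divide_right_mono) (auto simp: dist_norm d_def)
    finally show "cmod (velocity (t + \<tau>) / velocity t - 1) \<le> 1 / 10" using d by (simp add: d_def)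
  qed (use \<tau>1 in auto)
qed

text \<open>For \<open>q = \<tau>\<close> and \<open>p = 1\<close> this is the Poisson kernel up to a factor, and
  relative errors of one tenth change it by less than a factor of two.\<close>

lemma kernel_bound:
  fixes p q :: complex and \<tau> \<epsilon> :: real
  assumes q: "cmod (q - \<tau>) \<le> \<bar>\<tau>\<bar> / 10" and p: "cmod (p - 1) \<le> 1 / 10" and \<epsilon>: "\<epsilon> > 0"
  shows "q\<^sup>2 + (complex_of_real \<epsilon>)\<^sup>2 \<noteq> 0" "Re (p / (q\<^sup>2 + (complex_of_real \<epsilon>)\<^sup>2)) \<ge> (1/2) / (\<tau>\<^sup>2 + \<epsilon>\<^sup>2)"
proof -
  define T where "T = \<tau>\<^sup>2 + \<epsilon>\<^sup>2"
  have T: "T > 0" using \<epsilon> by (simp add: T_def add_nonneg_pos)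
  define Y where "Y = (q\<^sup>2 + (complex_of_real \<epsilon>)\<^sup>2) / T"
  have "cmod (q + \<tau>) \<le> cmod (q - \<tau>) + cmod (2 * complex_of_real \<tau>)"
    using norm_triangle_ineq[of "q - \<tau>" "2 * complex_of_real \<tau>"] by (simp add: add.commute)
  then have q2: "cmod (q + \<tau>) \<le> (21/10) * \<bar>\<tau>\<bar>" using q by (simp add: norm_mult)
  have "Y - 1 = (q\<^sup>2 + (complex_of_real \<epsilon>)\<^sup>2 - T) / T" using T by (simp add: Y_def diff_divide_distrib)
  also have "q\<^sup>2 + (complex_of_real \<epsilon>)\<^sup>2 - T = (q - \<tau>) * (q + \<tau>)"
    by (simp add: T_def power2_eq_square algebra_simps)
  finally have "cmod (Y - 1) = cmod (q - \<tau>) * cmod (q + \<tau>) / T" using T by (simp add: norm_divide norm_mult)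
  also have "\<dots> \<le> (\<bar>\<tau>\<bar> / 10) * ((21/10) * \<bar>\<tau>\<bar>) / T"
    using q q2 T by (intro divide_right_mono mult_mono) auto
  also have "\<dots> = (21/100) * \<tau>\<^sup>2 / T" by (simp add: power2_eq_square)
  also have "\<dots> \<le> (21/100) * T / T" using T by (intro divide_right_mono mult_left_mono) (auto simp: T_def)
  finally have Y1: "cmod (Y - 1) \<le> 21/100" using T by simp
  then have Yn: "cmod Y \<ge> 79/100" using norm_triangle_ineq2[of 1 "1 - Y"] by (simp add: norm_minus_commute)
  then have Y0: "Y \<noteq> 0" by auto
  then show "q\<^sup>2 + (complex_of_real \<epsilon>)\<^sup>2 \<noteq> 0" by (auto simp: Y_def)
  have "cmod (p - Y) \<le> cmod (p - 1) + cmod (1 - Y)" using norm_triangle_ineq[of "p - 1" "1 - Y"] by simp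
  then have pY: "cmod (p - Y) \<le> 31/100" using p Y1 by (simp add: norm_minus_commute)
  have "p / Y - 1 = (p - Y) / Y" using Y0 by (simp add: diff_divide_distrib)
  then have "cmod (p / Y - 1) = cmod (p - Y) / cmod Y" by (simp add: norm_divide)
  also have "\<dots> \<le> (31/100) / (79/100)" using pY Yn by (intro frac_le) auto
  finally have "cmod (p / Y - 1) \<le> 1/2" by simp
  then have "Re (p / Y) \<ge> 1/2" using abs_Re_le_cmod[of "p / Y - 1"] by simp
  moreover have "Re (p / (q\<^sup>2 + (complex_of_real \<epsilon>)\<^sup>2)) = Re (p / Y) / T"
  proof -
    have "q\<^sup>2 + (complex_of_real \<epsilon>)\<^sup>2 = Y * T" using T by (simp add: Y_def)
    then have "p / (q\<^sup>2 + (complex_of_real \<epsilon>)\<^sup>2) = (p / Y) / of_real T" by simp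
    then show ?thesis by (simp only: Re_divide_of_real)
  qed
  ultimately show "Re (p / (q\<^sup>2 + (complex_of_real \<epsilon>)\<^sup>2)) \<ge> (1/2) / (\<tau>\<^sup>2 + \<epsilon>\<^sup>2)"
    unfolding T_def[symmetric] using T by (metis divide_right_mono less_imp_le)
qed

text \<open>The winding numbers at the two points \<open>\<gamma> t \<plusminus> \<i> * \<epsilon> * velocity t\<close> differ by
  \<open>1 / (2 * pi)\<close> times the integral of a kernel that is concentrated at \<open>t\<close>. Its real part is positive near \<open>t\<close>
  and of order \<open>\<epsilon>\<close> elsewhere, so the difference is positive. As the winding numbers are 0 and 1, the
  left point is inside and the right one outside.\<close>

lemma left_side_inside:
  obtains \<epsilon>0 where "\<epsilon>0 > 0"
    "\<And>\<epsilon>::real. 0 < \<epsilon> \<Longrightarrow> \<epsilon> < \<epsilon>0 \<Longrightarrow>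
      \<gamma> t + \<i> * complex_of_real \<epsilon> * velocity t \<in> inside (path_image \<gamma>) \<and>
      \<gamma> t - \<i> * complex_of_real \<epsilon> * velocity t \<in> outside (path_image \<gamma>)"
proof -
  define d where "d = velocity t"
  have d: "d \<noteq> 0" using regularity(4) by (simp add: d_def)
  define q where "q \<tau> = (\<gamma> (t + \<tau>) - \<gamma> t) / d" for \<tau>
  define p where "p \<tau> = velocity (t + \<tau>) / d" for \<tau>
  obtain \<tau>1 where \<tau>1: "0 < \<tau>1" "\<tau>1 < 1/2"
    "\<And>\<tau>. \<bar>\<tau>\<bar> \<le> \<tau>1 \<Longrightarrow> cmod (q \<tau> - \<tau>) \<le> \<bar>\<tau>\<bar> / 10" "\<And>\<tau>. \<bar>\<tau>\<bar> \<le> \<tau>1 \<Longrightarrow> cmod (p \<tau> - 1) \<le> 1 / 10"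
    using near_point[of t] unfolding q_def p_def d_def by blast
  have cq: "continuous_on A q" for A
    unfolding q_def by (intro continuous_intros continuous_on_compose2[OF continuous[of UNIV]]) (use d in auto)
  have cp: "continuous_on A p" for A
    unfolding p_def by (intro continuous_intros continuous_on_compose2[OF regularity(2)]) (use d in auto)
  define K where "K = {-1/2..1/2} \<inter> {\<tau>::real. \<tau>1 \<le> \<bar>\<tau>\<bar>}"
  have K: "compact K" unfolding K_def
    by (intro compact_Int_closed compact_Icc closed_Collect_le continuous_intros)
  have q0: "q \<tau> \<noteq> 0" if "\<tau> \<in> K" for \<tau>
  proof
    assume "q \<tau> = 0"
    then have "\<gamma> (t + \<tau>) = \<gamma> t" using d by (simp add: q_def)
    moreover have "\<bar>t + \<tau> - t\<bar> < 1" using that by (auto simp: K_def)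
    ultimately have "t + \<tau> = t" by (rule injective)
    then show False using that \<tau>1 by (auto simp: K_def)
  qed
  have "\<exists>m>0. \<forall>\<tau>\<in>K. m \<le> cmod (q \<tau>)"
  proof (cases "K = {}")
    case False
    have "continuous_on K (\<lambda>\<tau>. cmod (q \<tau>))" by (intro continuous_intros cq)
    then obtain \<tau>' where "\<tau>' \<in> K" "\<forall>\<tau>\<in>K. cmod (q \<tau>') \<le> cmod (q \<tau>)"
      using continuous_attains_inf[OF K False] by blast
    then show ?thesis using q0 by (intro exI[of _ "cmod (q \<tau>')"]) auto
  qed (auto intro: exI[of _ 1])
  then obtain m where m: "m > 0" "\<And>\<tau>. \<tau> \<in> K \<Longrightarrow> m \<le> cmod (q \<tau>)" by blast
  have "compact (p ` {-1/2..1/2})" by (intro compact_continuous_image cp compact_Icc)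
  then obtain P where P: "P > 0" "\<And>\<tau>. \<tau> \<in> {-1/2..1/2} \<Longrightarrow> cmod (p \<tau>) \<le> P"
    using compact_imp_bounded bounded_pos by (metis image_eqI)
  define C where "C = 4 * P / m\<^sup>2"
  have C: "C > 0" using P m by (simp add: C_def)
  define \<epsilon>0 where "\<epsilon>0 = min (m / 2) (min \<tau>1 (1 / (2 * C)))"
  show thesis
  proof (rule that[of \<epsilon>0])
    show "\<epsilon>0 > 0" using m \<tau>1 C by (simp add: \<epsilon>0_def)
    fix \<epsilon> assume \<epsilon>: "0 < \<epsilon>" "\<epsilon> < \<epsilon>0"
    then have \<epsilon>': "\<epsilon> < m / 2" "\<epsilon> < \<tau>1" "\<epsilon> < 1 / (2 * C)" by (auto simp: \<epsilon>0_def)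
    define X where "X \<tau> = (q \<tau>)\<^sup>2 + (complex_of_real \<epsilon>)\<^sup>2" for \<tau>
    have far: "X \<tau> \<noteq> 0" "cmod (p \<tau> / X \<tau>) \<le> 2 * P / m\<^sup>2" if "\<tau> \<in> K" for \<tau>
    proof -
      have "\<epsilon>\<^sup>2 \<le> (m / 2)\<^sup>2" using \<epsilon> \<epsilon>' by (intro power_mono) auto
      moreover have "m\<^sup>2 \<le> (cmod (q \<tau>))\<^sup>2" using m that by (intro power_mono) auto
      moreover have "(cmod (q \<tau>))\<^sup>2 - \<epsilon>\<^sup>2 \<le> cmod (X \<tau>)"
        using norm_triangle_ineq2[of "(q \<tau>)\<^sup>2" "- (complex_of_real \<epsilon>)\<^sup>2"] by (simp add: X_def norm_power)
      moreover have "(m / 2)\<^sup>2 = m\<^sup>2 / 4" by (simp add: power_divide)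
      moreover have "m\<^sup>2 > 0" using m by simp
      ultimately have X: "cmod (X \<tau>) \<ge> m\<^sup>2 / 2" "m\<^sup>2 / 2 > 0" by linarith+
      then show "X \<tau> \<noteq> 0" by auto
      have "cmod (p \<tau> / X \<tau>) \<le> P / (m\<^sup>2 / 2)"
        unfolding norm_divide using X P(1) P(2)[of \<tau>] that by (intro frac_le) (auto simp: K_def)
      then show "cmod (p \<tau> / X \<tau>) \<le> 2 * P / m\<^sup>2" by (simp add: ac_simps)
    qed
    have near: "X \<tau> \<noteq> 0" "Re (p \<tau> / X \<tau>) \<ge> (1/2) / (\<tau>\<^sup>2 + \<epsilon>\<^sup>2)" if "\<bar>\<tau>\<bar> \<le> \<tau>1" for \<tau>
      unfolding X_def using kernel_bound[OF \<tau>1(3)[OF that] \<tau>1(4)[OF that] \<epsilon>(1)] by blast+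
    have cases: "\<bar>\<tau>\<bar> \<le> \<tau>1 \<or> \<tau> \<in> K" if "\<tau> \<in> {-1/2..1/2}" for \<tau> using that by (auto simp: K_def)
    have X0: "X \<tau> \<noteq> 0" if "\<tau> \<in> {-1/2..1/2}" for \<tau> using cases[OF that] near far by blast
    define zp where "zp = \<gamma> t + \<i> * \<epsilon> * d"
    define zm where "zm = \<gamma> t - \<i> * \<epsilon> * d"
    define \<eta> where "\<eta> = (\<lambda>u. \<gamma> (t - 1/2 + u))"
    note sp = shifted_path[where a = "t - 1/2", folded \<eta>_def]
    have fac: "(\<eta> u - zp) * (\<eta> u - zm) = d\<^sup>2 * X (u - 1/2)" for u
    proof -
      have "t - 1/2 + u = t + (u - 1/2)" by simp
      then have "\<eta> u = \<gamma> (t + (u - 1/2))" by (simp only: \<eta>_def)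
      also have "\<dots> = \<gamma> t + d * q (u - 1/2)" unfolding q_def using d by simp
      finally have "\<eta> u = \<gamma> t + d * q (u - 1/2)" .
      moreover have "(w + d * y - (w + \<i> * \<epsilon> * d)) * (w + d * y - (w - \<i> * \<epsilon> * d)) = d\<^sup>2 * (y\<^sup>2 + (complex_of_real \<epsilon>)\<^sup>2)"
        for w y :: complex by (simp add: power2_eq_square algebra_simps)
      ultimately show ?thesis by (simp add: zp_def zm_def X_def)
    qed
    have ne: "\<eta> u - zp \<noteq> 0" "\<eta> u - zm \<noteq> 0" if "u \<in> {0..1}" for u
    proof -
      have "X (u - 1/2) \<noteq> 0" using that by (intro X0) auto
      then have "(\<eta> u - zp) * (\<eta> u - zm) \<noteq> 0" unfolding fac using d by simp
      then show "\<eta> u - zp \<noteq> 0" "\<eta> u - zm \<noteq> 0" by auto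
    qed
    have "zp \<notin> path_image \<eta>" "zm \<notin> path_image \<eta>"
      using ne unfolding path_image_def by force+
    then have notin: "zp \<notin> path_image \<gamma>" "zm \<notin> path_image \<gamma>" unfolding sp(1) .
    define F where "F u = 2 * \<epsilon> * Re (p (u - 1/2) / X (u - 1/2))" for u
    have "((\<lambda>u. 1 / (\<eta> u - z) * velocity (t - 1/2 + u)) has_integral 2 * pi * \<i> * winding_number \<gamma> z) {0..1}"
      if "z \<notin> path_image \<gamma>" for z
      using has_contour_integral_winding_number[OF sp(2), of z] that
      unfolding has_contour_integral sp(1,4) sp(3)[OF that] by simp
    from has_integral_diff[OF this[OF notin(1)] this[OF notin(2)]]
    have "((\<lambda>u. 1 / (\<eta> u - zp) * velocity (t - 1/2 + u) - 1 / (\<eta> u - zm) * velocity (t - 1/2 + u)) has_integral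
        (2 * pi * \<i> * winding_number \<gamma> zp - 2 * pi * \<i> * winding_number \<gamma> zm)) {0..1}" .
    from has_integral_linear[OF this bounded_linear_Im]
    have I: "((\<lambda>u. Im (1 / (\<eta> u - zp) * velocity (t - 1/2 + u) - 1 / (\<eta> u - zm) * velocity (t - 1/2 + u))) has_integral
        2 * pi * Re (winding_number \<gamma> zp - winding_number \<gamma> zm)) {0..1}"
      by (simp add: o_def right_diff_distrib)
    have IF: "(F has_integral 2 * pi * Re (winding_number \<gamma> zp - winding_number \<gamma> zm)) {0..1}"
    proof (rule has_integral_eq[OF _ I])
      fix u :: real assume u: "u \<in> {0..1}"
      have im: "Im (\<i> * (of_real c * w)) = c * Re w" for c w by simp
      have "1 / (\<eta> u - zp) - 1 / (\<eta> u - zm) = (zp - zm) / ((\<eta> u - zp) * (\<eta> u - zm))"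
        using ne[OF u] by (simp add: field_simps)
      also have "\<dots> = (2 * \<i> * \<epsilon> * d) / (d\<^sup>2 * X (u - 1/2))" unfolding fac by (simp add: zp_def zm_def)
      finally have "1 / (\<eta> u - zp) * velocity (t - 1/2 + u) - 1 / (\<eta> u - zm) * velocity (t - 1/2 + u)
         = (2 * \<i> * \<epsilon> * d) / (d\<^sup>2 * X (u - 1/2)) * velocity (t - 1/2 + u)"
        by (simp only: left_diff_distrib[symmetric])
      also have "\<dots> = \<i> * (of_real (2 * \<epsilon>) * (p (u - 1/2) / X (u - 1/2)))"
      proof -
        have tu: "t - 1/2 + u = t + (u - 1/2)" by simp
        have "velocity (t - 1/2 + u) = d * p (u - 1/2)" unfolding p_def tu using d by simp
        then show ?thesis using d by (simp add: power2_eq_square field_simps)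
      qed
      finally show "Im (1 / (\<eta> u - zp) * velocity (t - 1/2 + u) - 1 / (\<eta> u - zm) * velocity (t - 1/2 + u)) = F u"
        by (simp only: im F_def)
    qed
    \<comment> \<open>The integral over the interval of length \<open>2 * \<epsilon>\<close> around the base point is at least one, and the
      negative part of the integrand is of order \<open>\<epsilon>\<close>.\<close>
    define G where "G u = (if u \<in> {1/2 - \<epsilon>..1/2 + \<epsilon>} then 1 / (2 * \<epsilon>) else 0) - C * \<epsilon>" for u
    have "((\<lambda>u. 1 / (2 * \<epsilon>)) has_integral (1 / (2 * \<epsilon>)) * ((1/2 + \<epsilon>) - (1/2 - \<epsilon>))) {1/2 - \<epsilon>..1/2 + \<epsilon>}"
      using has_integral_const_real[of "1 / (2 * \<epsilon>)" "1/2 - \<epsilon>" "1/2 + \<epsilon>"] \<epsilon> by simp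
    then have "((\<lambda>u. 1 / (2 * \<epsilon>)) has_integral 1) {1/2 - \<epsilon>..1/2 + \<epsilon>}" using \<epsilon> by simp
    moreover have "{1/2 - \<epsilon>..1/2 + \<epsilon>} \<subseteq> {0..1}" using \<epsilon>' \<tau>1 by auto
    ultimately have "((\<lambda>u. if u \<in> {1/2 - \<epsilon>..1/2 + \<epsilon>} then 1 / (2 * \<epsilon>) else 0) has_integral 1) {0..1}"
      by (simp only: has_integral_restrict)
    from has_integral_diff[OF this has_integral_const_real[of "C * \<epsilon>" 0 1]]
    have IG: "(G has_integral 1 - C * \<epsilon>) {0..1}" unfolding G_def by simp
    have "G u \<le> F u" if u: "u \<in> {0..1}" for u
    proof -
      define \<tau> where "\<tau> = u - 1/2"
      have \<tau>: "\<tau> \<in> {-1/2..1/2}" using u by (auto simp: \<tau>_def)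
      have C\<epsilon>: "C * \<epsilon> > 0" using C \<epsilon> by simp
      show ?thesis
      proof (cases "\<bar>\<tau>\<bar> \<le> \<tau>1")
        case True
        have T: "\<tau>\<^sup>2 + \<epsilon>\<^sup>2 > 0" using \<epsilon> by (simp add: add_nonneg_pos)
        have "2 * \<epsilon> * ((1/2) / (\<tau>\<^sup>2 + \<epsilon>\<^sup>2)) \<le> F u"
          unfolding F_def \<tau>_def[symmetric] using near(2)[OF True] \<epsilon> by (intro mult_left_mono) auto
        moreover have "2 * \<epsilon> * ((1/2) / w) = \<epsilon> / w" for w by simp
        ultimately have FT: "\<epsilon> / (\<tau>\<^sup>2 + \<epsilon>\<^sup>2) \<le> F u" by (simp only:)
        moreover have "\<epsilon> / (\<tau>\<^sup>2 + \<epsilon>\<^sup>2) \<ge> 0" using T \<epsilon> by simp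
        moreover have "1 / (2 * \<epsilon>) \<le> \<epsilon> / (\<tau>\<^sup>2 + \<epsilon>\<^sup>2)" if "\<bar>\<tau>\<bar> \<le> \<epsilon>"
        proof -
          have "\<tau>\<^sup>2 \<le> \<epsilon>\<^sup>2" using that by (simp add: abs_le_square_iff[symmetric])
          then have "\<tau>\<^sup>2 + \<epsilon>\<^sup>2 \<le> 2 * \<epsilon> * \<epsilon>" by (simp add: power2_eq_square)
          then have "\<epsilon> / (2 * \<epsilon> * \<epsilon>) \<le> \<epsilon> / (\<tau>\<^sup>2 + \<epsilon>\<^sup>2)" using T \<epsilon> by (intro divide_left_mono) auto
          then show ?thesis using \<epsilon> by simp
        qed
        moreover have "\<bar>\<tau>\<bar> \<le> \<epsilon>" if "u \<in> {1/2 - \<epsilon>..1/2 + \<epsilon>}" using that unfolding \<tau>_def by auto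
        ultimately show ?thesis using C\<epsilon> unfolding G_def by (auto intro: order_trans)
      next
        case False
        then have k: "\<tau> \<in> K" using cases[OF \<tau>] by blast
        have nu: "u \<notin> {1/2 - \<epsilon>..1/2 + \<epsilon>}" using False \<epsilon>' unfolding \<tau>_def by auto
        have "G u = - (C * \<epsilon>)" by (simp only: G_def if_not_P[OF nu] diff_0)
        also have "- (C * \<epsilon>) = 2 * \<epsilon> * (- (2 * P / m\<^sup>2))" by (simp add: C_def)
        also have "\<dots> \<le> F u" unfolding F_def \<tau>_def[symmetric]
          using far(2)[OF k] abs_Re_le_cmod[of "p \<tau> / X \<tau>"] \<epsilon> by (intro mult_left_mono) auto
        finally show ?thesis .
      qed
    qed
    then have "1 - C * \<epsilon> \<le> 2 * pi * Re (winding_number \<gamma> zp - winding_number \<gamma> zm)"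
      using has_integral_le[OF IG IF] by blast
    moreover have "C * \<epsilon> < 1 / 2" using \<epsilon>'(3) C by (simp add: field_simps)
    ultimately have "0 < 2 * pi * Re (winding_number \<gamma> zp - winding_number \<gamma> zm)" by linarith
    then have pos: "0 < Re (winding_number \<gamma> zp - winding_number \<gamma> zm)" by (simp add: zero_less_mult_iff)
    have "zp \<in> inside (path_image \<gamma>) \<and> zm \<in> outside (path_image \<gamma>)"
      using winding_number_cases[OF notin(1)] winding_number_cases[OF notin(2)] pos
      by (metis diff_self less_irrefl zero_complex.sel(1) diff_0 uminus_complex.sel(1) one_complex.sel(1) neg_0_less_iff_less not_one_less_zero)
    then show "\<gamma> t + \<i> * \<epsilon> * velocity t \<in> inside (path_image \<gamma>) \<and> \<gamma> t - \<i> * \<epsilon> * velocity t \<in> outside (path_image \<gamma>)"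
      by (simp add: zp_def zm_def d_def)
  qed
qed

end

section \<open>From graph coordinates to the curve\<close>

text \<open>For fixed \<open>r\<close> and \<open>\<delta>\<close> the sequence in \<open>N\<close> need not be known to converge; it is enough that its cluster
  points are close to \<open>G r\<close> for small \<open>\<delta>\<close>.\<close>

lemma iterated_limits_of_approximation:
  fixes a :: "nat \<Rightarrow> real \<Rightarrow> real \<Rightarrow> real"
  assumes approx: "\<forall>\<^sub>F r in at_right 0. \<forall>\<epsilon>>0. \<exists>\<delta>0>0. \<forall>\<delta>. 0 < \<delta> \<longrightarrow> \<delta> < \<delta>0 \<longrightarrow>
      (\<forall>\<^sub>F N in sequentially. \<bar>a N r \<delta> - G r\<bar> \<le> \<epsilon>)"
    and lim: "((\<lambda>r. G r / (2 * r)) \<longlongrightarrow> L) (at_right 0)"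
  shows "has_iterated_limit (\<lambda>r \<delta>. liminf (\<lambda>N. ereal (1 / (2 * r) * a N r \<delta>))) (ereal L)"
    and "has_iterated_limit (\<lambda>r \<delta>. limsup (\<lambda>N. ereal (1 / (2 * r) * a N r \<delta>))) (ereal L)"
proof -
  define lo where "lo r \<delta> = liminf (\<lambda>N. ereal (1 / (2 * r) * a N r \<delta>))" for r \<delta>
  define hi where "hi r \<delta> = limsup (\<lambda>N. ereal (1 / (2 * r) * a N r \<delta>))" for r \<delta>
  have lohi: "lo r \<delta> \<le> hi r \<delta>" for r \<delta>
    unfolding lo_def hi_def by (rule Liminf_le_Limsup) simp
  have bounds: "\<forall>\<^sub>F r in at_right 0. \<forall>\<epsilon>>0. \<forall>\<^sub>F \<delta> in at_right 0.
      ereal (G r / (2 * r) - \<epsilon>) \<le> lo r \<delta> \<and> hi r \<delta> \<le> ereal (G r / (2 * r) + \<epsilon>)"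
    using approx eventually_at_right_less[of "0::real"]
  proof eventually_elim
    case (elim r)
    show ?case
    proof (intro allI impI)
      fix \<epsilon> :: real assume "\<epsilon> > 0"
      then have "\<epsilon> * (2 * r) > 0" using elim(2) by simp
      then obtain \<delta>0 where \<delta>0: "\<delta>0 > 0" "\<And>\<delta>. 0 < \<delta> \<Longrightarrow> \<delta> < \<delta>0 \<Longrightarrow>
          \<forall>\<^sub>F N in sequentially. \<bar>a N r \<delta> - G r\<bar> \<le> \<epsilon> * (2 * r)" using elim(1) by blast
      have "ereal (G r / (2 * r) - \<epsilon>) \<le> lo r \<delta> \<and> hi r \<delta> \<le> ereal (G r / (2 * r) + \<epsilon>)"
        if \<delta>: "0 < \<delta>" "\<delta> < \<delta>0" for \<delta>
      proof -
        have "\<forall>\<^sub>F N in sequentially. \<bar>1 / (2 * r) * a N r \<delta> - G r / (2 * r)\<bar> \<le> \<epsilon>"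
          using \<delta>0(2)[OF \<delta>]
        proof eventually_elim
          case (elim N)
          have "1 / (2 * r) * a N r \<delta> - G r / (2 * r) = (a N r \<delta> - G r) / (2 * r)" by (simp add: diff_divide_distrib)
          then have "\<bar>1 / (2 * r) * a N r \<delta> - G r / (2 * r)\<bar> = \<bar>a N r \<delta> - G r\<bar> / (2 * r)"
            using \<open>0 < r\<close> by (simp add: abs_divide)
          then show ?case using elim \<open>0 < r\<close> by (simp add: pos_divide_le_eq)
        qed
        then have "\<forall>\<^sub>F N in sequentially. ereal (G r / (2 * r) - \<epsilon>) \<le> ereal (1 / (2 * r) * a N r \<delta>)"
          "\<forall>\<^sub>F N in sequentially. ereal (1 / (2 * r) * a N r \<delta>) \<le> ereal (G r / (2 * r) + \<epsilon>)"
          by (eventually_elim, simp add: abs_le_iff, eventually_elim, simp add: abs_le_iff)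
        then show ?thesis unfolding lo_def hi_def by (auto intro: Liminf_bounded Limsup_bounded)
      qed
      then show "\<forall>\<^sub>F \<delta> in at_right 0. ereal (G r / (2 * r) - \<epsilon>) \<le> lo r \<delta> \<and> hi r \<delta> \<le> ereal (G r / (2 * r) + \<epsilon>)"
        using \<delta>0(1) by (auto simp: eventually_at_right_field intro!: exI[of _ \<delta>0])
    qed
  qed
  have squeeze: "(v \<longlongrightarrow> ereal g) (at_right 0)"
    if v: "\<And>\<delta>. lo r \<delta> \<le> v \<delta>" "\<And>\<delta>. v \<delta> \<le> hi r \<delta>"
      and b: "\<forall>\<epsilon>>0. \<forall>\<^sub>F \<delta> in at_right 0. ereal (g - \<epsilon>) \<le> lo r \<delta> \<and> hi r \<delta> \<le> ereal (g + \<epsilon>)" for v g r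
  proof (rule order_tendstoI)
    fix c assume "c < ereal g"
    then obtain b' where b': "c < ereal b'" "ereal b' < ereal g" using ereal_dense2 by blast
    then have "\<forall>\<^sub>F \<delta> in at_right 0. ereal (g - (g - b')) \<le> lo r \<delta> \<and> hi r \<delta> \<le> ereal (g + (g - b'))"
      by (intro b[rule_format]) simp
    then show "\<forall>\<^sub>F \<delta> in at_right 0. c < v \<delta>"
      by eventually_elim (use b' v(1) in \<open>auto intro: less_le_trans order_trans\<close>)
  next
    fix c assume "ereal g < c"
    then obtain b' where b': "ereal g < ereal b'" "ereal b' < c" using ereal_dense2 by blast
    then have "\<forall>\<^sub>F \<delta> in at_right 0. ereal (g - (b' - g)) \<le> lo r \<delta> \<and> hi r \<delta> \<le> ereal (g + (b' - g))"
      by (intro b[rule_format]) simp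
    then show "\<forall>\<^sub>F \<delta> in at_right 0. v \<delta> < c"
      by eventually_elim (use b' v(2) in \<open>auto intro: le_less_trans order_trans\<close>)
  qed
  have L: "((\<lambda>r. ereal (G r / (2 * r))) \<longlongrightarrow> ereal L) (at_right 0)" using lim by simp
  have "\<forall>\<^sub>F r in at_right 0. (lo r \<longlongrightarrow> ereal (G r / (2 * r))) (at_right 0)"
    using bounds by eventually_elim (rule squeeze, auto simp: lohi)
  then show "has_iterated_limit (\<lambda>r \<delta>. liminf (\<lambda>N. ereal (1 / (2 * r) * a N r \<delta>))) (ereal L)"
    unfolding has_iterated_limit_def lo_def[abs_def] using L by (intro exI[of _ "\<lambda>r. ereal (G r / (2 * r))"] conjI)
  have "\<forall>\<^sub>F r in at_right 0. (hi r \<longlongrightarrow> ereal (G r / (2 * r))) (at_right 0)"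
    using bounds by eventually_elim (rule squeeze, auto simp: lohi)
  then show "has_iterated_limit (\<lambda>r \<delta>. limsup (\<lambda>N. ereal (1 / (2 * r) * a N r \<delta>))) (ereal L)"
    unfolding has_iterated_limit_def hi_def[abs_def] using L by (intro exI[of _ "\<lambda>r. ereal (G r / (2 * r))"] conjI)
qed

text \<open>The identity or the reflection in the diagonal, on the plane and on the lattice. Multiplication by
  \<open>\<i>\<close> commutes with it up to the sign \<open>\<kappa>\<close>.\<close>

locale lattice_symmetry =
  fixes T :: "complex \<Rightarrow> complex" and S :: "site \<Rightarrow> site" and \<kappa> :: real
  assumes T: "(T = id \<and> S = id \<and> \<kappa> = 1) \<or> (T = (\<lambda>z. Complex (Im z) (Re z)) \<and> S = prod.swap \<and> \<kappa> = - 1)"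
begin

lemma TT [simp]: "T (T z) = z" and SS [simp]: "S (S x) = x" and dist_T [simp]: "dist (T z) (T w) = dist z w"
  and cell_S: "cell N (S x) = T ` cell N x"
  and T_add: "T (z + w) = T z + T w" and T_scale: "T (of_real c * z) = of_real c * T z" and T_i: "T (\<i> * z) = of_real \<kappa> * \<i> * T z"
proof -
  show TT: "T (T z) = z" for z using T by (auto simp: complex_eq_iff)
  show "S (S x) = x" using T by auto
  show "dist (T z) (T w) = dist z w" using T by (auto simp: dist_norm cmod_def add.commute)
  show "T (z + w) = T z + T w" "T (of_real c * z) = of_real c * T z" "T (\<i> * z) = of_real \<kappa> * \<i> * T z"
    using T by (auto simp: complex_eq_iff)
  have *: "z \<in> cell N (S x) \<longleftrightarrow> T z \<in> cell N x" for z using T by (auto simp: cell_def)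
  show "cell N (S x) = T ` cell N x"
  proof (intro set_eqI iffI)
    fix z assume "z \<in> cell N (S x)"
    then show "z \<in> T ` cell N x" using * TT by (metis image_eqI)
  next
    fix z assume "z \<in> T ` cell N x"
    then show "z \<in> cell N (S x)" using * TT by auto
  qed
qed

lemma bounded_linear_T: "bounded_linear T"
proof (rule bounded_linear_intro[where K = 1])
  show "T (z + w) = T z + T w" "T (c *\<^sub>R z) = c *\<^sub>R T z" for z w c
    using T_add T_scale by (auto simp: scaleR_conv_of_real)
  show "norm (T z) \<le> norm z * 1" for z using T by (auto simp: cmod_def add.commute)
qed

lemma T_image_iff: "z \<in> T ` A \<longleftrightarrow> T z \<in> A"
  by (metis TT image_iff)

lemma inj_T: "inj T" and inj_S: "inj_on S A"
  by (metis TT injI, metis SS inj_on_def)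

lemma open_T_image: "open A \<Longrightarrow> open (T ` A)"
proof -
  assume "open A"
  moreover have "T ` A = T -` A" by (auto simp: T_image_iff)
  ultimately show ?thesis
    using linear_continuous_on[OF bounded_linear_T] by (metis continuous_on_open_vimage open_UNIV inf_top.right_neutral)
qed

lemma cball_T: "cball (T p) r = T ` cball p r" and sphere_T: "sphere (T p) r = T ` sphere p r"
  and ball_T: "ball (T p) r = T ` ball p r"
  using dist_T[of p] TT by (auto simp: T_image_iff intro: set_eqI) (metis dist_T TT)+

lemma infdist_T: "infdist (T p) (T ` A) = infdist p A"
  by (simp add: infdist_def image_image)

lemma signed_rate_S: "signed_rate (\<sigma> \<circ> S) (S x) = signed_rate \<sigma> x"
  using T
proof
  assume "T = id \<and> S = id \<and> \<kappa> = 1"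
  then show ?thesis by simp
next
  assume "T = (\<lambda>z. Complex (Im z) (Re z)) \<and> S = prod.swap \<and> \<kappa> = - 1"
  then show ?thesis by (simp only: signed_rate_swap)
qed

lemma drift_sum_symmetric:
  "(\<Sum>x\<in>F. signed_rate (initial_config N \<Omega>) x * window_weight N s r p q \<delta> x)
     = (\<Sum>x\<in>S ` F. signed_rate (initial_config N (T ` \<Omega>)) x * window_weight N (T s) r (T p) (T q) \<delta> x)"
proof -
  have meets: "T ` A \<inter> T ` B \<noteq> {} \<longleftrightarrow> A \<inter> B \<noteq> {}" for A B
    using inj_T by (simp add: image_Int[symmetric])
  have "initial_config N (T ` \<Omega>) = initial_config N \<Omega> \<circ> S"
  proof
    fix x
    have "cell N x = T ` cell N (S x)" using cell_S[of N "S x"] by simp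
    then show "initial_config N (T ` \<Omega>) x = (initial_config N \<Omega> \<circ> S) x"
      using meets by (simp add: initial_config_def)
  qed
  moreover have "window_weight N (T s) r (T p) (T q) \<delta> (S x) = window_weight N s r p q \<delta> x" for x
    unfolding window_weight_def cell_S cball_T infdist_T meets ..
  ultimately show ?thesis by (simp add: sum.reindex[OF inj_S] signed_rate_S)
qed

end

context jordan_C2
begin

text \<open>Choose times \<open>a\<close> and \<open>b\<close> in the period before \<open>t\<close> at which the curve is at the two points. Going once around
  from the point at time \<open>a\<close> one passes \<open>t\<close> and then reaches the other point at time \<open>b + 1\<close>, which is
  before \<open>a + 1\<close> if and only if \<open>b < a\<close>. So exactly one of the two orders is the one along the curve.\<close>

lemma crossings_eq:
  assumes r: "r > 0" and pq: "sphere (\<gamma> t) r \<inter> path_image \<gamma> = {p, q}" "p \<noteq> q"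
  obtains "crossings \<gamma> (\<gamma> t) r = (p, q)" | "crossings \<gamma> (\<gamma> t) r = (q, p)"
proof -
  have rep: "\<exists>a. t - 1 < a \<and> a < t \<and> \<gamma> a = w" if "w \<in> {p, q}" for w
  proof -
    have w: "w \<in> sphere (\<gamma> t) r" "w \<in> range \<gamma>" using that pq(1) unfolding path_image_eq_range by auto
    then obtain u where u: "\<gamma> u = w" by blast
    define a where "a = u - of_int \<lceil>u - t\<rceil>"
    have "\<gamma> a = w" using periodic[of u "- \<lceil>u - t\<rceil>"] u by (simp add: a_def)
    moreover have "w \<noteq> \<gamma> t" using w(1) r by auto
    ultimately have "a \<noteq> t" by auto
    moreover have "t - 1 < a" "a \<le> t" unfolding a_def by linarith+
    ultimately show ?thesis using \<open>\<gamma> a = w\<close> by (intro exI[of _ a]) auto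
  qed
  have unique: "a = b" if "\<gamma> a = \<gamma> b" "t - 1 < a" "a < t" "t - 1 < b" "b < t" for a b
    using injective[of a b] that by auto
  have ordered: "ordered_along \<gamma> w (\<gamma> t) v \<longleftrightarrow> b < a"
    if ab: "\<gamma> a = w" "\<gamma> b = v" "t - 1 < a" "a < t" "t - 1 < b" "b < t" for a b w v
  proof
    assume "b < a"
    then show "ordered_along \<gamma> w (\<gamma> t) v" unfolding ordered_along_def
      using ab periodic[of b 1] by (intro exI[of _ a] exI[of _ t] exI[of _ "b + 1"]) auto
  next
    assume "ordered_along \<gamma> w (\<gamma> t) v"
    then obtain a' t' c' where o: "a' < t'" "t' < c'" "c' < a' + 1" "\<gamma> a' = w" "\<gamma> t' = \<gamma> t" "\<gamma> c' = v"
      unfolding ordered_along_def by blast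
    define m where "m = round (t' - t)"
    have "\<bar>t' - t - of_int m\<bar> \<le> 1 / 2" using of_int_round_abs_le[of "t' - t"] by (simp add: m_def abs_minus_commute)
    moreover have "\<gamma> (t' - of_int m) = \<gamma> t" using periodic[of t' "- m"] o(5) by simp
    ultimately have t': "t' - of_int m = t" by (intro injective) linarith+
    have "\<gamma> (a' - of_int m) = w" using periodic[of a' "- m"] o(4) by simp
    then have "a' - of_int m = a" using o ab t' by (intro unique) auto
    moreover have "\<gamma> (c' - of_int m - 1) = v" using periodic[of c' "- m - 1"] o(6) by (simp add: algebra_simps)
    then have "c' - of_int m - 1 = b" using o ab t' by (intro unique) auto
    ultimately show "b < a" using o(3) by linarith
  qed
  obtain a b where a: "t - 1 < a" "a < t" "\<gamma> a = p" and b: "t - 1 < b" "b < t" "\<gamma> b = q"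
    using rep[of p] rep[of q] by blast
  have ne: "a \<noteq> b" using a b pq(2) by auto
  have main: "crossings \<gamma> (\<gamma> t) r = (w, v)"
    if wv: "{w, v} = {p, q}" "ordered_along \<gamma> w (\<gamma> t) v" "\<not> ordered_along \<gamma> v (\<gamma> t) w" for w v
    unfolding crossings_def
  proof (rule the_equality)
    show "fst (w, v) \<noteq> snd (w, v) \<and> sphere (\<gamma> t) r \<inter> path_image \<gamma> = {fst (w, v), snd (w, v)} \<and>
      ordered_along \<gamma> (fst (w, v)) (\<gamma> t) (snd (w, v))"
      using wv pq by auto
    fix z assume z: "fst z \<noteq> snd z \<and> sphere (\<gamma> t) r \<inter> path_image \<gamma> = {fst z, snd z} \<and>
      ordered_along \<gamma> (fst z) (\<gamma> t) (snd z)"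
    then have "{fst z, snd z} = {w, v}" using pq(1) wv(1) by simp
    then show "z = (w, v)" using z wv(3) by (auto simp: doubleton_eq_iff prod_eq_iff)
  qed
  show thesis
  proof (cases "b < a")
    case True
    then show thesis using main[of p q] ordered[OF a(3) b(3) a(1,2) b(1,2)] ordered[OF b(3) a(3) b(1,2) a(1,2)] that(1) by auto
  next
    case False
    then have "a < b" using ne by simp
    then show thesis using main[of q p] ordered[OF a(3) b(3) a(1,2) b(1,2)] ordered[OF b(3) a(3) b(1,2) a(1,2)] that(2) by auto
  qed
qed

text \<open>The points of one period that are not near in time form a compact set, which does not contain
  \<open>\<gamma> t\<close>.\<close>

lemma near_points_are_near_in_time:
  assumes "\<tau>1 > 0"
  obtains r1 where "r1 > 0" "\<And>z. z \<in> path_image \<gamma> \<Longrightarrow> z \<in> ball (\<gamma> t) r1 \<Longrightarrow> \<exists>\<tau>. \<bar>\<tau>\<bar> \<le> \<tau>1 \<and> z = \<gamma> (t + \<tau>)"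
proof -
  define I where "I = {t - 1/2..t + 1/2} - {t - \<tau>1<..<t + \<tau>1}"
  have "compact I" unfolding I_def by (intro compact_diff) auto
  then have "compact (\<gamma> ` I)" by (rule compact_continuous_image[OF continuous])
  then have op: "open (- (\<gamma> ` I))" using compact_imp_closed by blast
  have "\<gamma> t \<notin> \<gamma> ` I"
  proof
    assume "\<gamma> t \<in> \<gamma> ` I"
    then obtain u where u: "u \<in> I" "\<gamma> t = \<gamma> u" by blast
    then have "t = u" by (intro injective) (auto simp: I_def)
    then show False using u(1) assms by (auto simp: I_def)
  qed
  then obtain r1 where r1: "r1 > 0" "ball (\<gamma> t) r1 \<subseteq> - (\<gamma> ` I)" using op by (meson ComplI open_contains_ball)
  show thesis
  proof (rule that[OF r1(1)])
    fix z assume z: "z \<in> path_image \<gamma>" "z \<in> ball (\<gamma> t) r1"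
    then obtain u where u: "z = \<gamma> u" unfolding path_image_eq_range by blast
    define \<tau> where "\<tau> = u - t - of_int (round (u - t))"
    have \<tau>: "\<bar>\<tau>\<bar> \<le> 1 / 2" using of_int_round_abs_le[of "u - t"] by (simp add: \<tau>_def abs_minus_commute)
    have "t + \<tau> = u + of_int (- round (u - t))" by (simp add: \<tau>_def)
    then have z\<tau>: "z = \<gamma> (t + \<tau>)" using u periodic[of u "- round (u - t)"] by (simp only:)
    then have "t + \<tau> \<notin> I" using z(2) r1(2) by blast
    then have "\<bar>\<tau>\<bar> \<le> \<tau>1" using \<tau> by (auto simp: I_def)
    then show "\<exists>\<tau>. \<bar>\<tau>\<bar> \<le> \<tau>1 \<and> z = \<gamma> (t + \<tau>)" using z\<tau> by blast
  qed
qed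

text \<open>The outside is connected, unbounded and disjoint from the frontier of the bounded set \<open>\<Omega>\<close>, so
  it does not meet \<open>\<Omega>\<close>.\<close>

lemma enclosed_region:
  assumes "encloses \<gamma> \<Omega>"
  shows "\<Omega> = inside (path_image \<gamma>) \<union> path_image \<gamma>"
proof -
  have \<Omega>: "compact \<Omega>" "frontier \<Omega> = path_image \<gamma>" "inside (path_image \<gamma>) \<subseteq> \<Omega>"
    using assms by (auto simp: encloses_def)
  have "outside (path_image \<gamma>) \<inter> \<Omega> = {}"
  proof (rule ccontr)
    assume ne: "outside (path_image \<gamma>) \<inter> \<Omega> \<noteq> {}"
    have con: "connected (outside (path_image \<gamma>))" by (rule connected_outside[OF path(3)]) simp
    have "outside (path_image \<gamma>) \<inter> frontier \<Omega> = {}" unfolding \<Omega>(2) using outside_no_overlap by auto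
    then have "outside (path_image \<gamma>) \<subseteq> \<Omega>" using connected_Int_frontier[OF con ne] by blast
    then have "bounded (outside (path_image \<gamma>))" using \<Omega>(1) bounded_subset compact_imp_bounded by blast
    then show False using unbounded_outside[OF path(3)] by blast
  qed
  moreover have "path_image \<gamma> \<subseteq> \<Omega>" using \<Omega>(1,2) frontier_subset_closed compact_imp_closed by metis
  ultimately show ?thesis using \<Omega>(3) inside_Un_outside[of "path_image \<gamma>"] by blast
qed

end

context jordan_C2
begin

text \<open>The sign \<open>\<rho>\<close> is the direction of time in which the curve, after the reflection if there is one, runs
  to the right. The region then lies above the curve if \<open>\<kappa> * \<rho> = 1\<close> and below otherwise, because a
  reflection and a reversal of time both exchange left and right.\<close>

lemma drift_limit_by_symmetry:
  fixes \<rho> t :: real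
  assumes sym: "lattice_symmetry T S \<kappa>" and \<rho>: "\<rho> = 1 \<or> \<rho> = -1"
    and ising: "stochastic_ising W P X" and \<Omega>: "encloses \<gamma> \<Omega>"
  defines "v \<equiv> T (of_real \<rho> * velocity t)" and "w \<equiv> T (acceleration t)"
  assumes pos: "Re v > 0" and diag: "\<bar>Im v\<bar> \<le> Re v"
  defines "L \<equiv> - (\<kappa> * \<rho> / 2) * (((Re v)\<^sup>2 - (Im v)\<^sup>2) / ((Re v)\<^sup>2 + (Im v)\<^sup>2)) *
      ((Re v * Im w - Re w * Im v) / ((Re v)\<^sup>2 + (Im v)\<^sup>2) powr (3/2))"
  shows "has_iterated_limit (\<lambda>r \<delta>. liminf (\<lambda>N. ereal (1 / (2 * r) * averaged_drift P X N (initial_config N \<Omega>) \<gamma> (\<gamma> t) r \<delta>)))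
      (ereal L)"
    and "has_iterated_limit (\<lambda>r \<delta>. limsup (\<lambda>N. ereal (1 / (2 * r) * averaged_drift P X N (initial_config N \<Omega>) \<gamma> (\<gamma> t) r \<delta>)))
      (ereal L)"
proof -
  interpret lattice_symmetry T S \<kappa> by (rule sym)
  let ?K = "path_image \<gamma>"
  define \<eta> where "\<eta> \<tau> = T (\<gamma> (t + \<rho> * \<tau>))" for \<tau>
  define e1 where "e1 \<tau> = T (of_real \<rho> * velocity (t + \<rho> * \<tau>))" for \<tau>
  have \<rho>\<rho>: "\<rho> * \<rho> = 1" using \<rho> by auto
  have inner: "((\<lambda>\<tau>. t + \<rho> * \<tau>) has_vector_derivative \<rho>) (at \<tau>)" for \<tau>
    by (auto intro!: derivative_eq_intros simp: has_real_derivative_iff_has_vector_derivative[symmetric])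
  have \<eta>': "(\<eta> has_vector_derivative e1 \<tau>) (at \<tau>)" for \<tau>
  proof -
    have "(\<gamma> \<circ> (\<lambda>\<tau>. t + \<rho> * \<tau>) has_vector_derivative \<rho> *\<^sub>R velocity (t + \<rho> * \<tau>)) (at \<tau>)"
      by (rule vector_diff_chain_at[OF inner regularity(1)])
    from bounded_linear.has_vector_derivative[OF bounded_linear_T this] show ?thesis
      by (simp add: \<eta>_def[abs_def] e1_def o_def scaleR_conv_of_real)
  qed
  have e1': "(e1 has_vector_derivative w) (at 0)"
  proof -
    have "(velocity \<circ> (\<lambda>\<tau>. t + \<rho> * \<tau>) has_vector_derivative \<rho> *\<^sub>R acceleration t) (at 0)"
      by (rule vector_diff_chain_at[OF inner]) (simp add: regularity(3))
    from bounded_linear.has_vector_derivative[OF bounded_linear_mult_right[of "of_real \<rho>"] this]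
    have "((\<lambda>\<tau>. of_real \<rho> * velocity (t + \<rho> * \<tau>)) has_vector_derivative acceleration t) (at 0)"
      using \<rho>\<rho> by (simp add: o_def scaleR_conv_of_real mult.assoc[symmetric] of_real_mult[symmetric] del: of_real_mult)
    from bounded_linear.has_vector_derivative[OF bounded_linear_T this] show ?thesis
      by (simp add: e1_def[abs_def] w_def)
  qed
  have e10: "e1 0 = v" by (simp add: e1_def v_def)
  have ce1: "continuous_on UNIV e1"
  proof -
    have "continuous_on UNIV (\<lambda>\<tau>. velocity (t + \<rho> * \<tau>))"
      by (rule continuous_on_compose2[OF regularity(2)]) (auto intro!: continuous_intros)
    then show ?thesis unfolding e1_def
      by (intro bounded_linear.continuous_on[OF bounded_linear_T] continuous_intros)
  qed
  have re: "((\<lambda>\<tau>. Re (g \<tau>)) has_real_derivative Re g') (at \<tau>)" and im: "((\<lambda>\<tau>. Im (g \<tau>)) has_real_derivative Im g') (at \<tau>)"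
    if "(g has_vector_derivative g') (at \<tau>)" for g g' \<tau>
    using bounded_linear.has_vector_derivative[OF bounded_linear_Re that] bounded_linear.has_vector_derivative[OF bounded_linear_Im that]
    by (simp_all add: has_real_derivative_iff_has_vector_derivative)
  have ri [simp]: "Complex (Re z) (Im z) = z" for z by simp
  have s: "Complex (Re (\<eta> 0)) (Im (\<eta> 0)) = T (\<gamma> t)" by (simp add: \<eta>_def)
  obtain \<epsilon>0 where \<epsilon>0: "\<epsilon>0 > 0" "\<And>\<epsilon>::real. 0 < \<epsilon> \<Longrightarrow> \<epsilon> < \<epsilon>0 \<Longrightarrow>
      \<gamma> t + \<i> * of_real \<epsilon> * velocity t \<in> inside ?K \<and> \<gamma> t - \<i> * of_real \<epsilon> * velocity t \<in> outside ?K"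
    using left_side_inside[of t] by blast
  obtain G where G: "\<forall>\<^sub>F r in at_right 0. \<exists>p q. p \<noteq> q \<and> sphere (T (\<gamma> t)) r \<inter> T ` ?K = {p, q} \<and> has_drift_limit (T ` inside ?K \<union> T ` ?K) (T (\<gamma> t)) r p q (G r)"
    "((\<lambda>r. G r / (2 * r)) \<longlongrightarrow> L) (at_right 0)"
  proof (rule drift_in_graph_coordinates[where x = "\<lambda>\<tau>. Re (\<eta> \<tau>)" and y = "\<lambda>\<tau>. Im (\<eta> \<tau>)"
        and x' = "\<lambda>\<tau>. Re (e1 \<tau>)" and y' = "\<lambda>\<tau>. Im (e1 \<tau>)" and ?x2.0 = "Re w" and ?y2.0 = "Im w"
        and A = "T ` inside ?K" and B = "T ` outside ?K" and K = "T ` ?K" and \<omega> = "\<kappa> * \<rho>" and ?\<epsilon>0.0 = \<epsilon>0, unfolded s e10])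
    show "open (T ` inside ?K)" "open (T ` outside ?K)"
      using path(4) by (auto intro: open_T_image open_inside open_outside)
    show "T ` inside ?K \<inter> T ` outside ?K = {}"
      using inj_T by (simp add: image_Int[symmetric])
    have "- (T ` ?K) = T ` (- ?K)" by (intro set_eqI) (simp only: Compl_iff T_image_iff)
    then show "T ` inside ?K \<union> T ` outside ?K = - (T ` ?K)"
      by (simp add: image_Un[symmetric])
    show "Complex (Re (\<eta> \<tau>)) (Im (\<eta> \<tau>)) \<in> T ` ?K" for \<tau>
      by (simp add: \<eta>_def path_image_eq_range)
    show "\<exists>r1>0. \<forall>z\<in>T ` ?K \<inter> ball (T (\<gamma> t)) r1. \<exists>\<tau>. \<bar>\<tau>\<bar> \<le> \<tau>1 \<and> z = Complex (Re (\<eta> \<tau>)) (Im (\<eta> \<tau>))"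
      if \<tau>1: "\<tau>1 > 0" for \<tau>1
    proof -
      obtain r1 where r1: "r1 > 0" "\<And>z. z \<in> ?K \<Longrightarrow> z \<in> ball (\<gamma> t) r1 \<Longrightarrow> \<exists>\<tau>. \<bar>\<tau>\<bar> \<le> \<tau>1 \<and> z = \<gamma> (t + \<tau>)"
        using near_points_are_near_in_time[OF \<tau>1, of t] by blast
      have "\<exists>\<tau>. \<bar>\<tau>\<bar> \<le> \<tau>1 \<and> z = Complex (Re (\<eta> \<tau>)) (Im (\<eta> \<tau>))" if z: "z \<in> T ` ?K" "z \<in> ball (T (\<gamma> t)) r1" for z
      proof -
        have "T z \<in> ?K" "T z \<in> ball (\<gamma> t) r1" using z unfolding ball_T by (auto simp: T_image_iff)
        then obtain \<tau> where \<tau>: "\<bar>\<tau>\<bar> \<le> \<tau>1" "T z = \<gamma> (t + \<tau>)" using r1(2) by blast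
        have "\<rho> * (\<rho> * \<tau>) = \<tau>" using \<rho>\<rho> by (simp add: mult.assoc[symmetric])
        then have "\<eta> (\<rho> * \<tau>) = z" unfolding \<eta>_def using \<tau>(2) by (metis TT)
        moreover have "\<bar>\<rho> * \<tau>\<bar> \<le> \<tau>1" using \<tau>(1) \<rho> by auto
        ultimately show ?thesis by (metis ri)
      qed
      then show ?thesis using r1(1) by blast
    qed
    have T_minus: "T (a - b) = T a - T b" for a b
      using T_add[of "a - b" b] by (simp add: algebra_simps)
    show "T (\<gamma> t) + \<i> * of_real (\<kappa> * \<rho> * \<epsilon>) * Complex (Re v) (Im v) \<in> T ` inside ?K \<and>
        T (\<gamma> t) - \<i> * of_real (\<kappa> * \<rho> * \<epsilon>) * Complex (Re v) (Im v) \<in> T ` outside ?K"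
      if \<epsilon>: "0 < \<epsilon>" "\<epsilon> < \<epsilon>0" for \<epsilon>
    proof -
      have "v = of_real \<rho> * T (velocity t)" by (simp add: v_def T_scale)
      then have "\<i> * of_real (\<kappa> * \<rho> * \<epsilon>) * Complex (Re v) (Im v) = \<i> * of_real (\<kappa> * \<rho> * \<epsilon>) * (of_real \<rho> * T (velocity t))"
        by (simp only: ri)
      also have "\<dots> = of_real (\<rho> * \<rho>) * (of_real \<kappa> * \<i> * (of_real \<epsilon> * T (velocity t)))"
        by (simp add: ac_simps)
      also have "\<dots> = T (\<i> * of_real \<epsilon> * velocity t)" by (simp only: \<rho>\<rho> mult.assoc[of \<i>] T_i T_scale) simp
      finally have "\<i> * of_real (\<kappa> * \<rho> * \<epsilon>) * Complex (Re v) (Im v) = T (\<i> * of_real \<epsilon> * velocity t)" .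
      then show ?thesis using \<epsilon>0(2)[OF \<epsilon>] by (simp only: T_add[symmetric] T_minus[symmetric]) blast
    qed
    show "\<kappa> * \<rho> = 1 \<or> \<kappa> * \<rho> = - 1" using T \<rho> by auto
    show "thesis" if "\<forall>\<^sub>F r in at_right 0. \<exists>p q. p \<noteq> q \<and> sphere (T (\<gamma> t)) r \<inter> T ` ?K = {p, q} \<and> has_drift_limit (T ` inside ?K \<union> T ` ?K) (T (\<gamma> t)) r p q (G r)"
      "((\<lambda>r. G r / (2 * r)) \<longlongrightarrow> - (\<kappa> * \<rho> / 2) * (((Re v)\<^sup>2 - (Im v)\<^sup>2) / ((Re v)\<^sup>2 + (Im v)\<^sup>2)) *
      ((Re v * Im w - Re w * Im v) / ((Re v)\<^sup>2 + (Im v)\<^sup>2) powr (3/2))) (at_right 0)" for G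
      using \<open>\<And>G. _ \<Longrightarrow> _ \<Longrightarrow> thesis\<close>[OF that(1)] that(2) unfolding L_def by blast
  qed (use pos diag \<epsilon>0(1) in \<open>auto intro!: re im \<eta>' e1' continuous_intros ce1\<close>)
  have approx: "\<forall>\<^sub>F r in at_right 0. \<forall>\<epsilon>>0. \<exists>\<delta>0>0. \<forall>\<delta>. 0 < \<delta> \<longrightarrow> \<delta> < \<delta>0 \<longrightarrow>
      (\<forall>\<^sub>F N in sequentially. \<bar>averaged_drift P X N (initial_config N \<Omega>) \<gamma> (\<gamma> t) r \<delta> - G r\<bar> \<le> \<epsilon>)"
    using G(1) eventually_at_right_less[of "0::real"]
  proof eventually_elim
    case (elim r)
    obtain p q where pq: "p \<noteq> q" "sphere (T (\<gamma> t)) r \<inter> T ` ?K = {p, q}"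
      and main: "has_drift_limit (T ` inside ?K \<union> T ` ?K) (T (\<gamma> t)) r p q (G r)"
      using elim(1) by blast
    have "sphere (\<gamma> t) r \<inter> ?K = {T p, T q}"
    proof -
      have "T ` (sphere (\<gamma> t) r \<inter> ?K) = {p, q}" using pq(2) inj_T by (simp add: sphere_T image_Int)
      then have "T ` (T ` (sphere (\<gamma> t) r \<inter> ?K)) = {T p, T q}" by simp
      then show ?thesis by (simp add: image_image)
    qed
    moreover have "T p \<noteq> T q" using pq(1) inj_T by (auto dest: injD)
    ultimately obtain x0 x1 where x01: "crossings \<gamma> (\<gamma> t) r = (x0, x1)" "(x0 = T p \<and> x1 = T q) \<or> (x0 = T q \<and> x1 = T p)"
      using crossings_eq[OF elim(2), of t "T p" "T q"] by blast
    show ?case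
    proof (intro allI impI)
      fix \<epsilon> :: real assume "\<epsilon> > 0"
      then obtain \<delta>0 where \<delta>0: "\<delta>0 > 0" "\<And>\<delta>. 0 < \<delta> \<Longrightarrow> \<delta> < \<delta>0 \<Longrightarrow> \<forall>\<^sub>F N in sequentially. \<forall>F.
        finite F \<longrightarrow> {x. cell N x \<inter> (cball (T (\<gamma> t)) r \<union> cball p \<delta> \<union> cball q \<delta>) \<noteq> {}} \<subseteq> F \<longrightarrow>
        \<bar>(\<Sum>x\<in>F. signed_rate (initial_config N (T ` inside ?K \<union> T ` ?K)) x * window_weight N (T (\<gamma> t)) r p q \<delta> x) - G r\<bar> \<le> \<epsilon>"
        using main unfolding has_drift_limit_def by blast
      have "\<forall>\<^sub>F N in sequentially. \<bar>averaged_drift P X N (initial_config N \<Omega>) \<gamma> (\<gamma> t) r \<delta> - G r\<bar> \<le> \<epsilon>"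
        if \<delta>: "0 < \<delta>" "\<delta> < \<delta>0" for \<delta>
        using \<delta>0(2)[OF \<delta>] eventually_gt_at_top[of 0]
      proof eventually_elim
        case (elim N)
        define F where "F = {x. cell N x \<inter> (cball (\<gamma> t) r \<union> cball x0 \<delta> \<union> cball x1 \<delta>) \<noteq> {}}"
        have F: "finite F" unfolding F_def by (rule finite_cells_meeting_bounded[OF elim(2)]) auto
        have sub: "{x. cell N x \<inter> (cball (T (\<gamma> t)) r \<union> cball p \<delta> \<union> cball q \<delta>) \<noteq> {}} \<subseteq> S ` F"
        proof
          fix x assume "x \<in> {x. cell N x \<inter> (cball (T (\<gamma> t)) r \<union> cball p \<delta> \<union> cball q \<delta>) \<noteq> {}}"
          then obtain z where z: "z \<in> cell N x" "z \<in> cball (T (\<gamma> t)) r \<union> cball p \<delta> \<union> cball q \<delta>" by blast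
          have "T z \<in> cell N (S x)" unfolding cell_S using z(1) by simp
          moreover have "dist a (T z) = dist (T a) z" for a using dist_T[of a "T z"] by simp
          then have "T z \<in> cball (\<gamma> t) r \<union> cball x0 \<delta> \<union> cball x1 \<delta>" using z(2) x01(2) by auto
          ultimately have "S x \<in> F" unfolding F_def by blast
          then show "x \<in> S ` F" by (metis SS image_eqI)
        qed
        have "averaged_drift P X N (initial_config N \<Omega>) \<gamma> (\<gamma> t) r \<delta>
           = (\<Sum>x\<in>F. signed_rate (initial_config N \<Omega>) x * window_weight N (\<gamma> t) r x0 x1 \<delta> x)"
          by (rule averaged_drift_eq[OF elim(2) \<delta>(1) ising x01(1) F]) (simp add: F_def)
        also have "window_weight N (\<gamma> t) r x0 x1 \<delta> = window_weight N (\<gamma> t) r (T p) (T q) \<delta>"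
          using x01(2) window_weight_swap by auto
        also have "(\<Sum>x\<in>F. signed_rate (initial_config N \<Omega>) x * window_weight N (\<gamma> t) r (T p) (T q) \<delta> x)
          = (\<Sum>x\<in>S ` F. signed_rate (initial_config N (T ` inside ?K \<union> T ` ?K)) x * window_weight N (T (\<gamma> t)) r p q \<delta> x)"
          by (subst drift_sum_symmetric) (simp add: enclosed_region[OF \<Omega>] image_Un)
        finally show ?case using elim(1) F sub by simp
      qed
      then show "\<exists>\<delta>0>0. \<forall>\<delta>. 0 < \<delta> \<longrightarrow> \<delta> < \<delta>0 \<longrightarrow>
          (\<forall>\<^sub>F N in sequentially. \<bar>averaged_drift P X N (initial_config N \<Omega>) \<gamma> (\<gamma> t) r \<delta> - G r\<bar> \<le> \<epsilon>)"
        using \<delta>0(1) by blast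
    qed
  qed
  show "has_iterated_limit (\<lambda>r \<delta>. liminf (\<lambda>N. ereal (1 / (2 * r) * averaged_drift P X N (initial_config N \<Omega>) \<gamma> (\<gamma> t) r \<delta>)))
      (ereal L)"
    by (rule iterated_limits_of_approximation(1)[OF approx G(2)])
  show "has_iterated_limit (\<lambda>r \<delta>. limsup (\<lambda>N. ereal (1 / (2 * r) * averaged_drift P X N (initial_config N \<Omega>) \<gamma> (\<gamma> t) r \<delta>)))
      (ereal L)"
    by (rule iterated_limits_of_approximation(2)[OF approx G(2)])
qed

end

theorem proposition1:
  fixes W :: "'w measure"
    and P :: "config \<Rightarrow> 'w measure"
    and X :: "real \<Rightarrow> 'w \<Rightarrow> config"
    and \<gamma> :: "real \<Rightarrow> complex"
    and \<Omega> :: "complex set"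
    and s :: complex
    and t \<theta> :: real
  assumes "stochastic_ising W P X"
    and "C2_jordan_curve \<gamma>"
    and "encloses \<gamma> \<Omega>"
    and "s = \<gamma> t"
    and "vector_derivative \<gamma> (at t) \<in> span {cis \<theta>}"
  shows "has_iterated_limit
           (\<lambda>r \<delta>. liminf (\<lambda>N. ereal (1 / (2 * r) * averaged_drift P X N (initial_config N \<Omega>) \<gamma> s r \<delta>)))
           (ereal (- (1 / 2) * \<bar>cos (2 * \<theta>)\<bar> * curvature \<gamma> t))
       \<and> has_iterated_limit
           (\<lambda>r \<delta>. limsup (\<lambda>N. ereal (1 / (2 * r) * averaged_drift P X N (initial_config N \<Omega>) \<gamma> s r \<delta>)))
           (ereal (- (1 / 2) * \<bar>cos (2 * \<theta>)\<bar> * curvature \<gamma> t))"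
proof -
  interpret jordan_C2 \<gamma> by unfold_locales (rule assms(2))
  define a where "a = Re (velocity t)"
  define b where "b = Im (velocity t)"
  define a2 where "a2 = Re (acceleration t)"
  define b2 where "b2 = Im (acceleration t)"
  define n where "n = a\<^sup>2 + b\<^sup>2"
  have n: "n > 0"
    using regularity(4)[of t] by (auto simp: n_def a_def b_def complex_eq_iff sum_power2_gt_zero_iff)
  have curv: "curvature \<gamma> t = (a * b2 - a2 * b) / n powr (3/2)"
    by (simp add: curvature_def velocity_def acceleration_def a_def b_def a2_def b2_def n_def Let_def)
  obtain m where m: "velocity t = m *\<^sub>R cis \<theta>" using assms(5) by (auto simp: velocity_def span_singleton)
  have "a = m * cos \<theta>" "b = m * sin \<theta>" by (simp_all add: a_def b_def m)
  then have "a\<^sup>2 - b\<^sup>2 = m\<^sup>2 * cos (2 * \<theta>)" "n = m\<^sup>2"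
    by (simp_all add: n_def cos_double power_mult_distrib right_diff_distrib flip: distrib_left)
  then have cos2: "cos (2 * \<theta>) = (a\<^sup>2 - b\<^sup>2) / n" using n by simp
  show ?thesis
  proof (cases "\<bar>b\<bar> \<le> \<bar>a\<bar>")
    case True
    define \<rho> where "\<rho> = sgn a"
    have "a \<noteq> 0" using True n by (auto simp: n_def)
    then have \<rho>: "\<rho> = 1 \<or> \<rho> = -1" "\<rho> * a = \<bar>a\<bar>" "\<rho>\<^sup>2 = 1" by (auto simp: \<rho>_def sgn_if)
    have sym: "lattice_symmetry id id 1" by unfold_locales simp
    have v: "Re (id (of_real \<rho> * velocity t)) = \<rho> * a" "Im (id (of_real \<rho> * velocity t)) = \<rho> * b"
      "Re (id (acceleration t)) = a2" "Im (id (acceleration t)) = b2"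
      by (simp_all add: a_def b_def a2_def b2_def)
    have "b\<^sup>2 \<le> a\<^sup>2" using True by (simp add: abs_le_square_iff[symmetric])
    then have "\<bar>cos (2 * \<theta>)\<bar> = (a\<^sup>2 - b\<^sup>2) / n" using n by (simp add: cos2)
    then have L: "- (1 * \<rho> / 2) * (((\<rho> * a)\<^sup>2 - (\<rho> * b)\<^sup>2) / ((\<rho> * a)\<^sup>2 + (\<rho> * b)\<^sup>2)) *
        ((\<rho> * a * b2 - a2 * (\<rho> * b)) / ((\<rho> * a)\<^sup>2 + (\<rho> * b)\<^sup>2) powr (3/2)) = - (1 / 2) * \<bar>cos (2 * \<theta>)\<bar> * curvature \<gamma> t"
      unfolding curv power_mult_distrib \<rho>(3) mult_1 n_def[symmetric] using \<rho>(1) by (auto simp: field_simps)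
    have c: "Re (id (of_real \<rho> * velocity t)) > 0" "\<bar>Im (id (of_real \<rho> * velocity t))\<bar> \<le> Re (id (of_real \<rho> * velocity t))"
      unfolding v \<rho>(2) using \<open>a \<noteq> 0\<close> True \<rho>(1) by auto
    show ?thesis unfolding assms(4)
      using drift_limit_by_symmetry[OF sym \<rho>(1) assms(1,3) c, unfolded v L] by blast
  next
    case False
    define \<rho> where "\<rho> = sgn b"
    have "b \<noteq> 0" using False by auto
    then have \<rho>: "\<rho> = 1 \<or> \<rho> = -1" "\<rho> * b = \<bar>b\<bar>" "\<rho>\<^sup>2 = 1" by (auto simp: \<rho>_def sgn_if)
    define T where "T = (\<lambda>z. Complex (Im z) (Re z))"
    have sym: "lattice_symmetry T prod.swap (-1)" by unfold_locales (simp add: T_def)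
    have v: "Re (T (of_real \<rho> * velocity t)) = \<rho> * b" "Im (T (of_real \<rho> * velocity t)) = \<rho> * a"
      "Re (T (acceleration t)) = b2" "Im (T (acceleration t)) = a2"
      by (simp_all add: T_def a_def b_def a2_def b2_def)
    have "a\<^sup>2 \<le> b\<^sup>2" using False by (simp add: abs_le_square_iff[symmetric])
    then have cos: "\<bar>cos (2 * \<theta>)\<bar> = (b\<^sup>2 - a\<^sup>2) / n" using n by (simp add: cos2 abs_if divide_less_0_iff minus_divide_left)
    have nn: "b\<^sup>2 + a\<^sup>2 = n" by (simp add: n_def)
    have L: "- (- 1 * \<rho> / 2) * (((\<rho> * b)\<^sup>2 - (\<rho> * a)\<^sup>2) / ((\<rho> * b)\<^sup>2 + (\<rho> * a)\<^sup>2)) *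
        ((\<rho> * b * a2 - b2 * (\<rho> * a)) / ((\<rho> * b)\<^sup>2 + (\<rho> * a)\<^sup>2) powr (3/2)) = - (1 / 2) * \<bar>cos (2 * \<theta>)\<bar> * curvature \<gamma> t"
    proof -
      have z: "\<rho> * b * a2 - b2 * (\<rho> * a) = - \<rho> * (a * b2 - a2 * b)" by (simp add: algebra_simps)
      show ?thesis unfolding curv cos z power_mult_distrib \<rho>(3) mult_1 nn using \<rho>(1) by auto
    qed
    have c: "Re (T (of_real \<rho> * velocity t)) > 0" "\<bar>Im (T (of_real \<rho> * velocity t))\<bar> \<le> Re (T (of_real \<rho> * velocity t))"
      unfolding v \<rho>(2) using \<open>b \<noteq> 0\<close> False \<rho>(1) by auto
    show ?thesis unfolding assms(4)
      using drift_limit_by_symmetry[OF sym \<rho>(1) assms(1,3) c, unfolded v L] by blast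
  qed
qed

end
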